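(* Let $m$ be a multiplicity function and let $H$ be a filter relative to $m$ and $\alpha^*$ for which $S_H$ is a pure isometry. If $G$ and $G'$ are any two complementary filters to $H$, then the canonical GMRAs $\{V_j^{m,H,G}\}$ and $\{V_j^{m,H,G'}\}$ are equivalent.
   Context: Setting: $\Gamma$ is a countable (discrete) abelian group, $\alpha:\Gamma\to\Gamma$ is an injective homomorphism whose image has finite index $N>1$ in $\Gamma$, and $\bigcap_{n}\alpha^n(\Gamma)=\{0\}$. $\widehat\Gamma$ is the (compact) dual group, written multiplicatively, with Haar measure $\mu$. The dual endomorphism $\alpha^*:\widehat\Gamma\to\widehat\Gamma$, $[\alpha^*(\omega)](\gamma)=\omega(\alpha(\gamma))$, is onto and its kernel has exactly $N$ elements. Sets and functions on $\widehat\Gamma$ are considered up to Haar-null sets, identities and inequalities are understood almost everywhere, and $L^2(\sigma)$ for Borel $\sigma\subseteq\widehat\Gamma$ is taken with respect to Haar measure restricted to $\sigma$. A multiplicity function is a Borel function $m:\widehat\Gamma\to\{0,1,2,\dots\}$ with $m(\omega)\le\sum_{\alpha^*(\zeta)=\omega}m(\zeta)$. Put $\sigma_i=\{m\ge i\}$, $\widetilde m(\omega)=\sum_{\alpha^*(\zeta)=\omega}m(\zeta)-m(\omega)$, $\widetilde\sigma_k=\{\widetilde m\ge k\}$. A filter relative to $m$ and $\alpha^*$ is a (possibly infinite) matrix $H=[h_{i,j}]$ of Borel complex-valued functions on $\widehat\Gamma$, $h_{i,j}$ supported in $\sigma_j$, with $\sum_{\alpha^*(\zeta)=\omega}\sum_j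 h_{i,j}(\zeta)\overline{h_{i',j}(\zeta)}=N\delta_{i,i'}\chi_{\sigma_i}(\omega)$. A complementary filter to $H$ is a matrix $G=[g_{k,j}]$ of Borel complex-valued functions, $g_{k,j}$ supported in $\sigma_j$, with $\sum_{\alpha^*(\zeta)=\omega}\sum_j g_{k,j}(\zeta)\overline{g_{k',j}(\zeta)}=N\delta_{k,k'}\chi_{\widetilde\sigma_k}(\omega)$ and $\sum_{\alpha^*(\zeta)=\omega}\sum_j g_{k,j}(\zeta)\overline{h_{i,j}(\zeta)}=0$. The Ruelle operators are $S_H$ on $\bigoplus_iL^2(\sigma_i)$, $[S_H(f)](\omega)=H^t(\omega)f(\alpha^*(\omega))$, and $S_G:\bigoplus_kL^2(\widetilde\sigma_k)\to\bigoplus_iL^2(\sigma_i)$, $[S_G(f)](\omega)=G^t(\omega)f(\alpha^*(\omega))$. An isometry $S$ on $\mathcal K$ is pure if $\bigcap_{n\ge0}S^n(\mathcal K)=\{0\}$. Dilation by $\alpha^*$: fix a Borel cross-section $c$ of $\alpha^*$ (so $\alpha^*(c(\omega))=\omega$) and let $\tau(\omega)=c(\alpha^*(\omega))\omega^{-1}\in\ker\alpha^*$. Given $\mathcal K=\bigoplus_iL^2(E_i,\nu_i)$ (countable direct sum, $E_i\subseteq\widehat\Gamma$ Borel, $\nu_i$ a finite Borel measure on $E_i$), for $\zeta\in\ker\alpha^*$ put $E_{i,\zeta}=\{\omega\in E_i:\tau(\omega)=\zeta\}$, $E'_{i,\zeta}=\alpha^*(E_{i,\zeta})$, $\nu'_{i,\zeta}(F)=N\nu_i(E_{i,\zeta}\cap{\alpha^*}^{-1}(F))$,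 and $\mathcal D(\mathcal K)=\bigoplus_{i,\zeta}L^2(E'_{i,\zeta},\nu'_{i,\zeta})$, with $\mathcal D:\mathcal K\to\mathcal D(\mathcal K)$ the surjective isometry $[\mathcal D(f)]_{i,\zeta}(\omega)=\frac1{\sqrt N}f_i(\zeta^{-1}c(\omega))$. GMRA: let $\pi$ be a unitary representation of $\Gamma$ and $\delta$ a unitary operator on a separable Hilbert space $\mathcal H$ with $\delta^{-1}\pi_\gamma\delta=\pi_{\alpha(\gamma)}$ for all $\gamma$. A collection $\{V_j\}_{j\in\mathbb Z}$ of closed subspaces is a GMRA relative to $\pi$ and $\delta$ if $V_j\subseteq V_{j+1}$ and $V_{j+1}=\delta(V_j)$ for all $j$, $\bigcap_jV_j=\{0\}$, $\bigcup_jV_j$ is dense in $\mathcal H$, and $V_0$ is invariant under $\pi$. Canonical GMRA: for $m$, $H$ (with $S_H$ a pure isometry) and $G$ complementary to $H$, let $\mathcal V_0=\bigoplus_iL^2(\sigma_i)$, $\mathcal W_0=\bigoplus_kL^2(\widetilde\sigma_k)$, $\mathcal W_n=\mathcal D(\mathcal W_{n-1})$ for $n\ge1$, $\mathcal H=\mathcal V_0\oplus\bigoplus_{n\ge0}\mathcal W_n$; let $\Gamma$ act by $[\pi_\gamma(f)](\omega)=\omega(\gamma)f(\omega)$ and let $T$ be the unitary on $\mathcal H$ with $[T(f)]_{\mathcal V_0}=S_H(f_{\mathcal V_0})+S_G(f_{\mathcal W_0})$ and $[T(f)]_{\mathcal W_n}=\mathcal D^{-1}(f_{\mathcal W_{n+1}})$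 for $n\ge0$. Then $V_j^{m,H,G}=T^{-j}(\mathcal V_0)$, $j\in\mathbb Z$, is a GMRA relative to $\pi$ and $\delta=T^{-1}$, called the canonical GMRA with these parameters. Equivalence: GMRAs $\{V_j\}$ (in $\mathcal H$, relative to $\pi,\delta$) and $\{V'_j\}$ (in $\mathcal H'$, relative to $\pi',\delta'$) are equivalent if there is a unitary $U:\mathcal H\to\mathcal H'$ with $U(V_j)=V'_j$ for all $j$, $U\circ\pi_\gamma=\pi'_\gamma\circ U$ for all $\gamma\in\Gamma$, and $U\circ\delta=\delta'\circ U$. *)

theory Defs
  imports "HOL-Analysis.Analysis"
begin

section \<open>Hilbert spaces given by their operations\<close>

text \<open>The Hilbert spaces below depend on parameters (a multiplicity function, a cross-section), so
  they are carried by sets and not by types. The inner product is linear in the first argument.\<close>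

record 'a hilb =
  carr :: "'a set"
  hzero :: "'a"
  hadd :: "'a \<Rightarrow> 'a \<Rightarrow> 'a"
  hscale :: "complex \<Rightarrow> 'a \<Rightarrow> 'a"
  hip :: "'a \<Rightarrow> 'a \<Rightarrow> complex"

definition isometry_on :: "'a hilb \<Rightarrow> 'b hilb \<Rightarrow> ('a \<Rightarrow> 'b) \<Rightarrow> bool" where
  "isometry_on X Y U \<longleftrightarrow>
     (\<forall>f\<in>carr X. U f \<in> carr Y) \<and>
     (\<forall>f\<in>carr X. \<forall>g\<in>carr X. U (hadd X f g) = hadd Y (U f) (U g)) \<and>
     (\<forall>a. \<forall>f\<in>carr X. U (hscale X a f) = hscale Y a (U f)) \<and>
     (\<forall>f\<in>carr X. \<forall>g\<in>carr X. hip Y (U f) (U g) = hip X f g)"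

definition unitary_on :: "'a hilb \<Rightarrow> 'b hilb \<Rightarrow> ('a \<Rightarrow> 'b) \<Rightarrow> bool" where
  "unitary_on X Y U \<longleftrightarrow> isometry_on X Y U \<and> U ` carr X = carr Y"

definition pure_isometry :: "'a hilb \<Rightarrow> ('a \<Rightarrow> 'a) \<Rightarrow> bool" where
  "pure_isometry X S \<longleftrightarrow> isometry_on X X S \<and> (\<Inter>n. (S ^^ n) ` carr X) = {hzero X}"

definition hsum :: "'a hilb \<Rightarrow> 'b hilb \<Rightarrow> ('a \<times> 'b) hilb" where
  "hsum X Y = \<lparr>
     carr = carr X \<times> carr Y,
     hzero = (hzero X, hzero Y),
     hadd = (\<lambda>(f, g) (f', g'). (hadd X f f', hadd Y g g')),
     hscale = (\<lambda>a (f, g). (hscale X a f, hscale Y a g)),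
     hip = (\<lambda>(f, g) (f', g'). hip X f f' + hip Y g g')\<rparr>"

definition hsum_seq :: "(nat \<Rightarrow> 'a hilb) \<Rightarrow> (nat \<Rightarrow> 'a) hilb" where
  "hsum_seq X = \<lparr>
     carr = {w. (\<forall>n. w n \<in> carr (X n)) \<and> summable (\<lambda>n. Re (hip (X n) (w n) (w n)))},
     hzero = (\<lambda>n. hzero (X n)),
     hadd = (\<lambda>v w n. hadd (X n) (v n) (w n)),
     hscale = (\<lambda>a w n. hscale (X n) a (w n)),
     hip = (\<lambda>v w. \<Sum>n. hip (X n) (v n) (w n))\<rparr>"


section \<open>Direct sums of \<open>L\<^sup>2\<close>-spaces\<close>

text \<open>A pair \<open>(I, M)\<close> stands for the Hilbert space \<open>\<Oplus>i\<in>I. L\<^sup>2(M i)\<close>, whose elements are genuine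
  classes of families of functions modulo almost everywhere equality.\<close>

type_synonym ('i, 'x) l2fam = "'i set \<times> ('i \<Rightarrow> 'x measure)"

definition l2_fun :: "('i, 'x) l2fam \<Rightarrow> ('i \<Rightarrow> 'x \<Rightarrow> complex) set" where
  "l2_fun = (\<lambda>(I, M). {f.
     (\<forall>i\<in>I. f i \<in> borel_measurable (M i) \<and> integrable (M i) (\<lambda>x. (cmod (f i x))\<^sup>2)) \<and>
     (\<lambda>i. \<integral>x. (cmod (f i x))\<^sup>2 \<partial>M i) summable_on I})"

definition l2_class ::
    "('i, 'x) l2fam \<Rightarrow> ('i \<Rightarrow> 'x \<Rightarrow> complex) \<Rightarrow> ('i \<Rightarrow> 'x \<Rightarrow> complex) set" where
  "l2_class K f = {g \<in> l2_fun K. \<forall>i\<in>fst K. AE x in snd K i. g i x = f i x}"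

definition l2_rep :: "('i \<Rightarrow> 'x \<Rightarrow> complex) set \<Rightarrow> 'i \<Rightarrow> 'x \<Rightarrow> complex" where
  "l2_rep F = (SOME f. f \<in> F)"

definition l2_space :: "('i, 'x) l2fam \<Rightarrow> ('i \<Rightarrow> 'x \<Rightarrow> complex) set hilb" where
  "l2_space K = \<lparr>
     carr = l2_class K ` l2_fun K,
     hzero = l2_class K (\<lambda>i x. 0),
     hadd = (\<lambda>F G. l2_class K (\<lambda>i x. l2_rep F i x + l2_rep G i x)),
     hscale = (\<lambda>a F. l2_class K (\<lambda>i x. a * l2_rep F i x)),
     hip = (\<lambda>F G. \<Sum>\<^sub>\<infinity>i\<in>fst K. \<integral>x. l2_rep F i x * cnj (l2_rep G i x) \<partial>snd K i)\<rparr>"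

text \<open>The operator on classes induced by an operator on representatives; \<open>K\<close> is the codomain.\<close>

definition l2_lift :: "('j, 'x) l2fam \<Rightarrow> (('i \<Rightarrow> 'x \<Rightarrow> complex) \<Rightarrow> 'j \<Rightarrow> 'x \<Rightarrow> complex)
    \<Rightarrow> ('i \<Rightarrow> 'x \<Rightarrow> complex) set \<Rightarrow> ('j \<Rightarrow> 'x \<Rightarrow> complex) set" where
  "l2_lift K S F = l2_class K (S (l2_rep F))"


section \<open>The dual group\<close>

text \<open>The group is a countable type with the discrete topology, so the topology of its dual is
  that of pointwise convergence, i.e. the subspace topology of the product topology on functions.\<close>

type_synonym 'g dual = "'g \<Rightarrow> complex"

definition dual_group :: "'g::ab_group_add dual set" where
  "dual_group = {\<omega>. (\<forall>\<gamma>. cmod (\<omega> \<gamma>) = 1) \<and> (\<forall>\<gamma> \<eta>. \<omega> (\<gamma> + \<eta>) = \<omega> \<gamma> * \<omega> \<eta>)}"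

definition dmult :: "'g dual \<Rightarrow> 'g dual \<Rightarrow> 'g dual" where
  "dmult \<omega> \<zeta> = (\<lambda>\<gamma>. \<omega> \<gamma> * \<zeta> \<gamma>)"

definition dinv :: "'g dual \<Rightarrow> 'g dual" where
  "dinv \<omega> = (\<lambda>\<gamma>. inverse (\<omega> \<gamma>))"

definition haar :: "'g::{ab_group_add, countable} dual measure \<Rightarrow> bool" where
  "haar \<mu> \<longleftrightarrow>
     sets \<mu> = sets (restrict_space borel dual_group) \<and>
     emeasure \<mu> dual_group = 1 \<and>
     (\<forall>\<zeta>\<in>dual_group. \<forall>A\<in>sets \<mu>. emeasure \<mu> (dmult \<zeta> ` A) = emeasure \<mu> A)"

definition cosets :: "('g::ab_group_add \<Rightarrow> 'g) \<Rightarrow> 'g set set" where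
  "cosets \<alpha> = range (\<lambda>\<gamma>. (+) \<gamma> ` range \<alpha>)"

definition ind :: "('g::ab_group_add \<Rightarrow> 'g) \<Rightarrow> nat" where
  "ind \<alpha> = card (cosets \<alpha>)"

definition dual_endo :: "('g \<Rightarrow> 'g) \<Rightarrow> 'g dual \<Rightarrow> 'g dual" where
  "dual_endo \<alpha> \<omega> = (\<lambda>\<gamma>. \<omega> (\<alpha> \<gamma>))"

definition fibre :: "('g::ab_group_add \<Rightarrow> 'g) \<Rightarrow> 'g dual \<Rightarrow> 'g dual set" where
  "fibre \<alpha> \<omega> = {\<zeta> \<in> dual_group. dual_endo \<alpha> \<zeta> = \<omega>}"

definition dker :: "('g::ab_group_add \<Rightarrow> 'g) \<Rightarrow> 'g dual set" where
  "dker \<alpha> = fibre \<alpha> (\<lambda>\<gamma>. 1)"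

definition cross_section ::
    "('g::ab_group_add \<Rightarrow> 'g) \<Rightarrow> ('g dual \<Rightarrow> 'g dual) \<Rightarrow> bool" where
  "cross_section \<alpha> c \<longleftrightarrow>
     c \<in> restrict_space borel dual_group \<rightarrow>\<^sub>M restrict_space borel dual_group \<and>
     (\<forall>\<omega>\<in>dual_group. dual_endo \<alpha> (c \<omega>) = \<omega>)"


section \<open>Multiplicity functions, filters and Ruelle operators\<close>

definition multiplicity_function ::
    "('g::ab_group_add \<Rightarrow> 'g) \<Rightarrow> 'g dual measure \<Rightarrow> ('g dual \<Rightarrow> nat) \<Rightarrow> bool" where
  "multiplicity_function \<alpha> \<mu> m \<longleftrightarrow>
     m \<in> \<mu> \<rightarrow>\<^sub>M count_space UNIV \<and> (AE \<omega> in \<mu>. m \<omega> \<le> (\<Sum>\<zeta>\<in>fibre \<alpha> \<omega>. m \<zeta>))"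

text \<open>The subtraction is truncated only on the null set where the multiplicity inequality fails.\<close>

definition comp_mult ::
    "('g::ab_group_add \<Rightarrow> 'g) \<Rightarrow> ('g dual \<Rightarrow> nat) \<Rightarrow> 'g dual \<Rightarrow> nat" where
  "comp_mult \<alpha> m \<omega> = (\<Sum>\<zeta>\<in>fibre \<alpha> \<omega>. m \<zeta>) - m \<omega>"

definition level :: "('g::ab_group_add dual \<Rightarrow> nat) \<Rightarrow> nat \<Rightarrow> 'g dual set" where
  "level m i = {\<omega> \<in> dual_group. i \<le> m \<omega>}"

text \<open>Matrix indices and indices of the level sets range over \<open>1, 2, \<dots>\<close>. In \<open>fibre_ip\<close>, the
  sum over \<open>j\<close> has, for matrices supported in the level sets, finitely many nonzero terms at almost
  every point.\<close>

type_synonym 'g fmatrix = "nat \<Rightarrow> nat \<Rightarrow> 'g dual \<Rightarrow> complex"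

definition fibre_ip :: "('g::ab_group_add \<Rightarrow> 'g) \<Rightarrow> (nat \<Rightarrow> 'g dual \<Rightarrow> complex)
    \<Rightarrow> (nat \<Rightarrow> 'g dual \<Rightarrow> complex) \<Rightarrow> 'g dual \<Rightarrow> complex" where
  "fibre_ip \<alpha> a b \<omega> = (\<Sum>\<zeta>\<in>fibre \<alpha> \<omega>. \<Sum>\<^sub>\<infinity>j\<in>{1..}. a j \<zeta> * cnj (b j \<zeta>))"

definition supported_matrix ::
    "'g::ab_group_add dual measure \<Rightarrow> ('g dual \<Rightarrow> nat) \<Rightarrow> 'g fmatrix \<Rightarrow> bool" where
  "supported_matrix \<mu> m A \<longleftrightarrow>
     (\<forall>i\<ge>1. \<forall>j\<ge>1. A i j \<in> borel_measurable \<mu> \<and>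
        (AE \<omega> in \<mu>. \<omega> \<notin> level m j \<longrightarrow> A i j \<omega> = 0))"

definition filter_rel ::
    "('g::ab_group_add \<Rightarrow> 'g) \<Rightarrow> 'g dual measure \<Rightarrow> ('g dual \<Rightarrow> nat) \<Rightarrow> 'g fmatrix \<Rightarrow> bool" where
  "filter_rel \<alpha> \<mu> m H \<longleftrightarrow>
     supported_matrix \<mu> m H \<and>
     (\<forall>i\<ge>1. \<forall>i'\<ge>1. AE \<omega> in \<mu>.
        fibre_ip \<alpha> (H i) (H i') \<omega> = (if i = i' then of_nat (ind \<alpha>) * indicator (level m i) \<omega> else 0))"

definition complementary_filter :: "('g::ab_group_add \<Rightarrow> 'g) \<Rightarrow> 'g dual measure
    \<Rightarrow> ('g dual \<Rightarrow> nat) \<Rightarrow> 'g fmatrix \<Rightarrow> 'g fmatrix \<Rightarrow> bool" where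
  "complementary_filter \<alpha> \<mu> m H G \<longleftrightarrow>
     supported_matrix \<mu> m G \<and>
     (\<forall>k\<ge>1. \<forall>k'\<ge>1. AE \<omega> in \<mu>. fibre_ip \<alpha> (G k) (G k') \<omega> =
        (if k = k' then of_nat (ind \<alpha>) * indicator (level (comp_mult \<alpha> m) k) \<omega> else 0)) \<and>
     (\<forall>k\<ge>1. \<forall>i\<ge>1. AE \<omega> in \<mu>. fibre_ip \<alpha> (G k) (H i) \<omega> = 0)"

text \<open>The summands of all spaces are indexed by a positive integer and a list of elements of the
  kernel of the dual endomorphism: each dilation replaces an index \<open>(i, zs)\<close> by the indices
  \<open>(i, \<zeta> # zs)\<close>, which stand for the pairs \<open>((i, zs), \<zeta>)\<close>. The undilated spaces have the
  indices \<open>(i, [])\<close>.\<close>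

type_synonym 'g idx = "nat \<times> 'g dual list"
type_synonym 'g l2elt = "('g idx \<Rightarrow> 'g dual \<Rightarrow> complex) set"

definition level_fam :: "'g::ab_group_add dual measure \<Rightarrow> ('g dual \<Rightarrow> nat)
    \<Rightarrow> ('g idx, 'g dual) l2fam" where
  "level_fam \<mu> n = ({1..} \<times> {[]}, \<lambda>(i, zs). restrict_space \<mu> (level n i))"

text \<open>The operator with transposed matrix \<open>A\<^sup>t\<close>, defined on the direct sum of the \<open>L\<^sup>2\<close>-spaces over
  the level sets of \<open>n\<close>. The indicator function extends representatives by zero.\<close>

definition ruelle :: "('g::ab_group_add \<Rightarrow> 'g) \<Rightarrow> ('g dual \<Rightarrow> nat) \<Rightarrow> 'g fmatrix
    \<Rightarrow> ('g idx \<Rightarrow> 'g dual \<Rightarrow> complex) \<Rightarrow> 'g idx \<Rightarrow> 'g dual \<Rightarrow> complex" where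
  "ruelle \<alpha> n A f = (\<lambda>(j, zs) \<omega>. \<Sum>\<^sub>\<infinity>i\<in>{1..}. A i j \<omega> *
     (indicator (level n i) (dual_endo \<alpha> \<omega>) * f (i, []) (dual_endo \<alpha> \<omega>)))"

definition S_H :: "('g::ab_group_add \<Rightarrow> 'g) \<Rightarrow> 'g dual measure \<Rightarrow> ('g dual \<Rightarrow> nat) \<Rightarrow> 'g fmatrix
    \<Rightarrow> 'g l2elt \<Rightarrow> 'g l2elt" where
  "S_H \<alpha> \<mu> m H = l2_lift (level_fam \<mu> m) (ruelle \<alpha> m H)"

definition S_G :: "('g::ab_group_add \<Rightarrow> 'g) \<Rightarrow> 'g dual measure \<Rightarrow> ('g dual \<Rightarrow> nat) \<Rightarrow> 'g fmatrix
    \<Rightarrow> 'g l2elt \<Rightarrow> 'g l2elt" where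
  "S_G \<alpha> \<mu> m G = l2_lift (level_fam \<mu> m) (ruelle \<alpha> (comp_mult \<alpha> m) G)"


section \<open>Dilation by the dual endomorphism\<close>

definition tau :: "('g::ab_group_add \<Rightarrow> 'g) \<Rightarrow> ('g dual \<Rightarrow> 'g dual) \<Rightarrow> 'g dual \<Rightarrow> 'g dual" where
  "tau \<alpha> c \<omega> = dmult (c (dual_endo \<alpha> \<omega>)) (dinv \<omega>)"

definition dil_measure :: "('g::ab_group_add \<Rightarrow> 'g) \<Rightarrow> ('g dual \<Rightarrow> 'g dual) \<Rightarrow> 'g dual measure
    \<Rightarrow> 'g dual \<Rightarrow> 'g dual measure" where
  "dil_measure \<alpha> c \<nu> \<zeta> =
     (let E = {\<omega> \<in> space \<nu>. tau \<alpha> c \<omega> = \<zeta>}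
      in scale_measure (of_nat (ind \<alpha>))
           (distr (restrict_space \<nu> E) (restrict_space borel (dual_endo \<alpha> ` E)) (dual_endo \<alpha>)))"

definition dil_fam :: "('g::ab_group_add \<Rightarrow> 'g) \<Rightarrow> ('g dual \<Rightarrow> 'g dual)
    \<Rightarrow> ('g idx, 'g dual) l2fam \<Rightarrow> ('g idx, 'g dual) l2fam" where
  "dil_fam \<alpha> c = (\<lambda>(I, M).
     ({(i, \<zeta> # zs) | i \<zeta> zs. (i, zs) \<in> I \<and> \<zeta> \<in> dker \<alpha>},
      \<lambda>(i, zs). dil_measure \<alpha> c (M (i, tl zs)) (hd zs)))"

definition dil_fun :: "('g::ab_group_add \<Rightarrow> 'g) \<Rightarrow> ('g dual \<Rightarrow> 'g dual)
    \<Rightarrow> ('g idx \<Rightarrow> 'g dual \<Rightarrow> complex) \<Rightarrow> 'g idx \<Rightarrow> 'g dual \<Rightarrow> complex" where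
  "dil_fun \<alpha> c f = (\<lambda>(i, zs) \<omega>.
     f (i, tl zs) (dmult (dinv (hd zs)) (c \<omega>)) / of_real (sqrt (of_nat (ind \<alpha>))))"

definition dil :: "('g::ab_group_add \<Rightarrow> 'g) \<Rightarrow> ('g dual \<Rightarrow> 'g dual)
    \<Rightarrow> ('g idx, 'g dual) l2fam \<Rightarrow> 'g l2elt \<Rightarrow> 'g l2elt" where
  "dil \<alpha> c K = l2_lift (dil_fam \<alpha> c K) (dil_fun \<alpha> c)"


section \<open>Generalized multiresolution analyses\<close>

text \<open>The Hilbert space, the representation \<open>\<pi>\<close>, the operator \<open>\<delta>\<close> and the subspaces \<open>V\<^sub>j\<close> of a
  GMRA. Equivalence is a condition on these data alone; it does not involve the GMRA axioms.\<close>

record ('g, 'h) gmra_data =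
  gspace :: "'h hilb"
  grep :: "'g \<Rightarrow> 'h \<Rightarrow> 'h"
  gdil :: "'h \<Rightarrow> 'h"
  glevel :: "int \<Rightarrow> 'h set"

definition gmra_equivalent :: "('g, 'h) gmra_data \<Rightarrow> ('g, 'k) gmra_data \<Rightarrow> bool" where
  "gmra_equivalent A B \<longleftrightarrow> (\<exists>U.
     unitary_on (gspace A) (gspace B) U \<and>
     (\<forall>j. U ` glevel A j = glevel B j) \<and>
     (\<forall>\<gamma>. \<forall>f\<in>carr (gspace A). U (grep A \<gamma> f) = grep B \<gamma> (U f)) \<and>
     (\<forall>f\<in>carr (gspace A). U (gdil A f) = gdil B (U f)))"

definition W_fam :: "('g::ab_group_add \<Rightarrow> 'g) \<Rightarrow> 'g dual measure \<Rightarrow> ('g dual \<Rightarrow> 'g dual)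
    \<Rightarrow> ('g dual \<Rightarrow> nat) \<Rightarrow> nat \<Rightarrow> ('g idx, 'g dual) l2fam" where
  "W_fam \<alpha> \<mu> c m n = (dil_fam \<alpha> c ^^ n) (level_fam \<mu> (comp_mult \<alpha> m))"

type_synonym 'g can_elt = "'g l2elt \<times> (nat \<Rightarrow> 'g l2elt)"

definition can_space :: "('g::ab_group_add \<Rightarrow> 'g) \<Rightarrow> 'g dual measure \<Rightarrow> ('g dual \<Rightarrow> 'g dual)
    \<Rightarrow> ('g dual \<Rightarrow> nat) \<Rightarrow> 'g can_elt hilb" where
  "can_space \<alpha> \<mu> c m =
     hsum (l2_space (level_fam \<mu> m)) (hsum_seq (\<lambda>n. l2_space (W_fam \<alpha> \<mu> c m n)))"

definition can_rep :: "('g::ab_group_add \<Rightarrow> 'g) \<Rightarrow> 'g dual measure \<Rightarrow> ('g dual \<Rightarrow> 'g dual)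
    \<Rightarrow> ('g dual \<Rightarrow> nat) \<Rightarrow> 'g \<Rightarrow> 'g can_elt \<Rightarrow> 'g can_elt" where
  "can_rep \<alpha> \<mu> c m \<gamma> = (\<lambda>(v, w).
     (l2_lift (level_fam \<mu> m) (\<lambda>f i \<omega>. \<omega> \<gamma> * f i \<omega>) v,
      \<lambda>n. l2_lift (W_fam \<alpha> \<mu> c m n) (\<lambda>f i \<omega>. \<omega> \<gamma> * f i \<omega>) (w n)))"

definition can_T :: "('g::ab_group_add \<Rightarrow> 'g) \<Rightarrow> 'g dual measure \<Rightarrow> ('g dual \<Rightarrow> 'g dual)
    \<Rightarrow> ('g dual \<Rightarrow> nat) \<Rightarrow> 'g fmatrix \<Rightarrow> 'g fmatrix \<Rightarrow> 'g can_elt \<Rightarrow> 'g can_elt" where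
  "can_T \<alpha> \<mu> c m H G = (\<lambda>(v, w).
     (hadd (l2_space (level_fam \<mu> m)) (S_H \<alpha> \<mu> m H v) (S_G \<alpha> \<mu> m G (w 0)),
      \<lambda>n. inv_into (carr (l2_space (W_fam \<alpha> \<mu> c m n))) (dil \<alpha> c (W_fam \<alpha> \<mu> c m n)) (w (Suc n))))"

definition can_V0 :: "('g::ab_group_add \<Rightarrow> 'g) \<Rightarrow> 'g dual measure \<Rightarrow> ('g dual \<Rightarrow> 'g dual)
    \<Rightarrow> ('g dual \<Rightarrow> nat) \<Rightarrow> 'g can_elt set" where
  "can_V0 \<alpha> \<mu> c m =
     carr (l2_space (level_fam \<mu> m)) \<times> {\<lambda>n. hzero (l2_space (W_fam \<alpha> \<mu> c m n))}"

definition can_delta :: "('g::ab_group_add \<Rightarrow> 'g) \<Rightarrow> 'g dual measure \<Rightarrow> ('g dual \<Rightarrow> 'g dual)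
    \<Rightarrow> ('g dual \<Rightarrow> nat) \<Rightarrow> 'g fmatrix \<Rightarrow> 'g fmatrix \<Rightarrow> 'g can_elt \<Rightarrow> 'g can_elt" where
  "can_delta \<alpha> \<mu> c m H G = inv_into (carr (can_space \<alpha> \<mu> c m)) (can_T \<alpha> \<mu> c m H G)"

definition canonical_gmra :: "('g::ab_group_add \<Rightarrow> 'g) \<Rightarrow> 'g dual measure
    \<Rightarrow> ('g dual \<Rightarrow> 'g dual) \<Rightarrow> ('g dual \<Rightarrow> nat) \<Rightarrow> 'g fmatrix \<Rightarrow> 'g fmatrix
    \<Rightarrow> ('g, 'g can_elt) gmra_data" where
  "canonical_gmra \<alpha> \<mu> c m H G = \<lparr>
     gspace = can_space \<alpha> \<mu> c m,
     grep = can_rep \<alpha> \<mu> c m,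
     gdil = can_delta \<alpha> \<mu> c m H G,
     glevel = (\<lambda>j. if 0 \<le> j then (can_delta \<alpha> \<mu> c m H G ^^ nat j) ` can_V0 \<alpha> \<mu> c m
                   else (can_T \<alpha> \<mu> c m H G ^^ nat (- j)) ` can_V0 \<alpha> \<mu> c m)\<rparr>"

end

theory Submission
  imports Defs
begin

text \<open>
  The two canonical GMRAs have the same Hilbert space, the same representation and the same core
  space; they differ only in the component \<open>S\<^sub>G\<close> of the operator \<open>T\<close>. The equivalence is the
  identity on \<open>\<V>\<^sub>0\<close>, the operator \<open>u\<^sub>0 = S\<^sub>G\<^sub>'\<^sup>-\<^sup>1 S\<^sub>G\<close> on \<open>\<W>\<^sub>0\<close>, and its transport
  \<open>u\<^sub>n\<^sub>+\<^sub>1 = \<D> u\<^sub>n \<D>\<^sup>-\<^sup>1\<close> through the dilations. This choice makes it intertwine \<open>T\<close> and \<open>T'\<close> by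
  construction, and hence the dilations \<open>T\<^sup>-\<^sup>1\<close> and \<open>T'\<^sup>-\<^sup>1\<close> as well as all the subspaces \<open>V\<^sub>j\<close>, which
  are images of \<open>\<V>\<^sub>0\<close> under powers of these operators.

  The point is that \<open>u\<^sub>0\<close> exists and is unitary, i.e. that \<open>S\<^sub>G\<close> and \<open>S\<^sub>G\<^sub>'\<close> have the same range. Over a
  point \<open>\<omega>\<close>, the values of an element of \<open>\<V>\<^sub>0\<close> on the fibre of \<open>\<omega>\<close> form a vector in a space of
  dimension \<open>\<Sum>\<zeta>. m \<zeta> = m \<omega> + m' \<omega>\<close>, where \<open>m'\<close> is the complementary multiplicity function. The filter
  equations say that the first \<open>m \<omega>\<close> rows of \<open>H\<close> and the first \<open>m' \<omega>\<close> rows of \<open>G\<close> are orthogonal vectors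
  of squared length \<open>N\<close> in this space (lemma \<open>AE_orthogonal_basis\<close>); their number equals the
  dimension, so they form a basis (\<open>orthogonal_rows_imp_columns\<close>). Therefore every element of
  \<open>\<V>\<^sub>0\<close> is \<open>S\<^sub>H v + S\<^sub>G w\<close> for exactly one pair \<open>(v, w)\<close> (\<open>S_sum_bij\<close>), so that \<open>T\<close> is a bijection, and the
  range of \<open>S\<^sub>G\<close> consists of the elements whose coefficients along the rows of \<open>H\<close> vanish, a
  condition that does not mention \<open>G\<close> (\<open>S_G_range_contains\<close>).

  Both \<open>S\<^sub>G\<close> and \<open>S\<^sub>G\<^sub>'\<close> multiply squared norms by the same constant, \<open>N\<close> divided by the order of the
  kernel of \<open>\<alpha>\<^sup>*\<close>, so \<open>u\<^sub>0\<close> preserves norms. Both turn the action of \<open>\<gamma>\<close> into that of \<open>\<alpha> \<gamma>\<close>, and so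
  does \<open>\<D>\<^sup>-\<^sup>1\<close>; hence all \<open>u\<^sub>n\<close> commute with the action of the group.

  Pointwise statements over \<open>\<omega>\<close> are turned into statements about functions on the dual group by
  \<open>nn_integral_fibre\<close> and \<open>AE_fibre\<close>, which rest on the invariance of Haar measure under \<open>\<alpha>\<^sup>*\<close>
  (\<open>distr_endo\<close>).\<close>

section \<open>Operators on square-integrable families\<close>

text \<open>The squared norm, with values in the extended nonnegative reals: norms of images under operators
  can then be computed by exchanging sums and integrals before anything is known to be finite.\<close>

definition l2_sqnorm :: "('i, 'x) l2fam \<Rightarrow> ('i \<Rightarrow> 'x \<Rightarrow> complex) \<Rightarrow> ennreal" where
  "l2_sqnorm K f =
     (\<integral>\<^sup>+i. (\<integral>\<^sup>+x. ennreal ((cmod (f i x))\<^sup>2) \<partial>snd K i) \<partial>count_space (fst K))"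

lemma nn_integral_count_space_summable:
  fixes a :: "'i \<Rightarrow> real"
  assumes "a summable_on I" "\<And>i. i \<in> I \<Longrightarrow> 0 \<le> a i"
  shows "(\<integral>\<^sup>+i. ennreal (a i) \<partial>count_space I) = ennreal (\<Sum>\<^sub>\<infinity>i\<in>I. a i)"
proof -
  have "(\<lambda>i. norm (a i)) summable_on I"
    using assms by (simp cong: summable_on_cong)
  then have abs: "Infinite_Set_Sum.abs_summable_on a I"
    using abs_summable_equivalent by blast
  then have "integrable (count_space I) a" by (simp add: Infinite_Set_Sum.abs_summable_on_def)
  then have "(\<integral>\<^sup>+i. ennreal (a i) \<partial>count_space I) = ennreal (infsetsum a I)"
    unfolding infsetsum_def by (intro nn_integral_eq_integral) (auto simp: AE_count_space assms)
  then show ?thesis using infsetsum_infsum[OF abs] by simp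
qed

lemma summable_on_if_nn_integral_finite:
  fixes a :: "'i \<Rightarrow> real"
  assumes "(\<integral>\<^sup>+i. ennreal (a i) \<partial>count_space I) < \<infinity>" "\<And>i. i \<in> I \<Longrightarrow> 0 \<le> a i"
  shows "a summable_on I"
proof -
  have "integrable (count_space I) a"
    using assms by (intro integrableI_nonneg) (auto simp: AE_count_space)
  then have "Infinite_Set_Sum.abs_summable_on a I" by (simp add: Infinite_Set_Sum.abs_summable_on_def)
  then have "(\<lambda>i. norm (a i)) summable_on I"
    using abs_summable_equivalent by blast
  then show ?thesis using assms(2) by (simp cong: summable_on_cong)
qed

lemma l2_sqnorm_eq:
  assumes "f \<in> l2_fun K"
  shows "l2_sqnorm K f = ennreal (\<Sum>\<^sub>\<infinity>i\<in>fst K. \<integral>x. (cmod (f i x))\<^sup>2 \<partial>snd K i)"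
proof -
  have "l2_sqnorm K f = (\<integral>\<^sup>+i. ennreal (\<integral>x. (cmod (f i x))\<^sup>2 \<partial>snd K i) \<partial>count_space (fst K))"
    unfolding l2_sqnorm_def using assms
    by (intro nn_integral_cong nn_integral_eq_integral)
       (auto simp: l2_fun_def split: prod.splits)
  also have "\<dots> = ennreal (\<Sum>\<^sub>\<infinity>i\<in>fst K. \<integral>x. (cmod (f i x))\<^sup>2 \<partial>snd K i)"
    using assms by (intro nn_integral_count_space_summable)
      (auto simp: l2_fun_def split: prod.splits)
  finally show ?thesis .
qed

lemma l2_fun_iff:
  "f \<in> l2_fun K \<longleftrightarrow> (\<forall>i\<in>fst K. f i \<in> borel_measurable (snd K i)) \<and> l2_sqnorm K f < \<infinity>"
proof
  assume f: "f \<in> l2_fun K"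
  then show "(\<forall>i\<in>fst K. f i \<in> borel_measurable (snd K i)) \<and> l2_sqnorm K f < \<infinity>"
    using l2_sqnorm_eq[OF f] by (auto simp: l2_fun_def split: prod.splits)
next
  assume f: "(\<forall>i\<in>fst K. f i \<in> borel_measurable (snd K i)) \<and> l2_sqnorm K f < \<infinity>"
  have int: "integrable (snd K i) (\<lambda>x. (cmod (f i x))\<^sup>2)" if i: "i \<in> fst K" for i
  proof (rule integrableI_nonneg)
    show "(\<lambda>x. (cmod (f i x))\<^sup>2) \<in> borel_measurable (snd K i)" using f i by auto
    have "(\<integral>\<^sup>+x. ennreal ((cmod (f i x))\<^sup>2) \<partial>snd K i) \<le> l2_sqnorm K f"
      unfolding l2_sqnorm_def by (rule nn_integral_ge_point[OF i])
    also have "\<dots> < \<infinity>" using f by simp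
    finally show "(\<integral>\<^sup>+x. ennreal ((cmod (f i x))\<^sup>2) \<partial>snd K i) < \<infinity>" .
  qed auto
  have "l2_sqnorm K f = (\<integral>\<^sup>+i. ennreal (\<integral>x. (cmod (f i x))\<^sup>2 \<partial>snd K i) \<partial>count_space (fst K))"
    unfolding l2_sqnorm_def by (intro nn_integral_cong nn_integral_eq_integral) (auto simp: int)
  then have "(\<lambda>i. \<integral>x. (cmod (f i x))\<^sup>2 \<partial>snd K i) summable_on fst K"
    using f by (intro summable_on_if_nn_integral_finite) auto
  then show "f \<in> l2_fun K"
    using f int by (auto simp: l2_fun_def split: prod.splits)
qed

lemma l2_fun_measurable: "f \<in> l2_fun K \<Longrightarrow> i \<in> fst K \<Longrightarrow> f i \<in> borel_measurable (snd K i)"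
  by (simp add: l2_fun_iff)

lemma l2_sqnorm_cong_AE:
  assumes "\<And>i. i \<in> fst K \<Longrightarrow> AE x in snd K i. f i x = g i x"
  shows "l2_sqnorm K f = l2_sqnorm K g"
  unfolding l2_sqnorm_def
proof (rule nn_integral_cong)
  fix i assume "i \<in> space (count_space (fst K))"
  then have "AE x in snd K i. f i x = g i x" using assms by simp
  then have "AE x in snd K i. ennreal ((cmod (f i x))\<^sup>2) = ennreal ((cmod (g i x))\<^sup>2)"
    by eventually_elim simp
  then show "(\<integral>\<^sup>+x. ennreal ((cmod (f i x))\<^sup>2) \<partial>snd K i) = (\<integral>\<^sup>+x. ennreal ((cmod (g i x))\<^sup>2) \<partial>snd K i)"
    by (rule nn_integral_cong_AE)
qed

lemma l2_sqnorm_eq_0D: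
  assumes "f \<in> l2_fun K" "l2_sqnorm K f = 0" "i \<in> fst K"
  shows "AE x in snd K i. f i x = 0"
proof -
  have "(\<integral>\<^sup>+x. ennreal ((cmod (f i x))\<^sup>2) \<partial>snd K i) \<le> l2_sqnorm K f"
    unfolding l2_sqnorm_def by (rule nn_integral_ge_point[OF assms(3)])
  then have "(\<integral>\<^sup>+x. ennreal ((cmod (f i x))\<^sup>2) \<partial>snd K i) = 0" using assms by simp
  then have "AE x in snd K i. ennreal ((cmod (f i x))\<^sup>2) = 0"
    using l2_fun_measurable[OF assms(1,3)] by (subst (asm) nn_integral_0_iff_AE) auto
  then show ?thesis by (auto elim!: AE_mp simp: ennreal_eq_0_iff)
qed

lemma l2_fun_0: "(\<lambda>i x. 0) \<in> l2_fun K"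
  by (simp add: l2_fun_iff l2_sqnorm_def)

lemma l2_fun_scale:
  assumes "f \<in> l2_fun K"
  shows "(\<lambda>i x. a * f i x) \<in> l2_fun K"
proof -
  have "l2_sqnorm K (\<lambda>i x. a * f i x) = ennreal ((cmod a)\<^sup>2) * l2_sqnorm K f"
  proof -
    have "l2_sqnorm K (\<lambda>i x. a * f i x) =
        (\<integral>\<^sup>+i. ennreal ((cmod a)\<^sup>2) * (\<integral>\<^sup>+x. ennreal ((cmod (f i x))\<^sup>2) \<partial>snd K i) \<partial>count_space (fst K))"
      unfolding l2_sqnorm_def
    proof (rule nn_integral_cong)
      fix i assume "i \<in> space (count_space (fst K))"
      then have "f i \<in> borel_measurable (snd K i)" using assms by (auto simp: l2_fun_iff)
      then show "(\<integral>\<^sup>+x. ennreal ((cmod (a * f i x))\<^sup>2) \<partial>snd K i) =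
          ennreal ((cmod a)\<^sup>2) * (\<integral>\<^sup>+x. ennreal ((cmod (f i x))\<^sup>2) \<partial>snd K i)"
        by (subst nn_integral_cmult[symmetric])
           (auto simp: norm_mult power_mult_distrib ennreal_mult)
    qed
    then show ?thesis by (simp add: l2_sqnorm_def nn_integral_cmult)
  qed
  then show ?thesis
    using assms by (auto simp: l2_fun_iff ennreal_mult_less_top)
qed

lemma l2_fun_add:
  assumes f: "f \<in> l2_fun K" and g: "g \<in> l2_fun K"
  shows "(\<lambda>i x. f i x + g i x) \<in> l2_fun K"
proof -
  have le: "(cmod (z + w))\<^sup>2 \<le> 2 * (cmod z)\<^sup>2 + 2 * (cmod w)\<^sup>2" for z w
  proof -
    have "(cmod (z + w))\<^sup>2 \<le> (cmod z + cmod w)\<^sup>2"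
      by (intro power_mono norm_triangle_ineq) auto
    also have "\<dots> \<le> 2 * (cmod z)\<^sup>2 + 2 * (cmod w)\<^sup>2"
      using zero_le_power2[of "cmod z - cmod w"] by (simp add: power2_eq_square algebra_simps)
    finally show ?thesis .
  qed
  have "l2_sqnorm K (\<lambda>i x. f i x + g i x) \<le>
      (\<integral>\<^sup>+i. 2 * (\<integral>\<^sup>+x. ennreal ((cmod (f i x))\<^sup>2) \<partial>snd K i)
        + 2 * (\<integral>\<^sup>+x. ennreal ((cmod (g i x))\<^sup>2) \<partial>snd K i) \<partial>count_space (fst K))"
    unfolding l2_sqnorm_def
  proof (rule nn_integral_mono)
    fix i assume "i \<in> space (count_space (fst K))"
    then have [measurable]: "f i \<in> borel_measurable (snd K i)" "g i \<in> borel_measurable (snd K i)"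
      using f g by (auto simp: l2_fun_iff)
    have "(\<integral>\<^sup>+x. ennreal ((cmod (f i x + g i x))\<^sup>2) \<partial>snd K i) \<le>
      (\<integral>\<^sup>+x. 2 * ennreal ((cmod (f i x))\<^sup>2) + 2 * ennreal ((cmod (g i x))\<^sup>2) \<partial>snd K i)"
    proof (rule nn_integral_mono)
      fix x
      have "ennreal ((cmod (f i x + g i x))\<^sup>2) \<le> ennreal (2 * (cmod (f i x))\<^sup>2 + 2 * (cmod (g i x))\<^sup>2)"
        by (intro ennreal_leI le)
      then show "ennreal ((cmod (f i x + g i x))\<^sup>2)
          \<le> 2 * ennreal ((cmod (f i x))\<^sup>2) + 2 * ennreal ((cmod (g i x))\<^sup>2)"
        by (simp add: ennreal_mult)
    qed
    also have "\<dots> = 2 * (\<integral>\<^sup>+x. ennreal ((cmod (f i x))\<^sup>2) \<partial>snd K i)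
        + 2 * (\<integral>\<^sup>+x. ennreal ((cmod (g i x))\<^sup>2) \<partial>snd K i)"
      by (simp add: nn_integral_add nn_integral_cmult)
    finally show "(\<integral>\<^sup>+x. ennreal ((cmod (f i x + g i x))\<^sup>2) \<partial>snd K i) \<le> \<dots>" .
  qed
  also have "\<dots> = 2 * l2_sqnorm K f + 2 * l2_sqnorm K g"
    by (simp add: l2_sqnorm_def nn_integral_add nn_integral_cmult)
  also have "\<dots> < \<infinity>" using f g by (simp add: l2_fun_iff ennreal_mult_less_top)
  finally show ?thesis
    using f g by (auto simp: l2_fun_iff intro!: borel_measurable_add)
qed

lemma l2_fun_combine:
  "f \<in> l2_fun K \<Longrightarrow> g \<in> l2_fun K \<Longrightarrow> (\<lambda>i x. f i x + a * g i x) \<in> l2_fun K"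
  using l2_fun_add[OF _ l2_fun_scale] by blast

lemma l2_class_cong:
  assumes "\<And>i. i \<in> fst K \<Longrightarrow> AE x in snd K i. f i x = g i x"
  shows "l2_class K f = l2_class K g"
  unfolding l2_class_def
proof (intro Collect_cong conj_cong refl ball_cong)
  fix h :: "'a \<Rightarrow> 'b \<Rightarrow> complex" and i assume "i \<in> fst K"
  note eq = assms[OF this]
  show "(AE x in snd K i. h i x = f i x) = (AE x in snd K i. h i x = g i x)"
  proof
    assume "AE x in snd K i. h i x = f i x"
    with eq show "AE x in snd K i. h i x = g i x" by eventually_elim simp
  next
    assume "AE x in snd K i. h i x = g i x"
    with eq show "AE x in snd K i. h i x = f i x" by eventually_elim simp
  qed
qed

lemma l2_class_eq_iff:
  assumes "f \<in> l2_fun K"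
  shows "l2_class K f = l2_class K g \<longleftrightarrow> (\<forall>i\<in>fst K. AE x in snd K i. f i x = g i x)"
proof
  assume "l2_class K f = l2_class K g"
  moreover have "f \<in> l2_class K f" using assms by (simp add: l2_class_def)
  ultimately show "\<forall>i\<in>fst K. AE x in snd K i. f i x = g i x" by (simp add: l2_class_def)
qed (rule l2_class_cong, blast)

lemma l2_rep_class:
  assumes "f \<in> l2_fun K"
  shows "l2_rep (l2_class K f) \<in> l2_fun K"
    and "i \<in> fst K \<Longrightarrow> AE x in snd K i. l2_rep (l2_class K f) i x = f i x"
proof -
  have "f \<in> l2_class K f" using assms by (simp add: l2_class_def)
  then have "l2_rep (l2_class K f) \<in> l2_class K f" unfolding l2_rep_def
    by (rule someI[where P = "\<lambda>h. h \<in> l2_class K f"])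
  then show "l2_rep (l2_class K f) \<in> l2_fun K"
    and "i \<in> fst K \<Longrightarrow> AE x in snd K i. l2_rep (l2_class K f) i x = f i x"
    by (auto simp: l2_class_def)
qed

lemma carr_l2_space: "carr (l2_space K) = l2_class K ` l2_fun K"
  by (simp add: l2_space_def)

lemma carr_rep:
  assumes "F \<in> carr (l2_space K)"
  shows "l2_rep F \<in> l2_fun K" "l2_class K (l2_rep F) = F"
proof -
  obtain f where f: "f \<in> l2_fun K" "F = l2_class K f" using assms by (auto simp: carr_l2_space)
  show "l2_rep F \<in> l2_fun K" using l2_rep_class(1)[OF f(1)] f by simp
  show "l2_class K (l2_rep F) = F"
    unfolding f(2) by (rule l2_class_cong) (rule l2_rep_class(2)[OF f(1)])
qed

lemma hadd_l2_class:
  assumes "f \<in> l2_fun K" "g \<in> l2_fun K"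
  shows "hadd (l2_space K) (l2_class K f) (l2_class K g) = l2_class K (\<lambda>i x. f i x + g i x)"
  unfolding l2_space_def hilb.simps
proof (rule l2_class_cong)
  fix i assume "i \<in> fst K"
  from l2_rep_class(2)[OF assms(1) this] l2_rep_class(2)[OF assms(2) this]
  show "AE x in snd K i. l2_rep (l2_class K f) i x + l2_rep (l2_class K g) i x = f i x + g i x"
    by eventually_elim simp
qed

lemma hscale_l2_class:
  assumes "f \<in> l2_fun K"
  shows "hscale (l2_space K) a (l2_class K f) = l2_class K (\<lambda>i x. a * f i x)"
  unfolding l2_space_def hilb.simps
proof (rule l2_class_cong)
  fix i assume "i \<in> fst K"
  from l2_rep_class(2)[OF assms(1) this]
  show "AE x in snd K i. a * l2_rep (l2_class K f) i x = a * f i x"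
    by eventually_elim simp
qed

definition l2_ip :: "('i, 'x) l2fam \<Rightarrow> ('i \<Rightarrow> 'x \<Rightarrow> complex) \<Rightarrow> ('i \<Rightarrow> 'x \<Rightarrow> complex) \<Rightarrow> complex" where
  "l2_ip K f g = (\<Sum>\<^sub>\<infinity>i\<in>fst K. \<integral>x. f i x * cnj (g i x) \<partial>snd K i)"

text \<open>Inner products are determined by norms. Hence an operator that scales norms scales inner
  products, and only norms have to be computed below.\<close>

lemma l2_polarization:
  assumes f: "f \<in> l2_fun K" and g: "g \<in> l2_fun K"
  defines "q \<equiv> \<lambda>a. of_real (enn2real (l2_sqnorm K (\<lambda>i x. f i x + a * g i x))) :: complex"
  shows "4 * l2_ip K f g = q 1 - q (-1) + \<i> * q \<i> - \<i> * q (-\<i>)"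
proof -
  define n where "n = (\<lambda>a i. complex_of_real (\<integral>x. (cmod (f i x + a * g i x))\<^sup>2 \<partial>snd K i))"
  have comb: "(\<lambda>i x. f i x + a * g i x) \<in> l2_fun K" for a
    by (rule l2_fun_combine[OF f g])
  have int: "integrable (snd K i) (\<lambda>x. complex_of_real ((cmod (f i x + a * g i x))\<^sup>2))"
    if "i \<in> fst K" for a i
    using comb[of a] that unfolding complex_of_real_integrable_eq
    by (auto simp: l2_fun_def split: prod.splits)
  have sm: "(\<lambda>i. \<integral>x. (cmod (f i x + a * g i x))\<^sup>2 \<partial>snd K i) summable_on fst K" for a
    using comb[of a] by (auto simp: l2_fun_def split: prod.splits)
  have sum_n: "n a summable_on fst K" for a
    unfolding n_def using sm[of a] by (rule summable_on_of_real)
  have q: "q a = infsum (n a) (fst K)" for a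
  proof -
    have "infsum (n a) (fst K) = of_real (\<Sum>\<^sub>\<infinity>i\<in>fst K. \<integral>x. (cmod (f i x + a * g i x))\<^sup>2 \<partial>snd K i)"
      unfolding n_def using sm[of a] by (intro infsumI) (simp only: has_sum_of_real_iff has_sum_infsum)
    then show ?thesis
      unfolding q_def l2_sqnorm_eq[OF comb]
      by (subst enn2real_ennreal) (auto intro!: infsum_nonneg)
  qed
  have pt: "4 * (z * cnj w) = of_real ((cmod (z + 1 * w))\<^sup>2) - of_real ((cmod (z + (-1) * w))\<^sup>2)
      + \<i> * of_real ((cmod (z + \<i> * w))\<^sup>2) - \<i> * of_real ((cmod (z + (-\<i>) * w))\<^sup>2)" for z w
    unfolding complex_norm_square by (simp add: algebra_simps)
  have "4 * (\<integral>x. f i x * cnj (g i x) \<partial>snd K i) = n 1 i - n (-1) i + \<i> * n \<i> i - \<i> * n (-\<i>) i"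
    if i: "i \<in> fst K" for i
  proof -
    have "4 * (\<integral>x. f i x * cnj (g i x) \<partial>snd K i) = (\<integral>x. 4 * (f i x * cnj (g i x)) \<partial>snd K i)"
      by simp
    also have "\<dots> = n 1 i - n (-1) i + \<i> * n \<i> i - \<i> * n (-\<i>) i"
      unfolding pt n_def integral_complex_of_real[symmetric]
      using int[OF i, of 1] int[OF i, of "-1"] int[OF i, of \<i>] int[OF i, of "-\<i>"]
      by (simp del: of_real_power)
    finally show ?thesis .
  qed
  moreover have neg: "((\<lambda>i. - u i) has_sum - a) A" if "(u has_sum a) A"
    for u :: "'a \<Rightarrow> complex" and a A
    using that by (simp add: has_sum_uminus)
  ultimately have "4 * l2_ip K f g = (\<Sum>\<^sub>\<infinity>i\<in>fst K. n 1 i - n (-1) i + \<i> * n \<i> i - \<i> * n (-\<i>) i)"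
    unfolding l2_ip_def by (simp add: infsum_cmult_right'[symmetric] cong: infsum_cong)
  also have "\<dots> = infsum (n 1) (fst K) - infsum (n (-1)) (fst K)
      + \<i> * infsum (n \<i>) (fst K) - \<i> * infsum (n (-\<i>)) (fst K)"
    unfolding diff_conv_add_uminus
    by (intro infsumI has_sum_add neg has_sum_cmult_right has_sum_infsum sum_n)
  finally show ?thesis by (simp add: q)
qed

lemma measurable_cnj:
  assumes "f \<in> borel_measurable M"
  shows "(\<lambda>x. cnj (f x)) \<in> borel_measurable M"
  by (rule borel_measurable_continuous_on[OF _ assms]) (intro continuous_intros)

lemma l2_ip_cong_AE:
  assumes "\<And>i. i \<in> fst K \<Longrightarrow> AE x in snd K i. f i x = f' i x"
    and "\<And>i. i \<in> fst K \<Longrightarrow> AE x in snd K i. g i x = g' i x"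
    and "f \<in> l2_fun K" "g \<in> l2_fun K" "f' \<in> l2_fun K" "g' \<in> l2_fun K"
  shows "l2_ip K f g = l2_ip K f' g'"
  unfolding l2_ip_def
proof (intro infsum_cong integral_cong_AE)
  fix i assume i: "i \<in> fst K"
  show "AE x in snd K i. f i x * cnj (g i x) = f' i x * cnj (g' i x)"
    using assms(1,2)[OF i] by eventually_elim simp
qed (use assms(3-6) in \<open>auto simp: l2_fun_iff intro!: borel_measurable_times measurable_cnj\<close>)

lemma hip_l2_class:
  assumes "f \<in> l2_fun K" "g \<in> l2_fun K"
  shows "hip (l2_space K) (l2_class K f) (l2_class K g) = l2_ip K f g"
proof -
  have "hip (l2_space K) (l2_class K f) (l2_class K g) =
      l2_ip K (l2_rep (l2_class K f)) (l2_rep (l2_class K g))"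
    by (simp add: l2_space_def l2_ip_def)
  also have "\<dots> = l2_ip K f g"
    by (intro l2_ip_cong_AE l2_rep_class assms)
  finally show ?thesis .
qed

text \<open>An operator on representatives that induces an operator on classes. It need be linear only up to
  null sets; the scaling of norms by the factor \<open>s\<close> is what makes it respect almost everywhere
  equality.\<close>

definition l2_operator :: "('i, 'x) l2fam \<Rightarrow> ('j, 'x) l2fam \<Rightarrow> real
    \<Rightarrow> (('i \<Rightarrow> 'x \<Rightarrow> complex) \<Rightarrow> 'j \<Rightarrow> 'x \<Rightarrow> complex) \<Rightarrow> bool" where
  "l2_operator K L s S \<longleftrightarrow>
     (\<forall>f\<in>l2_fun K. S f \<in> l2_fun L \<and> l2_sqnorm L (S f) = ennreal s * l2_sqnorm K f) \<and>
     (\<forall>f\<in>l2_fun K. \<forall>g\<in>l2_fun K. \<forall>a. \<forall>j\<in>fst L. AE x in snd L j.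
        S (\<lambda>i x. f i x + a * g i x) j x = S f j x + a * S g j x)"

text \<open>Ruelle operators scale the inner product by a constant, so isometries are considered up to
  a factor.\<close>

definition similitude :: "real \<Rightarrow> 'a hilb \<Rightarrow> 'b hilb \<Rightarrow> ('a \<Rightarrow> 'b) \<Rightarrow> bool" where
  "similitude s X Y U \<longleftrightarrow>
     (\<forall>f\<in>carr X. U f \<in> carr Y) \<and>
     (\<forall>f\<in>carr X. \<forall>g\<in>carr X. U (hadd X f g) = hadd Y (U f) (U g)) \<and>
     (\<forall>a. \<forall>f\<in>carr X. U (hscale X a f) = hscale Y a (U f)) \<and>
     (\<forall>f\<in>carr X. \<forall>g\<in>carr X. hip Y (U f) (U g) = of_real s * hip X f g)"

lemma isometry_on_iff_similitude: "isometry_on X Y U \<longleftrightarrow> similitude 1 X Y U"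
  by (simp add: isometry_on_def similitude_def)

context
  fixes K :: "('i, 'x) l2fam" and L :: "('j, 'x) l2fam" and s S
  assumes op: "l2_operator K L s S" and s: "s > 0"
begin

lemma l2_operator_closed: "f \<in> l2_fun K \<Longrightarrow> S f \<in> l2_fun L"
  and l2_operator_sqnorm: "f \<in> l2_fun K \<Longrightarrow> l2_sqnorm L (S f) = ennreal s * l2_sqnorm K f"
  and l2_operator_linear: "f \<in> l2_fun K \<Longrightarrow> g \<in> l2_fun K \<Longrightarrow> j \<in> fst L \<Longrightarrow>
     AE x in snd L j. S (\<lambda>i x. f i x + a * g i x) j x = S f j x + a * S g j x"
  using op by (auto simp: l2_operator_def)

lemma l2_operator_sqnorm_combine:
  assumes "f \<in> l2_fun K" "g \<in> l2_fun K"
  shows "l2_sqnorm L (\<lambda>j x. S f j x + a * S g j x) =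
    ennreal s * l2_sqnorm K (\<lambda>i x. f i x + a * g i x)"
proof -
  have "l2_sqnorm L (\<lambda>j x. S f j x + a * S g j x) = l2_sqnorm L (S (\<lambda>i x. f i x + a * g i x))"
    by (rule l2_sqnorm_cong_AE) (use l2_operator_linear[OF assms, of _ a] in \<open>simp add: eq_commute\<close>)
  then show ?thesis using l2_operator_sqnorm[OF l2_fun_combine[OF assms]] by simp
qed

text \<open>Two representatives give the same class iff their difference has norm 0, and norms are scaled by
  a positive factor. One direction says that the operator is well defined on classes, the other
  one that the induced operator is injective.\<close>

lemma l2_operator_class_eq_iff:
  assumes f: "f \<in> l2_fun K" and g: "g \<in> l2_fun K"
  shows "l2_class L (S f) = l2_class L (S g) \<longleftrightarrow> l2_class K f = l2_class K g"
proof -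
  have zero: "(\<forall>i\<in>fst K'. AE x in snd K' i. u i x = v i x) \<longleftrightarrow> l2_sqnorm K' (\<lambda>i x. u i x + (-1) * v i x) = 0"
    if "u \<in> l2_fun K'" "v \<in> l2_fun K'" for K' :: "('k, 'x) l2fam" and u v
  proof
    assume "\<forall>i\<in>fst K'. AE x in snd K' i. u i x = v i x"
    then have "l2_sqnorm K' (\<lambda>i x. u i x + (-1) * v i x) = l2_sqnorm K' (\<lambda>i x. 0)"
      by (intro l2_sqnorm_cong_AE) auto
    then show "l2_sqnorm K' (\<lambda>i x. u i x + (-1) * v i x) = 0" by (simp add: l2_sqnorm_def)
  next
    assume "l2_sqnorm K' (\<lambda>i x. u i x + (-1) * v i x) = 0"
    from l2_sqnorm_eq_0D[OF l2_fun_combine[OF that] this]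
    show "\<forall>i\<in>fst K'. AE x in snd K' i. u i x = v i x" by simp
  qed
  show ?thesis
    unfolding l2_class_eq_iff[OF f] l2_class_eq_iff[OF l2_operator_closed[OF f]]
      zero[OF f g] zero[OF l2_operator_closed[OF f] l2_operator_closed[OF g]]
      l2_operator_sqnorm_combine[OF f g]
    using s by simp
qed

lemma l2_lift_class:
  assumes "f \<in> l2_fun K"
  shows "l2_lift L S (l2_class K f) = l2_class L (S f)"
  unfolding l2_lift_def
  using l2_operator_class_eq_iff[OF l2_rep_class(1)[OF assms] assms]
    carr_rep(2)[of "l2_class K f" K] assms by (simp add: carr_l2_space)

lemma l2_lift_similitude: "similitude s (l2_space K) (l2_space L) (l2_lift L S)"
proof -
  have clos: "l2_lift L S (l2_class K f) \<in> l2_class L ` l2_fun L" if f: "f \<in> l2_fun K" for f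
    using l2_lift_class[OF f] l2_operator_closed[OF f] by simp
  have scale: "l2_lift L S (hscale (l2_space K) a (l2_class K f)) =
      hscale (l2_space L) a (l2_lift L S (l2_class K f))" if f: "f \<in> l2_fun K" for f a
  proof -
    have "AE x in snd L j. S (\<lambda>i x. a * f i x) j x = a * S f j x" if j: "j \<in> fst L" for j
    proof -
      \<comment> \<open>homogeneity is the case \<open>0 + a f\<close>; the operator kills 0 because it scales norms\<close>
      have "AE x in snd L j. S (\<lambda>i x. 0 + a * f i x) j x = S (\<lambda>i x. 0) j x + a * S f j x"
        by (rule l2_operator_linear[OF l2_fun_0 f j])
      moreover have "AE x in snd L j. S (\<lambda>i x. 0) j x = 0"
        by (rule l2_sqnorm_eq_0D[OF l2_operator_closed[OF l2_fun_0] _ j])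
           (simp add: l2_operator_sqnorm[OF l2_fun_0], simp add: l2_sqnorm_def)
      ultimately show ?thesis by eventually_elim simp
    qed
    then have "l2_class L (S (\<lambda>i x. a * f i x)) = l2_class L (\<lambda>i x. a * S f i x)"
      by (rule l2_class_cong)
    then show ?thesis
      by (simp add: l2_lift_class f l2_fun_scale hscale_l2_class l2_operator_closed)
  qed
  have add: "l2_lift L S (hadd (l2_space K) (l2_class K f) (l2_class K g)) =
      hadd (l2_space L) (l2_lift L S (l2_class K f)) (l2_lift L S (l2_class K g))"
    if f: "f \<in> l2_fun K" and g: "g \<in> l2_fun K" for f g
  proof -
    have "l2_class L (S (\<lambda>i x. f i x + g i x)) = l2_class L (\<lambda>i x. S f i x + S g i x)"
      using l2_operator_linear[OF f g, of _ 1] by (intro l2_class_cong) simp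
    then show ?thesis
      by (simp add: l2_lift_class f g l2_fun_add hadd_l2_class l2_operator_closed)
  qed
  have ip: "hip (l2_space L) (l2_lift L S (l2_class K f)) (l2_lift L S (l2_class K g)) =
      of_real s * hip (l2_space K) (l2_class K f) (l2_class K g)"
    if f: "f \<in> l2_fun K" and g: "g \<in> l2_fun K" for f g
  proof -
    have "4 * l2_ip L (S f) (S g) = 4 * (of_real s * l2_ip K f g)"
      unfolding l2_polarization[OF l2_operator_closed[OF f] l2_operator_closed[OF g]]
        l2_operator_sqnorm_combine[OF f g]
        mult.left_commute[of 4] l2_polarization[OF f g]
      using s by (simp add: enn2real_mult algebra_simps)
    then show ?thesis
      by (simp add: l2_lift_class f g hip_l2_class l2_operator_closed)
  qed
  show ?thesis
    unfolding similitude_def carr_l2_space using clos scale add ip by blast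
qed

lemma l2_lift_inj: "inj_on (l2_lift L S) (carr (l2_space K))"
  unfolding inj_on_def carr_l2_space by (auto simp: l2_lift_class l2_operator_class_eq_iff)

lemma l2_lift_surj:
  assumes "\<And>g. g \<in> l2_fun L \<Longrightarrow>
    \<exists>f\<in>l2_fun K. \<forall>j\<in>fst L. AE x in snd L j. S f j x = g j x"
  shows "l2_lift L S ` carr (l2_space K) = carr (l2_space L)"
proof
  show "l2_lift L S ` carr (l2_space K) \<subseteq> carr (l2_space L)"
    using l2_lift_similitude by (auto simp: similitude_def)
  show "carr (l2_space L) \<subseteq> l2_lift L S ` carr (l2_space K)"
  proof
    fix G assume "G \<in> carr (l2_space L)"
    then obtain g where g: "g \<in> l2_fun L" "G = l2_class L g" by (auto simp: carr_l2_space)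
    then obtain f where f: "f \<in> l2_fun K" "\<forall>j\<in>fst L. AE x in snd L j. S f j x = g j x"
      using assms by blast
    then have "l2_class L (S f) = l2_class L g" by (intro l2_class_cong) simp
    then have "G = l2_lift L S (l2_class K f)" using g by (simp add: l2_lift_class f)
    then show "G \<in> l2_lift L S ` carr (l2_space K)" using f by (auto simp: carr_l2_space)
  qed
qed

end

definition hilb_closed :: "'a hilb \<Rightarrow> bool" where
  "hilb_closed X \<longleftrightarrow> (\<forall>f\<in>carr X. \<forall>g\<in>carr X. hadd X f g \<in> carr X) \<and>
     (\<forall>a. \<forall>f\<in>carr X. hscale X a f \<in> carr X)"

lemma hilb_closed_l2_space: "hilb_closed (l2_space K)"
  unfolding hilb_closed_def carr_l2_space
  by (auto simp: hadd_l2_class hscale_l2_class l2_fun_add l2_fun_scale)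

text \<open>If two similitudes have the same factor and the same range, the factors cancel in \<open>V\<^sup>-\<^sup>1 U\<close>. The
  operators \<open>S\<^sub>G\<^sub>'\<^sup>-\<^sup>1 S\<^sub>G\<close> and \<open>\<D>\<^sup>-\<^sup>1\<close> are of this form.\<close>

lemma unitary_on_transition:
  assumes U: "similitude s X Z U" and V: "similitude s Y Z V" and "s \<noteq> 0"
    and inj: "inj_on V (carr Y)" and ran: "U ` carr X = V ` carr Y"
    and X: "hilb_closed X" and Y: "hilb_closed Y"
  shows "unitary_on X Y (\<lambda>f. inv_into (carr Y) V (U f))"
proof -
  define W where "W = (\<lambda>f. inv_into (carr Y) V (U f))"
  have W: "W f \<in> carr Y" "V (W f) = U f" if "f \<in> carr X" for f
  proof -
    have "U f \<in> V ` carr Y" using that ran by blast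
    then show "W f \<in> carr Y" "V (W f) = U f"
      unfolding W_def by (auto intro: inv_into_into f_inv_into_f)
  qed
  have eqI: "g = h" if "g \<in> carr Y" "h \<in> carr Y" "V g = V h" for g h
    using inj that by (auto dest: inj_onD)
  have "isometry_on X Y W"
    unfolding isometry_on_def
  proof (intro conjI ballI allI)
    fix f g a assume f: "f \<in> carr X"
    show "W f \<in> carr Y" by (rule W[OF f])
    show "W (hscale X a f) = hscale Y a (W f)"
      using X Y U V W f by (intro eqI) (auto simp: hilb_closed_def similitude_def)
    assume g: "g \<in> carr X"
    show "W (hadd X f g) = hadd Y (W f) (W g)"
      using X Y U V W f g by (intro eqI) (auto simp: hilb_closed_def similitude_def)
    have "of_real s * hip Y (W f) (W g) = hip Z (U f) (U g)"
      using V W f g by (metis similitude_def)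
    also have "\<dots> = of_real s * hip X f g" using U f g by (auto simp: similitude_def)
    finally show "hip Y (W f) (W g) = hip X f g" using \<open>s \<noteq> 0\<close> by simp
  qed
  moreover have "W ` carr X = carr Y"
  proof
    show "W ` carr X \<subseteq> carr Y" using W by auto
    show "carr Y \<subseteq> W ` carr X"
    proof
      fix g assume g: "g \<in> carr Y"
      then obtain f where "f \<in> carr X" "U f = V g" using ran by (metis imageE imageI)
      then show "g \<in> W ` carr X" using W g by (intro image_eqI[of _ _ f] eqI) auto
    qed
  qed
  ultimately show ?thesis unfolding unitary_on_def W_def by simp
qed

lemma unitary_on_compose:
  "unitary_on X Y U \<Longrightarrow> unitary_on Y Z V \<Longrightarrow> unitary_on X Z (\<lambda>f. V (U f))"
  unfolding unitary_on_def isometry_on_def by (auto simp: image_iff) (metis (full_types) imageE imageI)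

lemma l2_lift_commute:
  assumes S: "l2_operator K L s S" "s > 0" and P: "l2_operator K K 1 P" and Q: "l2_operator L L 1 Q"
    and comm: "\<And>f j x. f \<in> l2_fun K \<Longrightarrow> j \<in> fst L \<Longrightarrow> x \<in> space (snd L j) \<Longrightarrow> S (P f) j x = Q (S f) j x"
    and F: "F \<in> carr (l2_space K)"
  shows "l2_lift L S (l2_lift K P F) = l2_lift L Q (l2_lift L S F)"
proof -
  obtain f where f: "f \<in> l2_fun K" "F = l2_class K f" using F by (auto simp: carr_l2_space)
  have "l2_class L (S (P f)) = l2_class L (Q (S f))"
    by (intro l2_class_cong AE_I2 comm f(1))
  then show ?thesis
    using f l2_lift_class[OF P] l2_lift_class[OF Q] l2_lift_class[OF S]
      l2_operator_closed[OF P] l2_operator_closed[OF S] by simp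
qed

lemma hzero_l2_space: "hzero (l2_space K) = l2_class K (\<lambda>i x. 0)"
  by (simp add: l2_space_def)

lemma hzero_in_carr: "hzero (l2_space K) \<in> carr (l2_space K)"
  by (simp add: hzero_l2_space carr_l2_space l2_fun_0)

lemma hip_hzero: "hip (l2_space K) (hzero (l2_space K)) (hzero (l2_space K)) = 0"
  by (simp add: hzero_l2_space hip_l2_class l2_fun_0 l2_ip_def)

lemma hscale_zero: "hscale (l2_space K) 0 F = hzero (l2_space K)"
  by (simp add: l2_space_def)

lemma similitude_zero:
  assumes "similitude s (l2_space K) (l2_space L) U"
  shows "U (hzero (l2_space K)) = hzero (l2_space L)"
proof -
  have "U (hscale (l2_space K) 0 (hzero (l2_space K))) = hscale (l2_space L) 0 (U (hzero (l2_space K)))"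
    using assms hzero_in_carr[of K] unfolding similitude_def by blast
  then show ?thesis by (simp add: hscale_zero)
qed

lemma hadd_zero_left: "F \<in> carr (l2_space K) \<Longrightarrow> hadd (l2_space K) (hzero (l2_space K)) F = F"
  by (auto simp: carr_l2_space hzero_l2_space hadd_l2_class l2_fun_0)

section \<open>The dual endomorphism and Haar measure\<close>

lemma dual_group_nonzero: "\<omega> \<in> dual_group \<Longrightarrow> \<omega> \<gamma> \<noteq> 0"
proof
  assume "\<omega> \<in> dual_group"
  then have "cmod (\<omega> \<gamma>) = 1" by (simp add: dual_group_def)
  moreover assume "\<omega> \<gamma> = 0"
  ultimately show False by simp
qed

lemma one_in_dual: "(\<lambda>\<gamma>. 1) \<in> dual_group"
  by (simp add: dual_group_def)

lemma dmult_in_dual: "\<omega> \<in> dual_group \<Longrightarrow> \<zeta> \<in> dual_group \<Longrightarrow> dmult \<omega> \<zeta> \<in> dual_group"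
  by (simp add: dual_group_def dmult_def norm_mult)

lemma dinv_in_dual: "\<omega> \<in> dual_group \<Longrightarrow> dinv \<omega> \<in> dual_group"
  by (simp add: dual_group_def dinv_def norm_inverse)

lemma dmult_commute: "dmult \<omega> \<zeta> = dmult \<zeta> \<omega>"
  by (simp add: dmult_def mult.commute)

lemma dmult_dinv_cancel:
  assumes "\<zeta> \<in> dual_group"
  shows "dmult (dinv \<zeta>) (dmult \<zeta> \<omega>) = \<omega>" "dmult \<zeta> (dmult (dinv \<zeta>) \<omega>) = \<omega>"
  using dual_group_nonzero[OF assms] by (simp_all add: dmult_def dinv_def fun_eq_iff)

lemma dual_endo_dmult: "dual_endo \<alpha> (dmult \<omega> \<zeta>) = dmult (dual_endo \<alpha> \<omega>) (dual_endo \<alpha> \<zeta>)"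
  by (simp add: dual_endo_def dmult_def)

lemma dual_endo_dinv: "dual_endo \<alpha> (dinv \<omega>) = dinv (dual_endo \<alpha> \<omega>)"
  by (simp add: dual_endo_def dinv_def)

lemma continuous_on_eval: "continuous_on UNIV (\<lambda>\<omega> :: 'g \<Rightarrow> complex. \<omega> \<gamma>)"
  by (simp add: continuous_on_product_coordinates)

lemma eval_measurable: "(\<lambda>\<omega> :: 'g \<Rightarrow> complex. \<omega> \<gamma>) \<in> borel_measurable borel"
  by (intro borel_measurable_continuous_onI continuous_on_eval)

locale dual_dynamics =
  fixes \<alpha> :: "'g::{ab_group_add, countable} \<Rightarrow> 'g"
    and \<mu> :: "'g dual measure"
    and c :: "'g dual \<Rightarrow> 'g dual"
  assumes additive: "Modules.additive \<alpha>"
    and finite_cosets: "finite (cosets \<alpha>)"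
    and haar: "haar \<mu>"
    and cross: "cross_section \<alpha> c"
begin

lemma sets_\<mu>: "sets \<mu> = sets (restrict_space borel dual_group)"
  using haar by (simp add: haar_def)

lemma space_\<mu>: "space \<mu> = dual_group"
  using sets_eq_imp_space_eq[OF sets_\<mu>] by (simp add: space_restrict_space)

lemma prob_\<mu>: "emeasure \<mu> (space \<mu>) = 1"
  using haar by (simp add: haar_def space_\<mu>)

sublocale \<mu>: finite_measure \<mu>
  by standard (simp add: prob_\<mu>)

text \<open>The group is countable, so the Borel sets of its dual are generated by the evaluations at the
  elements of the group.\<close>

lemma measurable_into_dual_iff:
  "f \<in> M \<rightarrow>\<^sub>M \<mu> \<longleftrightarrow> f \<in> space M \<rightarrow> dual_group \<and> (\<forall>\<gamma>. (\<lambda>x. f x \<gamma>) \<in> borel_measurable M)"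
  (is "_ \<longleftrightarrow> _ \<and> ?coord")
proof -
  have "f \<in> M \<rightarrow>\<^sub>M \<mu> \<longleftrightarrow> f \<in> space M \<rightarrow> dual_group \<and> f \<in> borel_measurable M"
    using measurable_restrict_space2_iff[of f M borel dual_group]
      measurable_cong_sets[OF refl sets_\<mu>, of M] by auto
  moreover have "f \<in> borel_measurable M \<longleftrightarrow> ?coord"
  proof
    assume "f \<in> borel_measurable M"
    then show ?coord using measurable_compose[OF _ eval_measurable, of f M] by simp
  next
    assume ?coord
    then show "f \<in> borel_measurable M"
      by (intro measurable_coordinatewise_then_product) simp
  qed
  ultimately show ?thesis by simp
qed

lemma eval_measurable_\<mu>[measurable]: "(\<lambda>\<omega>. \<omega> \<gamma>) \<in> borel_measurable \<mu>"
  unfolding measurable_cong_sets[OF sets_\<mu> refl]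
  by (rule measurable_restrict_space1[OF eval_measurable])

lemma add_\<alpha>: "\<alpha> (\<gamma> + \<eta>) = \<alpha> \<gamma> + \<alpha> \<eta>"
  using additive by (simp add: Modules.additive_def)

lemma endo_in_dual: "\<omega> \<in> dual_group \<Longrightarrow> dual_endo \<alpha> \<omega> \<in> dual_group"
  by (simp add: dual_group_def dual_endo_def add_\<alpha>)

lemma endo_measurable[measurable]: "dual_endo \<alpha> \<in> \<mu> \<rightarrow>\<^sub>M \<mu>"
  unfolding measurable_into_dual_iff
  by (auto simp: space_\<mu> endo_in_dual) (simp add: dual_endo_def)

lemma cross_measurable[measurable]: "c \<in> \<mu> \<rightarrow>\<^sub>M \<mu>"
  using cross measurable_cong_sets[OF sets_\<mu> sets_\<mu>] by (auto simp: cross_section_def)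

lemma cross_in_dual: "\<omega> \<in> dual_group \<Longrightarrow> c \<omega> \<in> dual_group"
  using measurable_space[OF cross_measurable] by (simp add: space_\<mu>)

lemma endo_cross: "\<omega> \<in> dual_group \<Longrightarrow> dual_endo \<alpha> (c \<omega>) = \<omega>"
  using cross by (simp add: cross_section_def)

lemma dmult_measurable[measurable]: "\<zeta> \<in> dual_group \<Longrightarrow> dmult \<zeta> \<in> \<mu> \<rightarrow>\<^sub>M \<mu>"
  unfolding measurable_into_dual_iff
  by (auto simp: space_\<mu> dmult_in_dual) (simp add: dmult_def)

lemma distr_translation:
  assumes \<zeta>: "\<zeta> \<in> dual_group"
  shows "distr \<mu> \<mu> (dmult \<zeta>) = \<mu>"
proof (rule measure_eqI)
  fix A assume "A \<in> sets (distr \<mu> \<mu> (dmult \<zeta>))"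
  then have A: "A \<in> sets \<mu>" by simp
  then have sub: "A \<subseteq> dual_group" using sets.sets_into_space space_\<mu> by blast
  have "dmult \<zeta> -` A \<inter> space \<mu> = dmult (dinv \<zeta>) ` A"
  proof (intro equalityI subsetI)
    fix \<omega> assume "\<omega> \<in> dmult \<zeta> -` A \<inter> space \<mu>"
    then show "\<omega> \<in> dmult (dinv \<zeta>) ` A"
      by (intro image_eqI[of _ _ "dmult \<zeta> \<omega>"]) (auto simp: dmult_dinv_cancel[OF \<zeta>])
  next
    fix \<omega> assume "\<omega> \<in> dmult (dinv \<zeta>) ` A"
    then show "\<omega> \<in> dmult \<zeta> -` A \<inter> space \<mu>"
      using sub \<zeta> by (auto simp: dmult_dinv_cancel[OF \<zeta>] space_\<mu> intro!: dmult_in_dual dinv_in_dual)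
  qed
  moreover have "emeasure \<mu> (dmult (dinv \<zeta>) ` A) = emeasure \<mu> A"
    using haar A dinv_in_dual[OF \<zeta>] by (simp add: haar_def)
  ultimately show "emeasure (distr \<mu> \<mu> (dmult \<zeta>)) A = emeasure \<mu> A"
    using A \<zeta> by (simp add: emeasure_distr)
qed simp

lemma nn_integral_translation:
  assumes "\<zeta> \<in> dual_group" "F \<in> borel_measurable \<mu>"
  shows "(\<integral>\<^sup>+\<omega>. F (dmult \<zeta> \<omega>) \<partial>\<mu>) = (\<integral>\<^sup>+\<omega>. F \<omega> \<partial>\<mu>)"
  using nn_integral_distr[OF dmult_measurable[OF assms(1)], of F] assms
  by (simp add: distr_translation)

text \<open>The uniqueness of Haar measure, specialised to the image measure under \<open>\<alpha>\<^sup>*\<close>. The indicator of \<open>A\<close> at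
  \<open>x \<alpha>\<^sup>*(y)\<close> is averaged over \<open>x\<close> and \<open>y\<close>. For fixed \<open>y\<close>, translation by \<open>\<alpha>\<^sup>*(y)\<close> gives \<open>\<mu>(A)\<close>. For fixed
  \<open>x = \<alpha>\<^sup>*(c(x))\<close> the point is \<open>\<alpha>\<^sup>*(c(x) y)\<close>, and translation by \<open>c(x)\<close> gives the image measure of \<open>A\<close>.\<close>

lemma distr_endo: "distr \<mu> \<mu> (dual_endo \<alpha>) = \<mu>"
proof (rule measure_eqI)
  fix A assume "A \<in> sets (distr \<mu> \<mu> (dual_endo \<alpha>))"
  then have A[measurable]: "A \<in> sets \<mu>" by simp
  interpret pair_sigma_finite \<mu> \<mu> ..
  have mult: "(\<lambda>p. dmult (fst p) (dual_endo \<alpha> (snd p))) \<in> (\<mu> \<Otimes>\<^sub>M \<mu>) \<rightarrow>\<^sub>M \<mu>"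
    unfolding measurable_into_dual_iff
  proof (intro conjI allI)
    show "(\<lambda>p. dmult (fst p) (dual_endo \<alpha> (snd p))) \<in> space (\<mu> \<Otimes>\<^sub>M \<mu>) \<rightarrow> dual_group"
      by (auto simp: space_pair_measure space_\<mu> dmult_in_dual endo_in_dual)
    fix \<gamma> show "(\<lambda>p. dmult (fst p) (dual_endo \<alpha> (snd p)) \<gamma>) \<in> borel_measurable (\<mu> \<Otimes>\<^sub>M \<mu>)"
      unfolding dmult_def dual_endo_def by measurable
  qed
  have ind_m: "(\<lambda>(x, y). indicator A (dmult x (dual_endo \<alpha> y)) :: ennreal) \<in> borel_measurable (\<mu> \<Otimes>\<^sub>M \<mu>)"
    using measurable_compose[OF mult borel_measurable_indicator[OF A]] by (simp add: case_prod_beta')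
  have "emeasure (distr \<mu> \<mu> (dual_endo \<alpha>)) A = (\<integral>\<^sup>+y. indicator A (dual_endo \<alpha> y) \<partial>\<mu>)"
    by (subst nn_integral_distr[symmetric, of _ _ \<mu>]) auto
  also have "\<dots> = (\<integral>\<^sup>+x. (\<integral>\<^sup>+y. indicator A (dual_endo \<alpha> y) \<partial>\<mu>) \<partial>\<mu>)"
    by (simp add: prob_\<mu>)
  also have "\<dots> = (\<integral>\<^sup>+x. (\<integral>\<^sup>+y. indicator A (dmult x (dual_endo \<alpha> y)) \<partial>\<mu>) \<partial>\<mu>)"
  proof (rule nn_integral_cong)
    fix x assume "x \<in> space \<mu>"
    then have x: "x \<in> dual_group" by (simp add: space_\<mu>)
    have "(\<integral>\<^sup>+y. indicator A (dual_endo \<alpha> y) \<partial>\<mu>) =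
        (\<integral>\<^sup>+y. indicator A (dual_endo \<alpha> (dmult (c x) y)) \<partial>\<mu>)"
      by (rule nn_integral_translation[OF cross_in_dual[OF x], symmetric]) measurable
    also have "\<dots> = (\<integral>\<^sup>+y. indicator A (dmult x (dual_endo \<alpha> y)) \<partial>\<mu>)"
      by (simp add: dual_endo_dmult endo_cross[OF x])
    finally show "(\<integral>\<^sup>+y. indicator A (dual_endo \<alpha> y) \<partial>\<mu>) =
        (\<integral>\<^sup>+y. indicator A (dmult x (dual_endo \<alpha> y)) \<partial>\<mu> :: ennreal)" .
  qed
  also have "\<dots> = (\<integral>\<^sup>+y. (\<integral>\<^sup>+x. indicator A (dmult x (dual_endo \<alpha> y)) \<partial>\<mu>) \<partial>\<mu>)"
    using Fubini'[OF ind_m] by simp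
  also have "\<dots> = (\<integral>\<^sup>+y. emeasure \<mu> A \<partial>\<mu>)"
  proof (rule nn_integral_cong)
    fix y assume "y \<in> space \<mu>"
    then have y: "dual_endo \<alpha> y \<in> dual_group" by (simp add: space_\<mu> endo_in_dual)
    show "(\<integral>\<^sup>+x. indicator A (dmult x (dual_endo \<alpha> y)) \<partial>\<mu>) = emeasure \<mu> A"
      using nn_integral_translation[OF y, of "indicator A"]
      by (simp add: dmult_commute[of _ "dual_endo \<alpha> y"])
  qed
  also have "\<dots> = emeasure \<mu> A" by (simp add: prob_\<mu>)
  finally show "emeasure (distr \<mu> \<mu> (dual_endo \<alpha>)) A = emeasure \<mu> A" .
qed simp

lemma nn_integral_endo:
  assumes "F \<in> borel_measurable \<mu>"
  shows "(\<integral>\<^sup>+\<omega>. F (dual_endo \<alpha> \<omega>) \<partial>\<mu>) = (\<integral>\<^sup>+\<omega>. F \<omega> \<partial>\<mu>)"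
  using nn_integral_distr[OF endo_measurable, of F] assms by (simp add: distr_endo)

lemma AE_endo: "AE \<omega> in \<mu>. P \<omega> \<Longrightarrow> AE \<omega> in \<mu>. P (dual_endo \<alpha> \<omega>)"
  by (rule AE_distrD[OF endo_measurable, unfolded distr_endo])

lemma dker_dual: "\<kappa> \<in> dker \<alpha> \<Longrightarrow> \<kappa> \<in> dual_group"
  and endo_dker: "\<kappa> \<in> dker \<alpha> \<Longrightarrow> dual_endo \<alpha> \<kappa> = (\<lambda>\<gamma>. 1)"
  by (auto simp: dker_def fibre_def)

lemma one_in_dker: "(\<lambda>\<gamma>. 1) \<in> dker \<alpha>"
  by (simp add: dker_def fibre_def one_in_dual) (simp add: dual_endo_def)

text \<open>An element of the kernel is constant on the cosets of the image of \<open>\<alpha>\<close>, so it is determined by its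
  values on finitely many representatives, and these are roots of unity of bounded order.\<close>

lemma finite_dker: "finite (dker \<alpha>)"
proof -
  define r where "r = (\<lambda>C. SOME \<gamma>. C = (+) \<gamma> ` range \<alpha>)"
  define roots where "roots = (\<Union>n\<in>{1..card (cosets \<alpha>)}. {z :: complex. z ^ n = 1})"
  have rC: "C = (+) (r C) ` range \<alpha>" if "C \<in> cosets \<alpha>" for C
  proof -
    have "\<exists>\<gamma>. C = (+) \<gamma> ` range \<alpha>" using that by (auto simp: cosets_def)
    then show ?thesis unfolding r_def by (rule someI_ex)
  qed
  have coset: "(+) \<gamma> ` range \<alpha> \<in> cosets \<alpha>" for \<gamma> by (auto simp: cosets_def)
  have zero: "\<alpha> 0 = 0" using add_\<alpha>[of 0 0] by simp
  have trivial: "\<kappa> (\<alpha> \<gamma>) = 1" if "\<kappa> \<in> dker \<alpha>" for \<kappa> \<gamma>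
    using fun_cong[OF endo_dker[OF that], of \<gamma>] by (simp add: dual_endo_def)
  have hom: "\<kappa> (\<gamma> + \<eta>) = \<kappa> \<gamma> * \<kappa> \<eta>" if "\<kappa> \<in> dker \<alpha>" for \<kappa> \<gamma> \<eta>
    using dker_dual[OF that] by (simp add: dual_group_def)
  have const: "\<kappa> \<gamma> = \<kappa> \<eta>" if "\<kappa> \<in> dker \<alpha>" "(+) \<gamma> ` range \<alpha> = (+) \<eta> ` range \<alpha>" for \<kappa> \<gamma> \<eta>
  proof -
    have "\<gamma> \<in> (+) \<gamma> ` range \<alpha>" using zero by (metis add.right_neutral rangeI image_eqI)
    then have "\<gamma> \<in> (+) \<eta> ` range \<alpha>" by (simp only: that(2))
    then obtain \<beta> where "\<gamma> = \<eta> + \<alpha> \<beta>" by blast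
    then show ?thesis by (simp add: hom[OF that(1)] trivial[OF that(1)])
  qed
  \<comment> \<open>two of the multiples \<open>0, \<gamma>, 2 \<gamma>, \<dots>\<close> share a coset, so a kernel element has a root of unity at \<open>\<gamma>\<close>\<close>
  have root: "\<kappa> \<gamma> \<in> roots" if \<kappa>: "\<kappa> \<in> dker \<alpha>" for \<kappa> \<gamma>
  proof -
    define p where "p = (\<lambda>n. ((+) \<gamma> ^^ n) 0)"
    have pow: "\<kappa> (p n) = \<kappa> \<gamma> ^ n" for n
    proof (induction n)
      case 0
      show ?case using trivial[OF \<kappa>, of 0] by (simp add: p_def zero)
    next
      case (Suc n)
      then show ?case by (simp add: p_def hom[OF \<kappa>])
    qed
    have "\<not> inj_on (\<lambda>n. (+) (p n) ` range \<alpha>) {0..card (cosets \<alpha>)}"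
    proof
      assume "inj_on (\<lambda>n. (+) (p n) ` range \<alpha>) {0..card (cosets \<alpha>)}"
      then have "card {0..card (cosets \<alpha>)} \<le> card (cosets \<alpha>)"
        by (rule card_inj_on_le) (use coset finite_cosets in auto)
      then show False by simp
    qed
    then obtain k l where kl: "k < l" "l \<le> card (cosets \<alpha>)"
      "(+) (p k) ` range \<alpha> = (+) (p l) ` range \<alpha>"
      unfolding inj_on_def by (metis atLeastAtMost_iff linorder_neqE_nat)
    then have "\<kappa> \<gamma> ^ k = \<kappa> \<gamma> ^ l" using const[OF \<kappa> kl(3)] by (simp add: pow)
    also have "\<dots> = \<kappa> \<gamma> ^ k * \<kappa> \<gamma> ^ (l - k)" using kl by (simp add: power_add[symmetric])
    finally have "\<kappa> \<gamma> ^ (l - k) = 1" using dual_group_nonzero[OF dker_dual[OF \<kappa>]] by simp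
    then show ?thesis using kl by (auto simp: roots_def intro!: bexI[of _ "l - k"])
  qed
  have "finite roots" unfolding roots_def by (intro finite_UN_I finite_roots_unity) auto
  then have "finite (cosets \<alpha> \<rightarrow>\<^sub>E roots)" using finite_cosets by (simp add: finite_PiE)
  moreover have "(\<lambda>\<kappa>. restrict (\<lambda>C. \<kappa> (r C)) (cosets \<alpha>)) ` dker \<alpha> \<subseteq> cosets \<alpha> \<rightarrow>\<^sub>E roots"
    using root by auto
  moreover have "inj_on (\<lambda>\<kappa>. restrict (\<lambda>C. \<kappa> (r C)) (cosets \<alpha>)) (dker \<alpha>)"
  proof (rule inj_onI, rule ext)
    fix \<kappa> \<kappa>' \<gamma> assume \<kappa>: "\<kappa> \<in> dker \<alpha>" "\<kappa>' \<in> dker \<alpha>"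
      and eq: "restrict (\<lambda>C. \<kappa> (r C)) (cosets \<alpha>) = restrict (\<lambda>C. \<kappa>' (r C)) (cosets \<alpha>)"
    have "\<kappa> (r ((+) \<gamma> ` range \<alpha>)) = \<kappa>' (r ((+) \<gamma> ` range \<alpha>))"
      using fun_cong[OF eq, of "(+) \<gamma> ` range \<alpha>"] coset[of \<gamma>] by simp
    then show "\<kappa> \<gamma> = \<kappa>' \<gamma>"
      using const[OF \<kappa>(1) rC[OF coset[of \<gamma>]]] const[OF \<kappa>(2) rC[OF coset[of \<gamma>]]] by simp
  qed
  ultimately show ?thesis by (meson finite_imageD finite_subset)
qed

lemma card_dker_pos: "card (dker \<alpha>) > 0"
  using finite_dker one_in_dker by (auto simp: card_gt_0_iff)

lemma dker_mult_in_fibre: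
  assumes "\<kappa> \<in> dker \<alpha>" "\<zeta> \<in> fibre \<alpha> \<omega>"
  shows "dmult \<kappa> \<zeta> \<in> fibre \<alpha> \<omega>"
  using assms dmult_in_dual[OF dker_dual] endo_dker[OF assms(1)]
  by (auto simp: fibre_def dual_endo_dmult) (simp add: dmult_def)

lemma fibre_eq_translate:
  assumes "\<zeta> \<in> fibre \<alpha> \<omega>"
  shows "fibre \<alpha> \<omega> = (\<lambda>\<kappa>. dmult \<kappa> \<zeta>) ` dker \<alpha>"
proof
  show "(\<lambda>\<kappa>. dmult \<kappa> \<zeta>) ` dker \<alpha> \<subseteq> fibre \<alpha> \<omega>"
    using dker_mult_in_fibre assms by auto
  have \<zeta>: "\<zeta> \<in> dual_group" using assms by (simp add: fibre_def)
  show "fibre \<alpha> \<omega> \<subseteq> (\<lambda>\<kappa>. dmult \<kappa> \<zeta>) ` dker \<alpha>"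
  proof
    fix \<xi> assume \<xi>: "\<xi> \<in> fibre \<alpha> \<omega>"
    then have \<omega>: "\<omega> \<in> dual_group" by (auto simp: fibre_def endo_in_dual)
    have "dmult (dinv \<zeta>) \<xi> \<in> dker \<alpha>"
      unfolding dker_def fibre_def using \<xi> assms \<zeta> dual_group_nonzero[OF \<omega>]
      by (auto simp: fibre_def dual_endo_dmult dual_endo_dinv dmult_in_dual dinv_in_dual)
         (auto simp: dmult_def dinv_def)
    moreover have "\<xi> = dmult (dmult (dinv \<zeta>) \<xi>) \<zeta>"
      by (simp only: dmult_commute[of _ \<zeta>] dmult_dinv_cancel[OF \<zeta>])
    ultimately show "\<xi> \<in> (\<lambda>\<kappa>. dmult \<kappa> \<zeta>) ` dker \<alpha>" by blast
  qed
qed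

lemma inj_translate: "\<zeta> \<in> dual_group \<Longrightarrow> inj_on (\<lambda>\<kappa>. dmult \<kappa> \<zeta>) S"
proof (rule inj_onI)
  fix \<kappa> \<kappa>' assume \<zeta>: "\<zeta> \<in> dual_group" and "dmult \<kappa> \<zeta> = dmult \<kappa>' \<zeta>"
  then have "dmult (dinv \<zeta>) (dmult \<zeta> \<kappa>) = dmult (dinv \<zeta>) (dmult \<zeta> \<kappa>')"
    by (simp add: dmult_commute[of \<zeta>])
  then show "\<kappa> = \<kappa>'" by (simp add: dmult_dinv_cancel[OF \<zeta>])
qed

lemma sum_fibre_translate:
  assumes "\<zeta> \<in> fibre \<alpha> \<omega>"
  shows "(\<Sum>\<xi>\<in>fibre \<alpha> \<omega>. F \<xi>) = (\<Sum>\<kappa>\<in>dker \<alpha>. F (dmult \<kappa> \<zeta>))"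
proof -
  have "inj_on (\<lambda>\<kappa>. dmult \<kappa> \<zeta>) (dker \<alpha>)" using assms by (intro inj_translate) (simp add: fibre_def)
  then show ?thesis unfolding fibre_eq_translate[OF assms] by (simp add: sum.reindex)
qed

lemma cross_in_fibre: "\<omega> \<in> dual_group \<Longrightarrow> c \<omega> \<in> fibre \<alpha> \<omega>"
  by (simp add: fibre_def cross_in_dual endo_cross)

lemma in_fibre_endo: "\<omega> \<in> dual_group \<Longrightarrow> \<omega> \<in> fibre \<alpha> (dual_endo \<alpha> \<omega>)"
  by (simp add: fibre_def)

lemma finite_fibre: "finite (fibre \<alpha> \<omega>)"
proof (cases "fibre \<alpha> \<omega> = {}")
  case False
  then obtain \<zeta> where "\<zeta> \<in> fibre \<alpha> \<omega>" by blast
  from fibre_eq_translate[OF this] show ?thesis using finite_dker by simp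
qed simp

lemma sum_fibre_measurable:
  fixes F :: "'g dual \<Rightarrow> 'b::{second_countable_topology, topological_comm_monoid_add}"
  assumes [measurable]: "F \<in> borel_measurable \<mu>"
  shows "(\<lambda>\<omega>. \<Sum>\<zeta>\<in>fibre \<alpha> \<omega>. F \<zeta>) \<in> borel_measurable \<mu>"
proof -
  have "(\<lambda>\<omega>. F (dmult \<kappa> (c \<omega>))) \<in> borel_measurable \<mu>" if "\<kappa> \<in> dker \<alpha>" for \<kappa>
    using measurable_compose[OF measurable_compose[OF cross_measurable
        dmult_measurable[OF dker_dual[OF that]]] assms] .
  then have "(\<lambda>\<omega>. \<Sum>\<kappa>\<in>dker \<alpha>. F (dmult \<kappa> (c \<omega>))) \<in> borel_measurable \<mu>"
    by (intro borel_measurable_sum) auto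
  then show ?thesis
    by (rule measurable_cong[THEN iffD1, rotated])
       (simp add: space_\<mu> sum_fibre_translate[OF cross_in_fibre])
qed

text \<open>After pulling back along \<open>\<alpha>\<^sup>*\<close>, the fibre over \<open>\<alpha>\<^sup>*(\<zeta>)\<close> consists of the translates of \<open>\<zeta>\<close> by the kernel,
  and each translation preserves the integral.\<close>

lemma nn_integral_fibre:
  assumes F[measurable]: "F \<in> borel_measurable \<mu>"
  shows "(\<integral>\<^sup>+\<omega>. (\<Sum>\<zeta>\<in>fibre \<alpha> \<omega>. F \<zeta>) \<partial>\<mu>) = of_nat (card (dker \<alpha>)) * (\<integral>\<^sup>+\<zeta>. F \<zeta> \<partial>\<mu>)"
proof -
  have "(\<integral>\<^sup>+\<omega>. (\<Sum>\<zeta>\<in>fibre \<alpha> \<omega>. F \<zeta>) \<partial>\<mu>) = (\<integral>\<^sup>+\<zeta>. (\<Sum>\<xi>\<in>fibre \<alpha> (dual_endo \<alpha> \<zeta>). F \<xi>) \<partial>\<mu>)"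
    by (rule nn_integral_endo[symmetric, OF sum_fibre_measurable[OF F]])
  also have "\<dots> = (\<integral>\<^sup>+\<zeta>. (\<Sum>\<kappa>\<in>dker \<alpha>. F (dmult \<kappa> \<zeta>)) \<partial>\<mu>)"
    by (intro nn_integral_cong sum_fibre_translate in_fibre_endo) (simp add: space_\<mu>)
  also have "\<dots> = (\<Sum>\<kappa>\<in>dker \<alpha>. \<integral>\<^sup>+\<zeta>. F (dmult \<kappa> \<zeta>) \<partial>\<mu>)"
    by (intro nn_integral_sum measurable_compose[OF dmult_measurable F] dker_dual)
  also have "\<dots> = (\<Sum>\<kappa>\<in>dker \<alpha>. \<integral>\<^sup>+\<zeta>. F \<zeta> \<partial>\<mu>)"
    by (intro sum.cong refl nn_integral_translation F dker_dual)
  finally show ?thesis by simp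
qed

text \<open>The set of points whose fibre meets a null set is null, because the number of points in the
  intersection has integral 0.\<close>

lemma AE_fibre:
  assumes "AE \<zeta> in \<mu>. P \<zeta>"
  shows "AE \<omega> in \<mu>. \<forall>\<zeta>\<in>fibre \<alpha> \<omega>. P \<zeta>"
proof -
  obtain N where N: "N \<in> sets \<mu>" "emeasure \<mu> N = 0" "{\<zeta> \<in> space \<mu>. \<not> P \<zeta>} \<subseteq> N"
    using assms by (auto elim: AE_E)
  then have "(\<integral>\<^sup>+\<omega>. (\<Sum>\<zeta>\<in>fibre \<alpha> \<omega>. indicator N \<zeta>) \<partial>\<mu>) = 0"
    by (simp add: nn_integral_fibre)
  then have "AE \<omega> in \<mu>. (\<Sum>\<zeta>\<in>fibre \<alpha> \<omega>. indicator N \<zeta> :: ennreal) = 0"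
    using N by (subst (asm) nn_integral_0_iff_AE) (auto intro: sum_fibre_measurable)
  then show ?thesis
  proof eventually_elim
    fix \<omega> assume "(\<Sum>\<zeta>\<in>fibre \<alpha> \<omega>. indicator N \<zeta> :: ennreal) = 0"
    then have "\<zeta> \<notin> N" if "\<zeta> \<in> fibre \<alpha> \<omega>" for \<zeta>
      using that finite_fibre[of \<omega>] by (auto simp: indicator_def split: if_splits)
    then show "\<forall>\<zeta>\<in>fibre \<alpha> \<omega>. P \<zeta>" using N(3) by (auto simp: fibre_def space_\<mu>)
  qed
qed

end

section \<open>Orthogonal bases of finite-dimensional spaces\<close>

lemma of_real_cmod_power2: "(complex_of_real (cmod z))\<^sup>2 = z * cnj z"
  by (simp add: complex_norm_square[symmetric])

lemma rows_parseval:
  fixes e :: "'a \<Rightarrow> 'b \<Rightarrow> complex"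
  assumes fin: "finite A" "finite B"
    and rows: "\<And>a a'. a \<in> A \<Longrightarrow> a' \<in> A \<Longrightarrow>
      (\<Sum>b\<in>B. e a b * cnj (e a' b)) = (if a = a' then of_real N else 0)"
  shows "(\<Sum>b\<in>B. (cmod (\<Sum>a\<in>A. e a b * x a))\<^sup>2) = N * (\<Sum>a\<in>A. (cmod (x a))\<^sup>2)"
proof -
  have "of_real (\<Sum>b\<in>B. (cmod (\<Sum>a\<in>A. e a b * x a))\<^sup>2) =
      (\<Sum>b\<in>B. \<Sum>a\<in>A. \<Sum>a'\<in>A. x a * cnj (x a') * (e a b * cnj (e a' b)))"
    by (simp add: of_real_cmod_power2 sum_product mult_ac)
  also have "\<dots> = (\<Sum>a\<in>A. \<Sum>a'\<in>A. x a * cnj (x a') * (\<Sum>b\<in>B. e a b * cnj (e a' b)))"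
    by (subst sum.swap) (intro sum.cong refl, subst sum.swap, simp add: sum_distrib_left)
  also have "\<dots> = (\<Sum>a\<in>A. \<Sum>a'\<in>A. if a = a' then of_real N * (x a * cnj (x a')) else 0)"
    by (intro sum.cong refl) (simp add: rows)
  also have "\<dots> = of_real (N * (\<Sum>a\<in>A. (cmod (x a))\<^sup>2))"
    using fin by (simp add: of_real_cmod_power2 sum_distrib_left)
  finally show ?thesis using of_real_eq_iff by blast
qed

text \<open>As many orthogonal rows as there are columns: then the columns are orthogonal, too. Let \<open>q\<close> be the Gram
  matrix of the columns and \<open>r = N - q\<close>. The squared entries of \<open>r\<close> add up to
  \<open>N\<^sup>2 |B| - 2 N tr q + \<Sum>|q|\<^sup>2\<close>. By orthogonality of the rows, \<open>tr q = N |A|\<close> and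
  \<open>\<Sum>|q|\<^sup>2 = N tr q\<close>, so the total is 0 when \<open>|A| = |B|\<close>, and \<open>r\<close> vanishes.\<close>

lemma orthogonal_rows_imp_columns:
  fixes e :: "'a \<Rightarrow> 'b \<Rightarrow> complex"
  assumes fin: "finite A" "finite B" and card: "card A = card B" and N: "N > 0"
    and rows: "\<And>a a'. a \<in> A \<Longrightarrow> a' \<in> A \<Longrightarrow>
      (\<Sum>b\<in>B. e a b * cnj (e a' b)) = (if a = a' then of_real N else 0)"
    and b: "b \<in> B" "b' \<in> B"
  shows "(\<Sum>a\<in>A. e a b * cnj (e a b')) = (if b = b' then of_real N else 0)"
proof -
  define q where "q = (\<lambda>b b'. \<Sum>a\<in>A. e a b * cnj (e a b'))"
  define r where "r = (\<lambda>b b'. (if b = b' then of_real N else 0) - q b b')"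
  have cnj_q: "cnj (q b b') = q b' b" for b b'
    by (simp add: q_def mult.commute)
  have diag: "(\<Sum>b\<in>B. q b b) = of_nat (card A) * of_real N"
    unfolding q_def by (subst sum.swap) (simp add: rows)
  have "(\<Sum>b\<in>B. \<Sum>b'\<in>B. q b b' * cnj (q b b')) = of_real N * (\<Sum>b\<in>B. q b b)"
  proof -
    have "(\<Sum>b'\<in>B. q b b' * cnj (q b b')) = of_real N * q b b" if "b \<in> B" for b
    proof -
      have "(\<Sum>b'\<in>B. (cmod (\<Sum>a\<in>A. e a b' * cnj (e a b)))\<^sup>2) = N * (\<Sum>a\<in>A. (cmod (cnj (e a b)))\<^sup>2)"
        by (rule rows_parseval[OF fin rows])
      then have "complex_of_real (\<Sum>b'\<in>B. (cmod (q b' b))\<^sup>2) = of_real (N * (\<Sum>a\<in>A. (cmod (e a b))\<^sup>2))"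
        by (simp add: q_def)
      then show ?thesis
        by (simp add: of_real_cmod_power2 cnj_q) (simp add: q_def mult.commute)
    qed
    then show ?thesis by (simp add: sum_distrib_left)
  qed
  moreover have "(\<Sum>b\<in>B. \<Sum>b'\<in>B. r b b' * cnj (r b b')) =
      of_nat (card B) * of_real N * of_real N - 2 * of_real N * (\<Sum>b\<in>B. q b b)
        + (\<Sum>b\<in>B. \<Sum>b'\<in>B. q b b' * cnj (q b b'))"
  proof -
    have "r b b' * cnj (r b b') = (if b = b' then of_real N * of_real N - 2 * of_real N * q b b else 0)
        + q b b' * cnj (q b b')" for b b'
      by (auto simp: r_def cnj_q algebra_simps)
    then have "(\<Sum>b\<in>B. \<Sum>b'\<in>B. r b b' * cnj (r b b')) =
        (\<Sum>b\<in>B. of_real N * of_real N - 2 * of_real N * q b b)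
        + (\<Sum>b\<in>B. \<Sum>b'\<in>B. q b b' * cnj (q b b'))"
      using fin by (simp add: sum.distrib)
    then show ?thesis by (simp add: sum_subtractf sum_distrib_left)
  qed
  ultimately have "(\<Sum>b\<in>B. \<Sum>b'\<in>B. r b b' * cnj (r b b')) = 0"
    using card by (simp add: diag algebra_simps)
  then have "complex_of_real (\<Sum>b\<in>B. \<Sum>b'\<in>B. (cmod (r b b'))\<^sup>2) = 0"
    by (simp add: of_real_cmod_power2)
  then have "(\<Sum>b\<in>B. \<Sum>b'\<in>B. (cmod (r b b'))\<^sup>2) = 0"
    using of_real_eq_0_iff by blast
  then have "r b b' = 0"
    using fin b by (simp add: sum_nonneg_eq_0_iff sum_nonneg)
  then show ?thesis by (simp add: r_def q_def split: if_splits)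
qed

text \<open>The expansion of a vector in an orthogonal basis is the orthogonality of the columns; Parseval's
  identity for the coefficients is \<open>rows_parseval\<close> with rows and columns exchanged.\<close>

lemma orthogonal_basis_expansion:
  fixes e :: "'a \<Rightarrow> 'b \<Rightarrow> complex"
  assumes "finite A" "finite B" "card A = card B" and N: "N > 0"
    and "\<And>a a'. a \<in> A \<Longrightarrow> a' \<in> A \<Longrightarrow>
      (\<Sum>b\<in>B. e a b * cnj (e a' b)) = (if a = a' then of_real N else 0)"
  shows "b \<in> B \<Longrightarrow> (\<Sum>a\<in>A. e a b * ((\<Sum>b'\<in>B. f b' * cnj (e a b')) / of_real N)) = f b"
    and "(\<Sum>a\<in>A. (cmod ((\<Sum>b\<in>B. f b * cnj (e a b)) / of_real N))\<^sup>2) = (\<Sum>b\<in>B. (cmod (f b))\<^sup>2) / N"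
proof -
  have cols: "(\<Sum>a\<in>A. e a b * cnj (e a b')) = (if b = b' then of_real N else 0)"
    if "b \<in> B" "b' \<in> B" for b b'
    using orthogonal_rows_imp_columns[of A B N e b b'] assms that by blast
  show "(\<Sum>a\<in>A. e a b * ((\<Sum>b'\<in>B. f b' * cnj (e a b')) / of_real N)) = f b" if b: "b \<in> B"
  proof -
    have "(\<Sum>a\<in>A. e a b * ((\<Sum>b'\<in>B. f b' * cnj (e a b')) / of_real N)) =
        (\<Sum>b'\<in>B. f b' / of_real N * (\<Sum>a\<in>A. e a b * cnj (e a b')))"
      by (simp add: sum_distrib_left sum_divide_distrib mult_ac)
         (subst sum.swap, simp)
    also have "\<dots> = (\<Sum>b'\<in>B. if b = b' then f b' else 0)"
      using N b by (intro sum.cong refl) (simp add: cols)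
    finally show ?thesis using b assms(2) by simp
  qed
  have "(\<Sum>a\<in>A. (cmod (\<Sum>b\<in>B. cnj (e a b) * f b))\<^sup>2) = N * (\<Sum>b\<in>B. (cmod (f b))\<^sup>2)"
  proof (rule rows_parseval[OF assms(2,1)])
    fix b b' assume b: "b \<in> B" "b' \<in> B"
    show "(\<Sum>a\<in>A. cnj (e a b) * cnj (cnj (e a b'))) = (if b = b' then of_real N else 0)"
      using cols[OF b(2,1)] by (simp add: mult.commute)
  qed
  then show "(\<Sum>a\<in>A. (cmod ((\<Sum>b\<in>B. f b * cnj (e a b)) / of_real N))\<^sup>2) = (\<Sum>b\<in>B. (cmod (f b))\<^sup>2) / N"
    using N by (simp add: norm_divide power_divide sum_divide_distrib[symmetric] mult.commute power2_eq_square)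
qed

section \<open>Square-integrable families over level sets\<close>

lemma fst_level_fam: "fst (level_fam \<mu> n) = {1..} \<times> {[]}"
  and snd_level_fam: "snd (level_fam \<mu> n) (i, zs) = restrict_space \<mu> (level n i)"
  by (simp_all add: level_fam_def)

context dual_dynamics
begin

abbreviation multiplicity :: "('g dual \<Rightarrow> nat) \<Rightarrow> bool" where
  "multiplicity n \<equiv> n \<in> \<mu> \<rightarrow>\<^sub>M count_space UNIV"

lemma level_sets: "multiplicity n \<Longrightarrow> level n i \<in> sets \<mu>"
  using measurable_sets[of n \<mu> "count_space UNIV" "{i..}"]
  by (simp add: level_def space_\<mu> vimage_def Int_def conj_commute)

lemma extend_measurable:
  fixes g :: "'g dual \<Rightarrow> complex"
  assumes "multiplicity n" "g \<in> borel_measurable (restrict_space \<mu> (level n i))"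
  shows "(\<lambda>\<omega>. if \<omega> \<in> level n i then g \<omega> else 0) \<in> borel_measurable \<mu>"
proof -
  have "level n i \<inter> space \<mu> \<in> sets \<mu>" using level_sets[OF assms(1)] by simp
  from borel_measurable_restrict_space_iff[OF this, of g] assms(2)
  have "(\<lambda>\<omega>. indicat_real (level n i) \<omega> *\<^sub>R g \<omega>) \<in> borel_measurable \<mu>" by simp
  then show ?thesis by (rule measurable_cong[THEN iffD1, rotated]) (simp add: indicator_def)
qed

text \<open>The number of summands depends on the point; on each of the countably many sets where it is
  constant the sum is an ordinary finite sum.\<close>

lemma sum_levels_measurable:
  fixes g :: "nat \<Rightarrow> 'g dual \<Rightarrow> 'b::{second_countable_topology, topological_comm_monoid_add}"
  assumes n: "multiplicity n"
    and g: "\<And>i. i \<ge> 1 \<Longrightarrow> (\<lambda>\<omega>. if \<omega> \<in> level n i then g i \<omega> else 0) \<in> borel_measurable \<mu>"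
  shows "(\<lambda>\<omega>. \<Sum>i\<in>{1..n \<omega>}. g i \<omega>) \<in> borel_measurable \<mu>"
proof -
  have "(\<lambda>\<omega>. \<Sum>i\<in>{1..k}. if \<omega> \<in> level n i then g i \<omega> else 0) \<in> borel_measurable \<mu>" for k
    using g by (intro borel_measurable_sum) auto
  from measurable_compose_countable[OF this n]
  have "(\<lambda>\<omega>. \<Sum>i\<in>{1..n \<omega>}. if \<omega> \<in> level n i then g i \<omega> else 0) \<in> borel_measurable \<mu>" .
  then show ?thesis
    by (rule measurable_cong[THEN iffD1, rotated]) (auto intro!: sum.cong simp: level_def space_\<mu>)
qed

text \<open>The level sets decrease, and \<open>\<omega>\<close> lies in exactly the first \<open>n \<omega>\<close> of them. So a family of functions on
  the level sets is a single function whose value at \<open>\<omega>\<close> is a vector with \<open>n \<omega>\<close> entries.\<close>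

lemma l2_sqnorm_level:
  assumes n: "multiplicity n"
    and f: "\<And>i. i \<ge> 1 \<Longrightarrow> f (i, []) \<in> borel_measurable (restrict_space \<mu> (level n i))"
  shows "l2_sqnorm (level_fam \<mu> n) f = (\<integral>\<^sup>+\<omega>. (\<Sum>i\<in>{1..n \<omega>}. ennreal ((cmod (f (i, []) \<omega>))\<^sup>2)) \<partial>\<mu>)"
proof -
  define u where "u = (\<lambda>i \<omega>. if \<omega> \<in> level n i then f (i, []) \<omega> else 0)"
  have u: "u i \<in> borel_measurable \<mu>" if "i \<in> {1..}" for i
    unfolding u_def using that by (intro extend_measurable[OF n] f) simp
  have bij: "bij_betw (\<lambda>i. (i, [])) {1::nat..} ({1..} \<times> {[]})"
    by (auto simp: bij_betw_def inj_on_def)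
  have "l2_sqnorm (level_fam \<mu> n) f =
      (\<integral>\<^sup>+i. (\<integral>\<^sup>+\<omega>. ennreal ((cmod (f (i, []) \<omega>))\<^sup>2) \<partial>restrict_space \<mu> (level n i)) \<partial>count_space {1..})"
    unfolding l2_sqnorm_def fst_level_fam nn_integral_bij_count_space[OF bij, symmetric] snd_level_fam ..
  also have "\<dots> = (\<integral>\<^sup>+i. (\<integral>\<^sup>+\<omega>. ennreal ((cmod (u i \<omega>))\<^sup>2) \<partial>\<mu>) \<partial>count_space {1..})"
  proof (intro nn_integral_cong)
    fix i
    show "(\<integral>\<^sup>+\<omega>. ennreal ((cmod (f (i, []) \<omega>))\<^sup>2) \<partial>restrict_space \<mu> (level n i)) =
        (\<integral>\<^sup>+\<omega>. ennreal ((cmod (u i \<omega>))\<^sup>2) \<partial>\<mu>)"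
      using level_sets[OF n]
      by (subst nn_integral_restrict_space) (auto intro!: nn_integral_cong simp: u_def indicator_def)
  qed
  also have "\<dots> = (\<integral>\<^sup>+\<omega>. (\<integral>\<^sup>+i. ennreal ((cmod (u i \<omega>))\<^sup>2) \<partial>count_space {1..}) \<partial>\<mu>)"
    using u by (intro nn_integral_count_space_nn_integral[symmetric]) auto
  also have "\<dots> = (\<integral>\<^sup>+\<omega>. (\<Sum>i\<in>{1..n \<omega>}. ennreal ((cmod (f (i, []) \<omega>))\<^sup>2)) \<partial>\<mu>)"
  proof (intro nn_integral_cong)
    fix \<omega> assume "\<omega> \<in> space \<mu>"
    then show "(\<integral>\<^sup>+i. ennreal ((cmod (u i \<omega>))\<^sup>2) \<partial>count_space {1..}) =
        (\<Sum>i\<in>{1..n \<omega>}. ennreal ((cmod (f (i, []) \<omega>))\<^sup>2))"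
      by (subst nn_integral_count_space'[of "{1..n \<omega>}"])
         (auto simp: u_def level_def space_\<mu> intro!: sum.cong)
  qed
  finally show ?thesis .
qed

lemma l2_fun_levelI:
  assumes "multiplicity n"
    and "\<And>i. i \<ge> 1 \<Longrightarrow> f (i, []) \<in> borel_measurable (restrict_space \<mu> (level n i))"
    and "(\<integral>\<^sup>+\<omega>. (\<Sum>i\<in>{1..n \<omega>}. ennreal ((cmod (f (i, []) \<omega>))\<^sup>2)) \<partial>\<mu>) < \<infinity>"
  shows "f \<in> l2_fun (level_fam \<mu> n)"
proof -
  have "l2_sqnorm (level_fam \<mu> n) f < \<infinity>"
    by (subst l2_sqnorm_level[of n f, OF assms(1,2)]) (simp_all only: assms(3))
  then show ?thesis using assms(2) by (auto simp: l2_fun_iff fst_level_fam snd_level_fam)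
qed

lemma l2_fun_level_measurable:
  assumes "f \<in> l2_fun (level_fam \<mu> n)" "i \<ge> 1"
  shows "f (i, []) \<in> borel_measurable (restrict_space \<mu> (level n i))"
  using l2_fun_measurable[OF assms(1), of "(i, [])"] assms(2)
  by (simp add: fst_level_fam snd_level_fam)

lemma AE_level_iff:
  assumes "multiplicity n"
  shows "(\<forall>p\<in>fst (level_fam \<mu> n). AE \<omega> in snd (level_fam \<mu> n) p. P p \<omega>) \<longleftrightarrow>
    (AE \<omega> in \<mu>. \<forall>i\<in>{1..n \<omega>}. P (i, []) \<omega>)"
proof -
  have "(\<forall>p\<in>fst (level_fam \<mu> n). AE \<omega> in snd (level_fam \<mu> n) p. P p \<omega>) \<longleftrightarrow>
      (\<forall>i\<in>{1..}. AE \<omega> in restrict_space \<mu> (level n i). P (i, []) \<omega>)"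
    unfolding fst_level_fam snd_level_fam[symmetric, of \<mu> n _ "[]"] by blast
  also have "\<dots> \<longleftrightarrow> (\<forall>i\<in>{1..}. AE \<omega> in \<mu>. \<omega> \<in> level n i \<longrightarrow> P (i, []) \<omega>)"
    using level_sets[OF assms] by (simp add: AE_restrict_space_iff)
  also have "\<dots> \<longleftrightarrow> (AE \<omega> in \<mu>. \<forall>i\<in>{1..}. \<omega> \<in> level n i \<longrightarrow> P (i, []) \<omega>)"
    by (intro AE_ball_countable[symmetric]) simp
  also have "\<dots> \<longleftrightarrow> (AE \<omega> in \<mu>. \<forall>i\<in>{1..n \<omega>}. P (i, []) \<omega>)"
    by (intro AE_cong) (auto simp: level_def space_\<mu>)
  finally show ?thesis .
qed

end

section \<open>Ruelle operators and fibrewise bases\<close>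

text \<open>The coordinates of the vector that the components of an element of \<open>\<V>\<^sub>0\<close> form over the fibre
  of \<open>\<omega>\<close>. The entries of row \<open>i\<close> of a matrix \<open>A\<close> at these coordinates are the values \<open>A i j \<zeta>\<close>.\<close>

definition fibre_pairs :: "('g::ab_group_add \<Rightarrow> 'g) \<Rightarrow> ('g dual \<Rightarrow> nat) \<Rightarrow> 'g dual \<Rightarrow> ('g dual \<times> nat) set"
  where "fibre_pairs \<alpha> m \<omega> = Sigma (fibre \<alpha> \<omega>) (\<lambda>\<zeta>. {1..m \<zeta>})"

text \<open>The coefficients of the fibre vectors of \<open>F\<close> along the rows of \<open>A\<close>; up to a constant factor this
  is the adjoint of the Ruelle operator.\<close>

definition coruelle :: "('g::ab_group_add \<Rightarrow> 'g) \<Rightarrow> ('g dual \<Rightarrow> nat) \<Rightarrow> 'g fmatrix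
    \<Rightarrow> ('g idx \<Rightarrow> 'g dual \<Rightarrow> complex) \<Rightarrow> 'g idx \<Rightarrow> 'g dual \<Rightarrow> complex" where
  "coruelle \<alpha> m A F = (\<lambda>(i, zs) \<omega>.
     (\<Sum>(\<zeta>, j)\<in>fibre_pairs \<alpha> m \<omega>. F (j, []) \<zeta> * cnj (A i j \<zeta>)) / of_real (real (ind \<alpha>)))"

locale ruelle_setting = dual_dynamics \<alpha> \<mu> c
  for \<alpha> :: "'g::{ab_group_add, countable} \<Rightarrow> 'g" and \<mu> c +
  fixes m :: "'g dual \<Rightarrow> nat"
  assumes m_measurable: "multiplicity m" and ind_pos: "ind \<alpha> > 0"
begin

text \<open>The equations that \<open>H\<close> satisfies with \<open>n = m\<close>, and \<open>G\<close> with the complementary multiplicity function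
  as \<open>n\<close>.\<close>

definition relative_filter :: "('g dual \<Rightarrow> nat) \<Rightarrow> 'g fmatrix \<Rightarrow> bool" where
  "relative_filter n A \<longleftrightarrow> multiplicity n \<and> supported_matrix \<mu> m A \<and>
     (\<forall>i\<ge>1. \<forall>i'\<ge>1. AE \<omega> in \<mu>. fibre_ip \<alpha> (A i) (A i') \<omega> =
        (if i = i' then of_nat (ind \<alpha>) * indicator (level n i) \<omega> else 0))"

lemma finite_fibre_pairs: "finite (fibre_pairs \<alpha> m \<omega>)"
  by (simp add: fibre_pairs_def finite_fibre)

lemma sum_fibre_pairs:
  "(\<Sum>(\<zeta>, j)\<in>fibre_pairs \<alpha> m \<omega>. \<phi> \<zeta> j) = (\<Sum>\<zeta>\<in>fibre \<alpha> \<omega>. \<Sum>j\<in>{1..m \<zeta>}. \<phi> \<zeta> j)"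
  unfolding fibre_pairs_def by (simp add: sum.Sigma finite_fibre)

text \<open>At a point in whose fibre the supports are respected without exception, the infinite sums
  are sums over the finitely many coordinates.\<close>

lemma fibre_ip_eq:
  assumes "\<And>\<zeta> j. \<zeta> \<in> fibre \<alpha> \<omega> \<Longrightarrow> j \<ge> 1 \<Longrightarrow> \<zeta> \<notin> level m j \<Longrightarrow> a j \<zeta> = 0"
  shows "fibre_ip \<alpha> a b \<omega> = (\<Sum>(\<zeta>, j)\<in>fibre_pairs \<alpha> m \<omega>. a j \<zeta> * cnj (b j \<zeta>))"
  unfolding fibre_ip_def sum_fibre_pairs
proof (rule sum.cong[OF refl])
  fix \<zeta> assume \<zeta>: "\<zeta> \<in> fibre \<alpha> \<omega>"
  have "(\<Sum>\<^sub>\<infinity>j\<in>{1..}. a j \<zeta> * cnj (b j \<zeta>)) = (\<Sum>\<^sub>\<infinity>j\<in>{1..m \<zeta>}. a j \<zeta> * cnj (b j \<zeta>))"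
    by (rule infsum_cong_neutral) (use assms[OF \<zeta>] in \<open>auto simp: level_def\<close>)
  then show "(\<Sum>\<^sub>\<infinity>j\<in>{1..}. a j \<zeta> * cnj (b j \<zeta>)) = (\<Sum>j\<in>{1..m \<zeta>}. a j \<zeta> * cnj (b j \<zeta>))"
    by simp
qed

lemma supported_fibres:
  assumes "supported_matrix \<mu> m A"
  shows "AE \<omega> in \<mu>. \<forall>\<zeta>\<in>fibre \<alpha> \<omega>. \<forall>i\<in>{1..}. \<forall>j\<in>{1..}. \<zeta> \<notin> level m j \<longrightarrow> A i j \<zeta> = 0"
proof (rule AE_fibre)
  have "\<forall>i\<in>{1..}. AE \<zeta> in \<mu>. \<forall>j\<in>{1..}. \<zeta> \<notin> level m j \<longrightarrow> A i j \<zeta> = 0"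
    using assms by (auto simp: supported_matrix_def AE_ball_countable)
  then show "AE \<zeta> in \<mu>. \<forall>i\<in>{1..}. \<forall>j\<in>{1..}. \<zeta> \<notin> level m j \<longrightarrow> A i j \<zeta> = 0"
    by (simp add: AE_ball_countable)
qed

lemma filter_measurable: "relative_filter n A \<Longrightarrow> i \<ge> 1 \<Longrightarrow> j \<ge> 1 \<Longrightarrow> A i j \<in> borel_measurable \<mu>"
  by (simp add: relative_filter_def supported_matrix_def)

lemma relation_fibre_pairs:
  fixes A B :: "'g fmatrix"
  assumes "supported_matrix \<mu> m A"
    and "\<forall>i\<ge>1. \<forall>k\<ge>1. AE \<omega> in \<mu>. fibre_ip \<alpha> (A i) (B k) \<omega> = \<rho> i k \<omega>"
  shows "AE \<omega> in \<mu>. \<forall>i\<in>{1..}. \<forall>k\<in>{1..}.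
    (\<Sum>(\<zeta>, j)\<in>fibre_pairs \<alpha> m \<omega>. A i j \<zeta> * cnj (B k j \<zeta>)) = \<rho> i k \<omega>"
proof -
  have "AE \<omega> in \<mu>. fibre_ip \<alpha> (A i) (B k) \<omega> = \<rho> i k \<omega>" if "i \<in> {1..}" "k \<in> {1..}" for i k
    using assms(2) that unfolding atLeast_iff by blast
  then have "AE \<omega> in \<mu>. \<forall>i\<in>{1..}. \<forall>k\<in>{1..}. fibre_ip \<alpha> (A i) (B k) \<omega> = \<rho> i k \<omega>"
    by (simp add: AE_ball_countable)
  with supported_fibres[OF assms(1)] show ?thesis
  proof eventually_elim
    fix \<omega>
    assume supp: "\<forall>\<zeta>\<in>fibre \<alpha> \<omega>. \<forall>i\<in>{1..}. \<forall>j\<in>{1..}. \<zeta> \<notin> level m j \<longrightarrow> A i j \<zeta> = 0"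
      and rel: "\<forall>i\<in>{1..}. \<forall>k\<in>{1..}. fibre_ip \<alpha> (A i) (B k) \<omega> = \<rho> i k \<omega>"
    show "\<forall>i\<in>{1..}. \<forall>k\<in>{1..}. (\<Sum>(\<zeta>, j)\<in>fibre_pairs \<alpha> m \<omega>. A i j \<zeta> * cnj (B k j \<zeta>)) = \<rho> i k \<omega>"
    proof (intro ballI)
      fix i k :: nat assume ik: "i \<in> {1..}" "k \<in> {1..}"
      have "fibre_ip \<alpha> (A i) (B k) \<omega> = (\<Sum>(\<zeta>, j)\<in>fibre_pairs \<alpha> m \<omega>. A i j \<zeta> * cnj (B k j \<zeta>))"
        using supp ik by (intro fibre_ip_eq) auto
      then show "(\<Sum>(\<zeta>, j)\<in>fibre_pairs \<alpha> m \<omega>. A i j \<zeta> * cnj (B k j \<zeta>)) = \<rho> i k \<omega>"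
        using rel ik by simp
    qed
  qed
qed

lemma orthogonal_rows:
  assumes "relative_filter n A"
  shows "AE \<omega> in \<mu>. \<forall>i\<in>{1..n \<omega>}. \<forall>i'\<in>{1..n \<omega>}.
    (\<Sum>(\<zeta>, j)\<in>fibre_pairs \<alpha> m \<omega>. A i j \<zeta> * cnj (A i' j \<zeta>)) = (if i = i' then of_real (real (ind \<alpha>)) else 0)"
proof -
  have "AE \<omega> in \<mu>. \<forall>i\<in>{1..}. \<forall>k\<in>{1..}.
      (\<Sum>(\<zeta>, j)\<in>fibre_pairs \<alpha> m \<omega>. A i j \<zeta> * cnj (A k j \<zeta>)) =
        (if i = k then of_nat (ind \<alpha>) * indicator (level n i) \<omega> else 0)"
    using assms by (intro relation_fibre_pairs) (auto simp: relative_filter_def)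
  moreover have "AE \<omega> in \<mu>. \<omega> \<in> dual_group" by (rule AE_I2) (simp add: space_\<mu>)
  ultimately show ?thesis by eventually_elim (auto simp: level_def)
qed

lemma ruelle_eq_sum:
  assumes "\<zeta> \<in> fibre \<alpha> \<omega>"
  shows "ruelle \<alpha> n A f (j, zs) \<zeta> = (\<Sum>i\<in>{1..n \<omega>}. A i j \<zeta> * f (i, []) \<omega>)"
proof -
  have \<omega>: "dual_endo \<alpha> \<zeta> = \<omega>" "\<omega> \<in> dual_group" using assms endo_in_dual by (auto simp: fibre_def)
  have "ruelle \<alpha> n A f (j, zs) \<zeta> =
      (\<Sum>\<^sub>\<infinity>i\<in>{1..n \<omega>}. A i j \<zeta> * (indicator (level n i) \<omega> * f (i, []) \<omega>))"
    unfolding ruelle_def prod.case \<omega>(1)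
    by (rule infsum_cong_neutral) (auto simp: level_def)
  also have "\<dots> = (\<Sum>i\<in>{1..n \<omega>}. A i j \<zeta> * f (i, []) \<omega>)"
    using \<omega>(2) by (simp, intro sum.cong) (auto simp: level_def)
  finally show ?thesis .
qed

lemma ruelle_measurable:
  assumes A: "relative_filter n A" and f: "f \<in> l2_fun (level_fam \<mu> n)" and j: "j \<ge> 1"
  shows "ruelle \<alpha> n A f (j, zs) \<in> borel_measurable \<mu>"
proof -
  have n: "multiplicity n" using A by (simp add: relative_filter_def)
  define u where "u = (\<lambda>i \<omega>. if \<omega> \<in> level n i then f (i, []) \<omega> else 0)"
  have "(\<lambda>\<zeta>. A i j \<zeta> * u i (dual_endo \<alpha> \<zeta>)) \<in> borel_measurable \<mu>" if "i \<ge> 1" for i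
    unfolding u_def
    by (intro borel_measurable_times filter_measurable[OF A that j]
        measurable_compose[OF endo_measurable extend_measurable[OF n l2_fun_level_measurable[OF f that]]])
  then have "(\<lambda>\<zeta>. \<Sum>i\<in>{1..k}. A i j \<zeta> * u i (dual_endo \<alpha> \<zeta>)) \<in> borel_measurable \<mu>" for k
    by (intro borel_measurable_sum) auto
  from measurable_compose_countable[OF this measurable_compose[OF endo_measurable n]]
  have "(\<lambda>\<zeta>. \<Sum>i\<in>{1..n (dual_endo \<alpha> \<zeta>)}. A i j \<zeta> * u i (dual_endo \<alpha> \<zeta>)) \<in> borel_measurable \<mu>" .
  then show ?thesis
  proof (rule measurable_cong[THEN iffD1, rotated])
    fix \<zeta> assume "\<zeta> \<in> space \<mu>"
    then have \<zeta>: "\<zeta> \<in> dual_group" by (simp add: space_\<mu>)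
    show "(\<Sum>i\<in>{1..n (dual_endo \<alpha> \<zeta>)}. A i j \<zeta> * u i (dual_endo \<alpha> \<zeta>)) = ruelle \<alpha> n A f (j, zs) \<zeta>"
      unfolding ruelle_eq_sum[OF in_fibre_endo[OF \<zeta>]]
      using endo_in_dual[OF \<zeta>] by (intro sum.cong refl) (simp add: u_def level_def)
  qed
qed

lemma l2_sqnorm_fibres:
  assumes F: "\<And>j. j \<ge> 1 \<Longrightarrow> F (j, []) \<in> borel_measurable (restrict_space \<mu> (level m j))"
  shows "(\<integral>\<^sup>+\<omega>. ennreal (\<Sum>(\<zeta>, j)\<in>fibre_pairs \<alpha> m \<omega>. (cmod (F (j, []) \<zeta>))\<^sup>2) \<partial>\<mu>) =
    of_nat (card (dker \<alpha>)) * l2_sqnorm (level_fam \<mu> m) F"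
proof -
  define \<Phi> where "\<Phi> = (\<lambda>\<zeta>. \<Sum>j\<in>{1..m \<zeta>}. ennreal ((cmod (F (j, []) \<zeta>))\<^sup>2))"
  have "\<Phi> \<in> borel_measurable \<mu>"
    unfolding \<Phi>_def
  proof (rule sum_levels_measurable[OF m_measurable])
    fix j :: nat assume "j \<ge> 1"
    from extend_measurable[OF m_measurable F[OF this]]
    have "(\<lambda>\<zeta>. ennreal ((cmod (if \<zeta> \<in> level m j then F (j, []) \<zeta> else 0))\<^sup>2)) \<in> borel_measurable \<mu>"
      by measurable
    then show "(\<lambda>\<zeta>. if \<zeta> \<in> level m j then ennreal ((cmod (F (j, []) \<zeta>))\<^sup>2) else 0) \<in> borel_measurable \<mu>"
      by (rule measurable_cong[THEN iffD1, rotated]) simp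
  qed
  then have "(\<integral>\<^sup>+\<omega>. (\<Sum>\<zeta>\<in>fibre \<alpha> \<omega>. \<Phi> \<zeta>) \<partial>\<mu>) = of_nat (card (dker \<alpha>)) * (\<integral>\<^sup>+\<zeta>. \<Phi> \<zeta> \<partial>\<mu>)"
    by (rule nn_integral_fibre)
  moreover have "l2_sqnorm (level_fam \<mu> m) F = (\<integral>\<^sup>+\<zeta>. \<Phi> \<zeta> \<partial>\<mu>)"
    unfolding \<Phi>_def by (rule l2_sqnorm_level[OF m_measurable F])
  ultimately show ?thesis
    by (simp add: \<Phi>_def sum_fibre_pairs sum_nonneg)
qed

text \<open>The values of the Ruelle operator over the fibre of \<open>\<omega>\<close> are a linear combination of orthogonal
  rows of squared length \<open>N\<close> with coefficients \<open>f\<^sub>i(\<omega>)\<close>. So the squared lengths are multiplied by \<open>N\<close>,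
  and the integral over fibres counts every point as often as the kernel has elements.\<close>

lemma l2_operator_ruelle:
  assumes A: "relative_filter n A"
  shows "l2_operator (level_fam \<mu> n) (level_fam \<mu> m) (real (ind \<alpha>) / real (card (dker \<alpha>))) (ruelle \<alpha> n A)"
  unfolding l2_operator_def
proof (intro conjI ballI allI)
  have n: "multiplicity n" using A by (simp add: relative_filter_def)
  fix f assume f: "f \<in> l2_fun (level_fam \<mu> n)"
  define R where "R = ruelle \<alpha> n A f"
  have R_meas: "R (j, []) \<in> borel_measurable (restrict_space \<mu> (level m j))" if "j \<ge> 1" for j
    unfolding R_def by (intro measurable_restrict_space1 ruelle_measurable[OF A f that])
  have "of_nat (card (dker \<alpha>)) * l2_sqnorm (level_fam \<mu> m) R =
      (\<integral>\<^sup>+\<omega>. ennreal (\<Sum>(\<zeta>, j)\<in>fibre_pairs \<alpha> m \<omega>. (cmod (R (j, []) \<zeta>))\<^sup>2) \<partial>\<mu>)"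
    by (rule l2_sqnorm_fibres[OF R_meas, symmetric])
  also have "\<dots> = (\<integral>\<^sup>+\<omega>. ennreal (real (ind \<alpha>)) * (\<Sum>i\<in>{1..n \<omega>}. ennreal ((cmod (f (i, []) \<omega>))\<^sup>2)) \<partial>\<mu>)"
  proof (rule nn_integral_cong_AE)
    from orthogonal_rows[OF A]
    show "AE \<omega> in \<mu>. ennreal (\<Sum>(\<zeta>, j)\<in>fibre_pairs \<alpha> m \<omega>. (cmod (R (j, []) \<zeta>))\<^sup>2) =
        ennreal (real (ind \<alpha>)) * (\<Sum>i\<in>{1..n \<omega>}. ennreal ((cmod (f (i, []) \<omega>))\<^sup>2))"
    proof eventually_elim
      fix \<omega>
      assume rows: "\<forall>i\<in>{1..n \<omega>}. \<forall>i'\<in>{1..n \<omega>}. (\<Sum>(\<zeta>, j)\<in>fibre_pairs \<alpha> m \<omega>.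
        A i j \<zeta> * cnj (A i' j \<zeta>)) = (if i = i' then of_real (real (ind \<alpha>)) else 0)"
      have "(\<Sum>(\<zeta>, j)\<in>fibre_pairs \<alpha> m \<omega>. (cmod (R (j, []) \<zeta>))\<^sup>2) =
          (\<Sum>p\<in>fibre_pairs \<alpha> m \<omega>. (cmod (\<Sum>i\<in>{1..n \<omega>}. (case p of (\<zeta>, j) \<Rightarrow> A i j \<zeta>) * f (i, []) \<omega>))\<^sup>2)"
        unfolding R_def by (intro sum.cong refl) (auto simp: fibre_pairs_def ruelle_eq_sum)
      also have "\<dots> = real (ind \<alpha>) * (\<Sum>i\<in>{1..n \<omega>}. (cmod (f (i, []) \<omega>))\<^sup>2)"
        using rows by (intro rows_parseval finite_fibre_pairs) (auto simp: case_prod_unfold)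
      finally show "ennreal (\<Sum>(\<zeta>, j)\<in>fibre_pairs \<alpha> m \<omega>. (cmod (R (j, []) \<zeta>))\<^sup>2) =
          ennreal (real (ind \<alpha>)) * (\<Sum>i\<in>{1..n \<omega>}. ennreal ((cmod (f (i, []) \<omega>))\<^sup>2))"
        by (simp add: ennreal_mult sum_nonneg)
    qed
  qed
  also have "\<dots> = ennreal (real (ind \<alpha>)) * l2_sqnorm (level_fam \<mu> n) f"
  proof -
    have "(\<lambda>\<omega>. \<Sum>i\<in>{1..n \<omega>}. ennreal ((cmod (f (i, []) \<omega>))\<^sup>2)) \<in> borel_measurable \<mu>"
    proof (rule sum_levels_measurable[OF n])
      fix i :: nat assume "i \<ge> 1"
      from extend_measurable[OF n l2_fun_level_measurable[OF f this]]
      have "(\<lambda>\<omega>. ennreal ((cmod (if \<omega> \<in> level n i then f (i, []) \<omega> else 0))\<^sup>2)) \<in> borel_measurable \<mu>"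
        by measurable
      then show "(\<lambda>\<omega>. if \<omega> \<in> level n i then ennreal ((cmod (f (i, []) \<omega>))\<^sup>2) else 0) \<in> borel_measurable \<mu>"
        by (rule measurable_cong[THEN iffD1, rotated]) simp
    qed
    then show ?thesis
      by (simp only: nn_integral_cmult l2_sqnorm_level[OF n l2_fun_level_measurable[OF f]])
  qed
  finally have eq: "of_nat (card (dker \<alpha>)) * l2_sqnorm (level_fam \<mu> m) R =
    ennreal (real (ind \<alpha>)) * l2_sqnorm (level_fam \<mu> n) f" .
  define M where "M = real (card (dker \<alpha>))"
  have M: "M > 0" using card_dker_pos by (simp add: M_def)
  have "l2_sqnorm (level_fam \<mu> m) R = ennreal (inverse M * M) * l2_sqnorm (level_fam \<mu> m) R"
    using M by simp
  also have "\<dots> = ennreal (inverse M) * (ennreal M * l2_sqnorm (level_fam \<mu> m) R)"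
    using M by (simp only: ennreal_mult less_imp_le inverse_positive_iff_positive mult.assoc)
  also have "ennreal M * l2_sqnorm (level_fam \<mu> m) R = ennreal (real (ind \<alpha>)) * l2_sqnorm (level_fam \<mu> n) f"
    using eq by (simp add: M_def ennreal_of_nat_eq_real_of_nat)
  also have "ennreal (inverse M) * (ennreal (real (ind \<alpha>)) * l2_sqnorm (level_fam \<mu> n) f) =
      ennreal (real (ind \<alpha>) / M) * l2_sqnorm (level_fam \<mu> n) f"
    using M by (simp add: mult.assoc[symmetric] ennreal_mult[symmetric] field_simps)
  finally show norm: "l2_sqnorm (level_fam \<mu> m) (ruelle \<alpha> n A f) =
      ennreal (real (ind \<alpha>) / real (card (dker \<alpha>))) * l2_sqnorm (level_fam \<mu> n) f"
    by (simp add: R_def M_def)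
  show "ruelle \<alpha> n A f \<in> l2_fun (level_fam \<mu> m)"
    unfolding l2_fun_iff norm using f R_meas
    by (auto simp: l2_fun_iff fst_level_fam snd_level_fam R_def ennreal_mult_less_top)
next
  fix f g a p
  assume "f \<in> l2_fun (level_fam \<mu> n)" "g \<in> l2_fun (level_fam \<mu> n)" and p: "p \<in> fst (level_fam \<mu> m)"
  show "AE \<zeta> in snd (level_fam \<mu> m) p. ruelle \<alpha> n A (\<lambda>i x. f i x + a * g i x) p \<zeta> =
      ruelle \<alpha> n A f p \<zeta> + a * ruelle \<alpha> n A g p \<zeta>"
  proof (rule AE_I2)
    fix \<zeta> assume "\<zeta> \<in> space (snd (level_fam \<mu> m) p)"
    then have "\<zeta> \<in> dual_group"
      using p by (auto simp: fst_level_fam snd_level_fam space_restrict_space space_\<mu>)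
    note ruelle = ruelle_eq_sum[OF in_fibre_endo[OF this]]
    show "ruelle \<alpha> n A (\<lambda>i x. f i x + a * g i x) p \<zeta> =
        ruelle \<alpha> n A f p \<zeta> + a * ruelle \<alpha> n A g p \<zeta>"
      by (cases p) (simp add: ruelle sum.distrib sum_distrib_left algebra_simps)
  qed
qed

lemma scale_pos: "real (ind \<alpha>) / real (card (dker \<alpha>)) > 0"
  using ind_pos card_dker_pos by simp

end

locale complementary_pair = ruelle_setting \<alpha> \<mu> c m
  for \<alpha> :: "'g::{ab_group_add, countable} \<Rightarrow> 'g" and \<mu> c m +
  fixes H G :: "'g fmatrix"
  assumes mult: "multiplicity_function \<alpha> \<mu> m"
    and H_filter: "filter_rel \<alpha> \<mu> m H"
    and G_complementary: "complementary_filter \<alpha> \<mu> m H G"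
begin

abbreviation "m' \<equiv> comp_mult \<alpha> m"

lemma comp_mult_measurable: "multiplicity m'"
proof -
  have "(\<lambda>\<zeta>. real (m \<zeta>)) \<in> borel_measurable \<mu>"
    by (rule measurable_compose[OF m_measurable]) simp
  then have "(\<lambda>\<omega>. \<Sum>\<zeta>\<in>fibre \<alpha> \<omega>. real (m \<zeta>)) \<in> borel_measurable \<mu>"
    by (rule sum_fibre_measurable)
  then have "(\<lambda>\<omega>. nat \<lfloor>\<Sum>\<zeta>\<in>fibre \<alpha> \<omega>. real (m \<zeta>)\<rfloor>) \<in> \<mu> \<rightarrow>\<^sub>M count_space UNIV" by measurable
  then have "(\<lambda>\<omega>. \<Sum>\<zeta>\<in>fibre \<alpha> \<omega>. m \<zeta>) \<in> \<mu> \<rightarrow>\<^sub>M count_space UNIV"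
    by (simp flip: of_nat_sum)
  then show ?thesis unfolding comp_mult_def using m_measurable by measurable
qed

lemma H_relative: "relative_filter m H"
  using H_filter m_measurable by (simp add: relative_filter_def filter_rel_def)

lemma G_relative: "relative_filter m' G"
  using G_complementary comp_mult_measurable
  by (simp add: relative_filter_def complementary_filter_def)

definition basis_indices :: "'g dual \<Rightarrow> (nat + nat) set" where
  "basis_indices \<omega> = {1..m \<omega>} <+> {1..m' \<omega>}"

definition basis :: "nat + nat \<Rightarrow> 'g dual \<times> nat \<Rightarrow> complex" where
  "basis a = (\<lambda>(\<zeta>, j). case a of Inl i \<Rightarrow> H i j \<zeta> | Inr k \<Rightarrow> G k j \<zeta>)"

definition orthogonal_basis_at :: "'g dual \<Rightarrow> bool" where
  "orthogonal_basis_at \<omega> \<longleftrightarrow> card (basis_indices \<omega>) = card (fibre_pairs \<alpha> m \<omega>) \<and>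
    (\<forall>a\<in>basis_indices \<omega>. \<forall>a'\<in>basis_indices \<omega>.
      (\<Sum>p\<in>fibre_pairs \<alpha> m \<omega>. basis a p * cnj (basis a' p)) = (if a = a' then of_real (real (ind \<alpha>)) else 0))"

text \<open>The filter equations and the complementarity equations provide orthogonality. The number of
  vectors is right because \<open>m \<omega> \<le> \<Sum>\<zeta>. m \<zeta>\<close>, so that the subtraction in the complementary multiplicity
  is not truncated.\<close>

lemma AE_orthogonal_basis: "AE \<omega> in \<mu>. orthogonal_basis_at \<omega>"
proof -
  have "AE \<omega> in \<mu>. m \<omega> \<le> (\<Sum>\<zeta>\<in>fibre \<alpha> \<omega>. m \<zeta>)"
    using mult by (simp add: multiplicity_function_def)
  moreover have "AE \<omega> in \<mu>. \<forall>k\<in>{1..}. \<forall>i\<in>{1..}.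
      (\<Sum>(\<zeta>, j)\<in>fibre_pairs \<alpha> m \<omega>. G k j \<zeta> * cnj (H i j \<zeta>)) = 0"
    using G_complementary by (intro relation_fibre_pairs) (auto simp: complementary_filter_def)
  ultimately show ?thesis
    using orthogonal_rows[OF H_relative] orthogonal_rows[OF G_relative]
  proof eventually_elim
    fix \<omega>
    assume le: "m \<omega> \<le> (\<Sum>\<zeta>\<in>fibre \<alpha> \<omega>. m \<zeta>)"
      and cross: "\<forall>k\<in>{1..}. \<forall>i\<in>{1..}. (\<Sum>(\<zeta>, j)\<in>fibre_pairs \<alpha> m \<omega>. G k j \<zeta> * cnj (H i j \<zeta>)) = 0"
      and HH: "\<forall>i\<in>{1..m \<omega>}. \<forall>i'\<in>{1..m \<omega>}. (\<Sum>(\<zeta>, j)\<in>fibre_pairs \<alpha> m \<omega>.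
        H i j \<zeta> * cnj (H i' j \<zeta>)) = (if i = i' then of_real (real (ind \<alpha>)) else 0)"
      and GG: "\<forall>i\<in>{1..m' \<omega>}. \<forall>i'\<in>{1..m' \<omega>}. (\<Sum>(\<zeta>, j)\<in>fibre_pairs \<alpha> m \<omega>.
        G i j \<zeta> * cnj (G i' j \<zeta>)) = (if i = i' then of_real (real (ind \<alpha>)) else 0)"
    have "card (fibre_pairs \<alpha> m \<omega>) = (\<Sum>\<zeta>\<in>fibre \<alpha> \<omega>. m \<zeta>)"
      by (simp add: fibre_pairs_def card_SigmaI finite_fibre)
    then have "card (basis_indices \<omega>) = card (fibre_pairs \<alpha> m \<omega>)"
      using le by (simp add: basis_indices_def card_Plus comp_mult_def)
    moreover have HG: "(\<Sum>(\<zeta>, j)\<in>fibre_pairs \<alpha> m \<omega>. H i j \<zeta> * cnj (G k j \<zeta>)) = 0" if "i \<ge> 1" "k \<ge> 1" for i k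
    proof -
      have "(\<Sum>(\<zeta>, j)\<in>fibre_pairs \<alpha> m \<omega>. H i j \<zeta> * cnj (G k j \<zeta>)) =
          cnj (\<Sum>(\<zeta>, j)\<in>fibre_pairs \<alpha> m \<omega>. G k j \<zeta> * cnj (H i j \<zeta>))"
        by (simp add: case_prod_unfold mult.commute)
      then show ?thesis using cross that by simp
    qed
    ultimately show "orthogonal_basis_at \<omega>"
      unfolding orthogonal_basis_at_def
    proof (intro conjI ballI)
      fix a a' assume "a \<in> basis_indices \<omega>" "a' \<in> basis_indices \<omega>"
      then show "(\<Sum>p\<in>fibre_pairs \<alpha> m \<omega>. basis a p * cnj (basis a' p)) =
          (if a = a' then of_real (real (ind \<alpha>)) else 0)"
        using HH GG cross HG unfolding basis_indices_def
        by (elim PlusE) (simp_all add: basis_def case_prod_unfold)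
    qed
  qed
qed

lemma coruelle_basis:
  "coruelle \<alpha> m H F (i, zs) \<omega> =
     (\<Sum>p\<in>fibre_pairs \<alpha> m \<omega>. F (snd p, []) (fst p) * cnj (basis (Inl i) p)) / of_real (real (ind \<alpha>))"
  "coruelle \<alpha> m G F (i, zs) \<omega> =
     (\<Sum>p\<in>fibre_pairs \<alpha> m \<omega>. F (snd p, []) (fst p) * cnj (basis (Inr i) p)) / of_real (real (ind \<alpha>))"
  by (simp_all add: coruelle_def basis_def case_prod_unfold)

lemma sum_basis_indices:
  "(\<Sum>a\<in>basis_indices \<omega>. \<phi> a) = (\<Sum>i\<in>{1..m \<omega>}. \<phi> (Inl i)) + (\<Sum>k\<in>{1..m' \<omega>}. \<phi> (Inr k))"
  unfolding basis_indices_def by (simp add: sum.Plus)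

lemma ruelle_basis:
  assumes "(\<zeta>, j) \<in> fibre_pairs \<alpha> m \<omega>"
  shows "ruelle \<alpha> m H v (j, []) \<zeta> + ruelle \<alpha> m' G w (j, []) \<zeta> =
    (\<Sum>a\<in>basis_indices \<omega>. basis a (\<zeta>, j) * (case a of Inl i \<Rightarrow> v (i, []) \<omega> | Inr k \<Rightarrow> w (k, []) \<omega>))"
proof -
  have "\<zeta> \<in> fibre \<alpha> \<omega>" using assms by (simp add: fibre_pairs_def)
  then show ?thesis by (simp add: sum_basis_indices ruelle_eq_sum basis_def)
qed

lemma coruelle_measurable:
  assumes A: "relative_filter n A" and F: "F \<in> l2_fun (level_fam \<mu> m)" and i: "i \<ge> 1"
  shows "coruelle \<alpha> m A F (i, zs) \<in> borel_measurable \<mu>"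
proof -
  have "(\<lambda>\<zeta>. \<Sum>j\<in>{1..m \<zeta>}. F (j, []) \<zeta> * cnj (A i j \<zeta>)) \<in> borel_measurable \<mu>"
  proof (rule sum_levels_measurable[OF m_measurable])
    fix j :: nat assume j: "j \<ge> 1"
    have "(\<lambda>\<zeta>. (if \<zeta> \<in> level m j then F (j, []) \<zeta> else 0) * cnj (A i j \<zeta>)) \<in> borel_measurable \<mu>"
      by (intro borel_measurable_times measurable_cnj filter_measurable[OF A i j]
          extend_measurable[OF m_measurable l2_fun_level_measurable[OF F j]])
    then show "(\<lambda>\<zeta>. if \<zeta> \<in> level m j then F (j, []) \<zeta> * cnj (A i j \<zeta>) else 0) \<in> borel_measurable \<mu>"
      by (rule measurable_cong[THEN iffD1, rotated]) simp
  qed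
  then have "(\<lambda>\<omega>. (\<Sum>\<zeta>\<in>fibre \<alpha> \<omega>. \<Sum>j\<in>{1..m \<zeta>}. F (j, []) \<zeta> * cnj (A i j \<zeta>)) / of_real (real (ind \<alpha>)))
      \<in> borel_measurable \<mu>"
    by (intro borel_measurable_divide sum_fibre_measurable) auto
  then show ?thesis by (simp add: coruelle_def sum_fibre_pairs)
qed

text \<open>By Parseval's identity in each fibre, the squared lengths of both coefficient vectors together are
  the squared length of the fibre vector divided by \<open>N\<close>.\<close>

lemma coruelle_l2:
  assumes F: "F \<in> l2_fun (level_fam \<mu> m)"
  shows "coruelle \<alpha> m H F \<in> l2_fun (level_fam \<mu> m)" "coruelle \<alpha> m G F \<in> l2_fun (level_fam \<mu> m')"
proof -
  define vsq where "vsq = (\<lambda>\<omega>. \<Sum>i\<in>{1..m \<omega>}. (cmod (coruelle \<alpha> m H F (i, []) \<omega>))\<^sup>2)"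
  define wsq where "wsq = (\<lambda>\<omega>. \<Sum>k\<in>{1..m' \<omega>}. (cmod (coruelle \<alpha> m G F (k, []) \<omega>))\<^sup>2)"
  define Fsq where "Fsq = (\<lambda>\<omega>. \<Sum>(\<zeta>, j)\<in>fibre_pairs \<alpha> m \<omega>. (cmod (F (j, []) \<zeta>))\<^sup>2)"
  have bound: "AE \<omega> in \<mu>. vsq \<omega> + wsq \<omega> \<le> Fsq \<omega>"
    using AE_orthogonal_basis
  proof eventually_elim
    fix \<omega> assume "orthogonal_basis_at \<omega>"
    then have "(\<Sum>a\<in>basis_indices \<omega>. (cmod ((\<Sum>p\<in>fibre_pairs \<alpha> m \<omega>.
        F (snd p, []) (fst p) * cnj (basis a p)) / of_real (real (ind \<alpha>))))\<^sup>2) =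
        (\<Sum>p\<in>fibre_pairs \<alpha> m \<omega>. (cmod (F (snd p, []) (fst p)))\<^sup>2) / real (ind \<alpha>)"
      using ind_pos
      by (intro orthogonal_basis_expansion(2))
         (auto simp: orthogonal_basis_at_def finite_fibre_pairs basis_indices_def)
    then have "vsq \<omega> + wsq \<omega> = Fsq \<omega> / real (ind \<alpha>)"
      by (simp add: sum_basis_indices vsq_def wsq_def Fsq_def coruelle_basis case_prod_unfold)
    also have "\<dots> \<le> Fsq \<omega>"
    proof -
      have "Fsq \<omega> \<ge> 0" unfolding Fsq_def by (auto intro!: sum_nonneg)
      then show ?thesis using ind_pos by (simp add: divide_le_eq mult_le_cancel_left1)
    qed
    finally show "vsq \<omega> + wsq \<omega> \<le> Fsq \<omega>" .
  qed
  have nonneg: "vsq \<omega> \<ge> 0" "wsq \<omega> \<ge> 0" for \<omega> by (auto simp: vsq_def wsq_def intro!: sum_nonneg)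
  have fin: "(\<integral>\<^sup>+\<omega>. ennreal (Fsq \<omega>) \<partial>\<mu>) < \<infinity>"
  proof -
    have "(\<integral>\<^sup>+\<omega>. ennreal (Fsq \<omega>) \<partial>\<mu>) = of_nat (card (dker \<alpha>)) * l2_sqnorm (level_fam \<mu> m) F"
      unfolding Fsq_def by (rule l2_sqnorm_fibres) (rule l2_fun_level_measurable[OF F])
    also have "\<dots> < \<infinity>" using F by (simp add: l2_fun_iff ennreal_mult_less_top of_nat_less_top)
    finally show ?thesis .
  qed
  show "coruelle \<alpha> m H F \<in> l2_fun (level_fam \<mu> m)"
  proof (rule l2_fun_levelI[OF m_measurable])
    have "(\<integral>\<^sup>+\<omega>. ennreal (vsq \<omega>) \<partial>\<mu>) \<le> (\<integral>\<^sup>+\<omega>. ennreal (Fsq \<omega>) \<partial>\<mu>)"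
      using bound by (intro nn_integral_mono_AE, eventually_elim) (use nonneg in \<open>smt (verit) ennreal_leI\<close>)
    then show "(\<integral>\<^sup>+\<omega>. (\<Sum>i\<in>{1..m \<omega>}. ennreal ((cmod (coruelle \<alpha> m H F (i, []) \<omega>))\<^sup>2)) \<partial>\<mu>) < \<infinity>"
      using fin by (simp add: vsq_def)
  qed (intro measurable_restrict_space1 coruelle_measurable[OF H_relative F])
  show "coruelle \<alpha> m G F \<in> l2_fun (level_fam \<mu> m')"
  proof (rule l2_fun_levelI[OF comp_mult_measurable])
    have "(\<integral>\<^sup>+\<omega>. ennreal (wsq \<omega>) \<partial>\<mu>) \<le> (\<integral>\<^sup>+\<omega>. ennreal (Fsq \<omega>) \<partial>\<mu>)"
      using bound by (intro nn_integral_mono_AE, eventually_elim) (use nonneg in \<open>smt (verit) ennreal_leI\<close>)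
    then show "(\<integral>\<^sup>+\<omega>. (\<Sum>i\<in>{1..m' \<omega>}. ennreal ((cmod (coruelle \<alpha> m G F (i, []) \<omega>))\<^sup>2)) \<partial>\<mu>) < \<infinity>"
      using fin by (simp add: wsq_def)
  qed (intro measurable_restrict_space1 coruelle_measurable[OF G_relative F])
qed

lemma ruelle_reconstruction:
  assumes p: "p \<in> fst (level_fam \<mu> m)"
  shows "AE \<zeta> in snd (level_fam \<mu> m) p.
    ruelle \<alpha> m H (coruelle \<alpha> m H F) p \<zeta> + ruelle \<alpha> m' G (coruelle \<alpha> m G F) p \<zeta> = F p \<zeta>"
proof -
  have "AE \<zeta> in \<mu>. \<zeta> \<in> dual_group" by (rule AE_I2) (simp add: space_\<mu>)
  moreover have "AE \<zeta> in \<mu>. orthogonal_basis_at (dual_endo \<alpha> \<zeta>)"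
    by (rule AE_endo[OF AE_orthogonal_basis])
  ultimately have "AE \<zeta> in \<mu>. \<forall>j\<in>{1..m \<zeta>}. ruelle \<alpha> m H (coruelle \<alpha> m H F) (j, []) \<zeta>
      + ruelle \<alpha> m' G (coruelle \<alpha> m G F) (j, []) \<zeta> = F (j, []) \<zeta>"
  proof eventually_elim
    fix \<zeta> :: "'g dual" assume \<zeta>: "\<zeta> \<in> dual_group" and basis: "orthogonal_basis_at (dual_endo \<alpha> \<zeta>)"
    show "\<forall>j\<in>{1..m \<zeta>}. ruelle \<alpha> m H (coruelle \<alpha> m H F) (j, []) \<zeta>
      + ruelle \<alpha> m' G (coruelle \<alpha> m G F) (j, []) \<zeta> = F (j, []) \<zeta>"
    proof
      define \<omega> where "\<omega> = dual_endo \<alpha> \<zeta>"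
      fix j assume "j \<in> {1..m \<zeta>}"
      then have p: "(\<zeta>, j) \<in> fibre_pairs \<alpha> m \<omega>"
        using in_fibre_endo[OF \<zeta>] by (simp add: fibre_pairs_def \<omega>_def)
      have "ruelle \<alpha> m H (coruelle \<alpha> m H F) (j, []) \<zeta> + ruelle \<alpha> m' G (coruelle \<alpha> m G F) (j, []) \<zeta> =
        (\<Sum>a\<in>basis_indices \<omega>. basis a (\<zeta>, j) * ((\<Sum>p\<in>fibre_pairs \<alpha> m \<omega>.
          F (snd p, []) (fst p) * cnj (basis a p)) / of_real (real (ind \<alpha>))))"
        unfolding ruelle_basis[OF p] by (intro sum.cong refl) (simp add: coruelle_basis split: sum.split)
      also have "\<dots> = F (snd (\<zeta>, j), []) (fst (\<zeta>, j))"
        using ind_pos basis p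
        by (intro orthogonal_basis_expansion(1)[where f = "\<lambda>p. F (snd p, []) (fst p)"])
           (auto simp: orthogonal_basis_at_def finite_fibre_pairs basis_indices_def \<omega>_def)
      finally show "ruelle \<alpha> m H (coruelle \<alpha> m H F) (j, []) \<zeta>
        + ruelle \<alpha> m' G (coruelle \<alpha> m G F) (j, []) \<zeta> = F (j, []) \<zeta>" by simp
    qed
  qed
  then show ?thesis
    using AE_level_iff[OF m_measurable, of "\<lambda>p \<zeta>. ruelle \<alpha> m H (coruelle \<alpha> m H F) p \<zeta>
      + ruelle \<alpha> m' G (coruelle \<alpha> m G F) p \<zeta> = F p \<zeta>"] p by blast
qed

text \<open>Coefficients with respect to an orthogonal basis are unique.\<close>

lemma coruelle_coefficients:
  assumes F: "\<And>p. p \<in> fst (level_fam \<mu> m) \<Longrightarrow> AE \<zeta> in snd (level_fam \<mu> m) p.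
      F p \<zeta> = ruelle \<alpha> m H v p \<zeta> + ruelle \<alpha> m' G w p \<zeta>"
  shows "p \<in> fst (level_fam \<mu> m) \<Longrightarrow> AE \<omega> in snd (level_fam \<mu> m) p. coruelle \<alpha> m H F p \<omega> = v p \<omega>"
    and "p \<in> fst (level_fam \<mu> m') \<Longrightarrow> AE \<omega> in snd (level_fam \<mu> m') p. coruelle \<alpha> m G F p \<omega> = w p \<omega>"
proof -
  have "AE \<zeta> in \<mu>. \<forall>j\<in>{1..m \<zeta>}. F (j, []) \<zeta> =
      ruelle \<alpha> m H v (j, []) \<zeta> + ruelle \<alpha> m' G w (j, []) \<zeta>"
    using AE_level_iff[OF m_measurable, of "\<lambda>p \<zeta>. F p \<zeta> =
      ruelle \<alpha> m H v p \<zeta> + ruelle \<alpha> m' G w p \<zeta>"] F by blast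
  from AE_fibre[OF this] AE_orthogonal_basis
  have coeff: "AE \<omega> in \<mu>. (\<forall>i\<in>{1..m \<omega>}. coruelle \<alpha> m H F (i, []) \<omega> = v (i, []) \<omega>) \<and>
      (\<forall>k\<in>{1..m' \<omega>}. coruelle \<alpha> m G F (k, []) \<omega> = w (k, []) \<omega>)"
  proof eventually_elim
    fix \<omega> assume F: "\<forall>\<zeta>\<in>fibre \<alpha> \<omega>. \<forall>j\<in>{1..m \<zeta>}. F (j, []) \<zeta> =
        ruelle \<alpha> m H v (j, []) \<zeta> + ruelle \<alpha> m' G w (j, []) \<zeta>"
      and basis: "orthogonal_basis_at \<omega>"
    define x where "x = (\<lambda>a. case a of Inl i \<Rightarrow> v (i, []) \<omega> | Inr k \<Rightarrow> w (k, []) \<omega>)"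
    have "(\<Sum>p\<in>fibre_pairs \<alpha> m \<omega>. F (snd p, []) (fst p) * cnj (basis a p)) = of_real (real (ind \<alpha>)) * x a"
      if a: "a \<in> basis_indices \<omega>" for a
    proof -
      have "(\<Sum>p\<in>fibre_pairs \<alpha> m \<omega>. F (snd p, []) (fst p) * cnj (basis a p)) =
          (\<Sum>p\<in>fibre_pairs \<alpha> m \<omega>. \<Sum>b\<in>basis_indices \<omega>. x b * (basis b p * cnj (basis a p)))"
      proof (rule sum.cong[OF refl])
        fix p assume p: "p \<in> fibre_pairs \<alpha> m \<omega>"
        then have "F (snd p, []) (fst p) = (\<Sum>b\<in>basis_indices \<omega>. basis b p * x b)"
          using F ruelle_basis[of "fst p" "snd p" \<omega> v w] by (auto simp: fibre_pairs_def x_def)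
        then show "F (snd p, []) (fst p) * cnj (basis a p) =
            (\<Sum>b\<in>basis_indices \<omega>. x b * (basis b p * cnj (basis a p)))"
          by (simp add: sum_distrib_left sum_distrib_right mult_ac)
      qed
      also have "\<dots> = (\<Sum>b\<in>basis_indices \<omega>. x b * (\<Sum>p\<in>fibre_pairs \<alpha> m \<omega>. basis b p * cnj (basis a p)))"
        by (subst sum.swap) (simp add: sum_distrib_left)
      also have "\<dots> = (\<Sum>b\<in>basis_indices \<omega>. if b = a then of_real (real (ind \<alpha>)) * x b else 0)"
        using basis a by (intro sum.cong refl) (auto simp: orthogonal_basis_at_def)
      also have "\<dots> = of_real (real (ind \<alpha>)) * x a"
        using a by (simp add: basis_indices_def)
      finally show ?thesis .
    qed
    then have coeff: "(\<Sum>p\<in>fibre_pairs \<alpha> m \<omega>. F (snd p, []) (fst p) * cnj (basis a p)) / of_real (real (ind \<alpha>)) = x a"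
      if "a \<in> basis_indices \<omega>" for a using ind_pos that by simp
    then have "coruelle \<alpha> m H F (i, []) \<omega> = x (Inl i)" if "i \<in> {1..m \<omega>}" for i
      using that by (simp add: coruelle_basis basis_indices_def InlI)
    moreover have "coruelle \<alpha> m G F (k, []) \<omega> = x (Inr k)" if "k \<in> {1..m' \<omega>}" for k
      using coeff that by (simp add: coruelle_basis basis_indices_def InrI)
    ultimately show "(\<forall>i\<in>{1..m \<omega>}. coruelle \<alpha> m H F (i, []) \<omega> = v (i, []) \<omega>) \<and>
      (\<forall>k\<in>{1..m' \<omega>}. coruelle \<alpha> m G F (k, []) \<omega> = w (k, []) \<omega>)"
      by (simp add: x_def)
  qed
  show "p \<in> fst (level_fam \<mu> m) \<Longrightarrow> AE \<omega> in snd (level_fam \<mu> m) p. coruelle \<alpha> m H F p \<omega> = v p \<omega>"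
    using AE_level_iff[OF m_measurable, of "\<lambda>p \<omega>. coruelle \<alpha> m H F p \<omega> = v p \<omega>"] coeff by auto
  show "p \<in> fst (level_fam \<mu> m') \<Longrightarrow> AE \<omega> in snd (level_fam \<mu> m') p. coruelle \<alpha> m G F p \<omega> = w p \<omega>"
    using AE_level_iff[OF comp_mult_measurable, of "\<lambda>p \<omega>. coruelle \<alpha> m G F p \<omega> = w p \<omega>"] coeff by auto
qed

end

section \<open>Dilation\<close>

context dual_dynamics
begin

text \<open>The measures that arise by repeated dilation: they live on Borel subsets of the dual group, and
  their measurable sets are the Borel sets. This is what a further dilation requires.\<close>

definition borel_dual_family :: "('g idx, 'g dual) l2fam \<Rightarrow> bool" where
  "borel_dual_family K \<longleftrightarrow> (\<forall>p\<in>fst K.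
     space (snd K p) \<in> sets \<mu> \<and> sets (snd K p) = sets (restrict_space \<mu> (space (snd K p))))"

lemma family_space: "borel_dual_family K \<Longrightarrow> p \<in> fst K \<Longrightarrow> x \<in> space (snd K p) \<Longrightarrow> x \<in> dual_group"
  using sets.sets_into_space[of "space (snd K p)" \<mu>] by (auto simp: borel_dual_family_def space_\<mu>)

lemma borel_dual_level: "multiplicity n \<Longrightarrow> borel_dual_family (level_fam \<mu> n)"
  using level_sets[of n]
  by (auto simp: borel_dual_family_def fst_level_fam snd_level_fam space_restrict_space
      intro!: arg_cong[where f = "\<lambda>A. sets (restrict_space \<mu> A)"] dest: sets.sets_into_space)

lemma family_measurable:
  assumes "borel_dual_family K" "p \<in> fst K" "f \<in> \<mu> \<rightarrow>\<^sub>M N"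
  shows "f \<in> snd K p \<rightarrow>\<^sub>M N"
proof -
  have "sets (snd K p) = sets (restrict_space \<mu> (space (snd K p)))"
    using assms by (auto simp: borel_dual_family_def)
  from measurable_cong_sets[OF this refl] show ?thesis
    using measurable_restrict_space1[OF assms(3)] by blast
qed

definition character_mult :: "'g \<Rightarrow> ('g idx \<Rightarrow> 'g dual \<Rightarrow> complex) \<Rightarrow> 'g idx \<Rightarrow> 'g dual \<Rightarrow> complex" where
  "character_mult \<gamma> f = (\<lambda>i \<omega>. \<omega> \<gamma> * f i \<omega>)"

lemma l2_operator_character_mult:
  assumes K: "borel_dual_family K"
  shows "l2_operator K K 1 (character_mult \<gamma>)"
  unfolding l2_operator_def
proof (intro conjI ballI allI)
  fix f assume f: "f \<in> l2_fun K"
  have "l2_sqnorm K (character_mult \<gamma> f) = l2_sqnorm K f"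
    unfolding l2_sqnorm_def character_mult_def
    by (intro nn_integral_cong) (auto dest!: family_space[OF K] simp: dual_group_def norm_mult)
  then show norm: "l2_sqnorm K (character_mult \<gamma> f) = ennreal 1 * l2_sqnorm K f" by simp
  have "character_mult \<gamma> f p \<in> borel_measurable (snd K p)" if p: "p \<in> fst K" for p
    unfolding character_mult_def
    by (intro borel_measurable_times family_measurable[OF K p] eval_measurable_\<mu> l2_fun_measurable[OF f p])
  then show "character_mult \<gamma> f \<in> l2_fun K"
    unfolding l2_fun_iff norm using f by (auto simp: l2_fun_iff)
qed (auto simp: character_mult_def algebra_simps)

lemma tau_measurable: "tau \<alpha> c \<in> \<mu> \<rightarrow>\<^sub>M \<mu>"
  unfolding measurable_into_dual_iff
proof (intro conjI allI)
  show "tau \<alpha> c \<in> space \<mu> \<rightarrow> dual_group"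
    by (auto simp: tau_def space_\<mu> intro!: dmult_in_dual dinv_in_dual cross_in_dual endo_in_dual)
  have "(\<lambda>\<omega>. c (dual_endo \<alpha> \<omega>) \<gamma>) \<in> borel_measurable \<mu>" for \<gamma>
    using measurable_compose[OF measurable_compose[OF endo_measurable cross_measurable] eval_measurable_\<mu>] .
  then show "(\<lambda>\<omega>. tau \<alpha> c \<omega> \<gamma>) \<in> borel_measurable \<mu>" for \<gamma>
    unfolding tau_def dmult_def dinv_def by measurable
qed

lemma tau_in_dker: "\<omega> \<in> dual_group \<Longrightarrow> tau \<alpha> c \<omega> \<in> dker \<alpha>"
  using endo_in_dual[of \<omega>] dual_group_nonzero[of "dual_endo \<alpha> \<omega>"]
  by (auto simp: tau_def dker_def fibre_def dual_endo_dmult dual_endo_dinv endo_cross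
      dmult_in_dual dinv_in_dual cross_in_dual) (auto simp: dmult_def dinv_def)

text \<open>The inverse of \<open>\<alpha>\<^sup>*\<close> on the piece where \<open>\<tau>\<close> has the value \<open>\<zeta>\<close>.\<close>

definition branch :: "'g dual \<Rightarrow> 'g dual \<Rightarrow> 'g dual" where
  "branch \<zeta> \<omega> = dmult (dinv \<zeta>) (c \<omega>)"

lemma branch_measurable: "\<zeta> \<in> dker \<alpha> \<Longrightarrow> branch \<zeta> \<in> \<mu> \<rightarrow>\<^sub>M \<mu>"
  unfolding branch_def
  by (intro measurable_compose[OF cross_measurable dmult_measurable] dinv_in_dual dker_dual)

lemma endo_branch: "\<zeta> \<in> dker \<alpha> \<Longrightarrow> \<omega> \<in> dual_group \<Longrightarrow> dual_endo \<alpha> (branch \<zeta> \<omega>) = \<omega>"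
  by (simp add: branch_def dual_endo_dmult dual_endo_dinv endo_dker endo_cross) (simp add: dmult_def dinv_def)

lemma tau_branch:
  assumes "\<zeta> \<in> dker \<alpha>" "\<omega> \<in> dual_group"
  shows "tau \<alpha> c (branch \<zeta> \<omega>) = \<zeta>"
  unfolding tau_def endo_branch[OF assms] unfolding branch_def dmult_def dinv_def
  using dual_group_nonzero[OF cross_in_dual[OF assms(2)]] dual_group_nonzero[OF dker_dual[OF assms(1)]]
  by (simp add: fun_eq_iff)

lemma branch_endo:
  assumes "\<omega> \<in> dual_group"
  shows "branch (tau \<alpha> c \<omega>) (dual_endo \<alpha> \<omega>) = \<omega>"
  unfolding branch_def tau_def dmult_def dinv_def
  using dual_group_nonzero[OF cross_in_dual[OF endo_in_dual[OF assms]]] dual_group_nonzero[OF assms]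
  by (simp add: fun_eq_iff)

lemma endo_image_piece:
  assumes "\<zeta> \<in> dker \<alpha>" "E \<subseteq> {\<omega> \<in> dual_group. tau \<alpha> c \<omega> = \<zeta>}"
  shows "dual_endo \<alpha> ` E = branch \<zeta> -` E \<inter> dual_group"
proof (intro equalityI subsetI)
  fix \<omega> assume "\<omega> \<in> dual_endo \<alpha> ` E"
  then obtain \<omega>' where "\<omega>' \<in> E" "\<omega> = dual_endo \<alpha> \<omega>'" by blast
  then show "\<omega> \<in> branch \<zeta> -` E \<inter> dual_group"
    using assms(2) branch_endo[of \<omega>'] endo_in_dual[of \<omega>'] by auto
next
  fix \<omega> assume "\<omega> \<in> branch \<zeta> -` E \<inter> dual_group"
  then show "\<omega> \<in> dual_endo \<alpha> ` E"
    using endo_branch[OF assms(1), of \<omega>] by (intro image_eqI[of _ _ "branch \<zeta> \<omega>"]) auto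
qed

context
  fixes K :: "('g idx, 'g dual) l2fam"
  assumes K: "borel_dual_family K"
begin

definition piece :: "'g idx \<Rightarrow> 'g dual \<Rightarrow> 'g dual set" where
  "piece p \<zeta> = {\<omega> \<in> space (snd K p). tau \<alpha> c \<omega> = \<zeta>}"

lemma fst_dil_fam: "fst (dil_fam \<alpha> c K) = (\<lambda>((i, zs), \<zeta>). (i, \<zeta> # zs)) ` (fst K \<times> dker \<alpha>)"
  by (cases K) (force simp: dil_fam_def)

lemma snd_dil_fam: "snd (dil_fam \<alpha> c K) (i, \<zeta> # zs) = dil_measure \<alpha> c (snd K (i, zs)) \<zeta>"
  by (cases K) (simp add: dil_fam_def)

lemma piece_sets:
  assumes "p \<in> fst K" "\<zeta> \<in> dual_group"
  shows "piece p \<zeta> \<in> sets \<mu>" "piece p \<zeta> \<in> sets (snd K p)"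
proof -
  have sp: "space (snd K p) \<in> sets \<mu>" "space (snd K p) \<subseteq> space \<mu>"
    and st: "sets (snd K p) = sets (restrict_space \<mu> (space (snd K p)))"
    using K assms sets.sets_into_space[of "space (snd K p)" \<mu>] by (auto simp: borel_dual_family_def)
  have "{\<zeta>} \<in> sets \<mu>"
    unfolding sets_\<mu> sets_restrict_space using assms(2)
    by (intro image_eqI[of _ _ "{\<zeta>}"]) auto
  from measurable_sets[OF tau_measurable this]
  have "space (snd K p) \<inter> (tau \<alpha> c -` {\<zeta>} \<inter> space \<mu>) \<in> sets \<mu>" by (rule sets.Int[OF sp(1)])
  moreover have "space (snd K p) \<inter> (tau \<alpha> c -` {\<zeta>} \<inter> space \<mu>) = piece p \<zeta>"
    using sp by (auto simp: piece_def)
  ultimately show *: "piece p \<zeta> \<in> sets \<mu>" by simp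
  show "piece p \<zeta> \<in> sets (snd K p)"
    unfolding st sets_restrict_space using *
    by (intro image_eqI[of _ _ "piece p \<zeta>"]) (auto simp: piece_def)
qed

lemma piece_subset: "p \<in> fst K \<Longrightarrow> piece p \<zeta> \<subseteq> {\<omega> \<in> dual_group. tau \<alpha> c \<omega> = \<zeta>}"
  by (auto simp: piece_def dest: family_space[OF K])

lemma dil_measure_eq:
  "dil_measure \<alpha> c (snd K p) \<zeta> = scale_measure (of_nat (ind \<alpha>))
     (distr (restrict_space (snd K p) (piece p \<zeta>)) (restrict_space borel (dual_endo \<alpha> ` piece p \<zeta>)) (dual_endo \<alpha>))"
  by (simp add: dil_measure_def piece_def Let_def)

lemma space_dil_measure: "space (dil_measure \<alpha> c (snd K p) \<zeta>) = dual_endo \<alpha> ` piece p \<zeta>"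
  unfolding dil_measure_eq space_scale_measure space_distr by (simp add: space_restrict_space)

lemma image_piece_sets:
  assumes "p \<in> fst K" "\<zeta> \<in> dker \<alpha>"
  shows "dual_endo \<alpha> ` piece p \<zeta> \<in> sets \<mu>"
  unfolding endo_image_piece[OF assms(2) piece_subset[OF assms(1)]]
  using measurable_sets[OF branch_measurable[OF assms(2)] piece_sets(1)[OF assms(1) dker_dual[OF assms(2)]]]
  by (simp add: space_\<mu>)

lemma sets_dil_measure:
  assumes "p \<in> fst K" "\<zeta> \<in> dker \<alpha>"
  shows "sets (dil_measure \<alpha> c (snd K p) \<zeta>) = sets (restrict_space \<mu> (dual_endo \<alpha> ` piece p \<zeta>))"
proof -
  have sub: "dual_endo \<alpha> ` piece p \<zeta> \<subseteq> dual_group"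
    using piece_subset[OF assms(1)] endo_in_dual by blast
  have "sets (restrict_space \<mu> (dual_endo \<alpha> ` piece p \<zeta>)) =
      sets (restrict_space (restrict_space borel dual_group) (dual_endo \<alpha> ` piece p \<zeta>))"
    by (intro sets_restrict_space_cong sets_\<mu>)
  also have "\<dots> = sets (restrict_space borel (dual_endo \<alpha> ` piece p \<zeta>))"
    using sub by (simp add: sets_restrict_restrict_space Int_absorb1)
  finally show ?thesis by (simp add: dil_measure_eq)
qed

lemma borel_dual_dil: "borel_dual_family (dil_fam \<alpha> c K)"
  unfolding borel_dual_family_def fst_dil_fam
  by (auto simp: snd_dil_fam space_dil_measure sets_dil_measure image_piece_sets)

lemma endo_measurable_dil:
  assumes p: "p \<in> fst K" and \<zeta>: "\<zeta> \<in> dker \<alpha>"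
  shows "dual_endo \<alpha> \<in> restrict_space (snd K p) (piece p \<zeta>) \<rightarrow>\<^sub>M dil_measure \<alpha> c (snd K p) \<zeta>"
proof -
  have "dual_endo \<alpha> \<in> snd K p \<rightarrow>\<^sub>M \<mu>" by (rule family_measurable[OF K p endo_measurable])
  then have "dual_endo \<alpha> \<in> restrict_space (snd K p) (piece p \<zeta>) \<rightarrow>\<^sub>M restrict_space \<mu> (dual_endo \<alpha> ` piece p \<zeta>)"
    by (intro measurable_restrict_space2 measurable_restrict_space1) (auto simp: space_restrict_space)
  then show ?thesis
    using measurable_cong_sets[OF refl sets_dil_measure[OF p \<zeta>]] by blast
qed

lemma nn_integral_dil_measure:
  assumes p: "p \<in> fst K" and \<zeta>: "\<zeta> \<in> dker \<alpha>"
    and F: "F \<in> borel_measurable (dil_measure \<alpha> c (snd K p) \<zeta>)"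
  shows "(\<integral>\<^sup>+\<omega>. F \<omega> \<partial>dil_measure \<alpha> c (snd K p) \<zeta>) =
    of_nat (ind \<alpha>) * (\<integral>\<^sup>+\<omega>. F (dual_endo \<alpha> \<omega>) * indicator (piece p \<zeta>) \<omega> \<partial>snd K p)"
proof -
  let ?R = "restrict_space borel (dual_endo \<alpha> ` piece p \<zeta>) :: 'g dual measure"
  have sR: "sets ?R = sets (dil_measure \<alpha> c (snd K p) \<zeta>)" by (simp add: dil_measure_eq)
  have FR: "F \<in> borel_measurable ?R" using F measurable_cong_sets[OF sR refl] by blast
  have P: "piece p \<zeta> \<in> sets (snd K p)" by (rule piece_sets(2)[OF p dker_dual[OF \<zeta>]])
  have endo: "dual_endo \<alpha> \<in> restrict_space (snd K p) (piece p \<zeta>) \<rightarrow>\<^sub>M ?R"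
    using endo_measurable_dil[OF p \<zeta>] measurable_cong_sets[OF refl sR] by blast
  have "(\<integral>\<^sup>+\<omega>. F \<omega> \<partial>dil_measure \<alpha> c (snd K p) \<zeta>) =
      of_nat (ind \<alpha>) * (\<integral>\<^sup>+\<omega>. F (dual_endo \<alpha> \<omega>) \<partial>restrict_space (snd K p) (piece p \<zeta>))"
    unfolding dil_measure_eq using FR endo
    by (subst nn_integral_scale_measure) (auto simp: nn_integral_distr)
  also have "(\<integral>\<^sup>+\<omega>. F (dual_endo \<alpha> \<omega>) \<partial>restrict_space (snd K p) (piece p \<zeta>)) =
      (\<integral>\<^sup>+\<omega>. F (dual_endo \<alpha> \<omega>) * indicator (piece p \<zeta>) \<omega> \<partial>snd K p)"
    using P by (intro nn_integral_restrict_space) simp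
  finally show ?thesis .
qed

lemma dil_fun_branch: "dil_fun \<alpha> c f (i, \<zeta> # zs) \<omega> = f (i, zs) (branch \<zeta> \<omega>) / of_real (sqrt (real (ind \<alpha>)))"
  by (simp add: dil_fun_def branch_def)

lemma branch_measurable_dil:
  assumes p: "p \<in> fst K" and \<zeta>: "\<zeta> \<in> dker \<alpha>"
  shows "branch \<zeta> \<in> dil_measure \<alpha> c (snd K p) \<zeta> \<rightarrow>\<^sub>M snd K p"
proof -
  have st: "sets (snd K p) = sets (restrict_space \<mu> (space (snd K p)))"
    using K p by (simp add: borel_dual_family_def)
  have "branch \<zeta> \<in> restrict_space \<mu> (dual_endo \<alpha> ` piece p \<zeta>) \<rightarrow>\<^sub>M restrict_space \<mu> (space (snd K p))"
  proof (rule measurable_restrict_space2)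
    show "branch \<zeta> \<in> space (restrict_space \<mu> (dual_endo \<alpha> ` piece p \<zeta>)) \<rightarrow> space (snd K p)"
      unfolding endo_image_piece[OF \<zeta> piece_subset[OF p]] by (auto simp: space_restrict_space piece_def)
  qed (rule measurable_restrict_space1[OF branch_measurable[OF \<zeta>]])
  then show ?thesis
    using measurable_cong_sets[OF sets_dil_measure[OF p \<zeta>] st] by blast
qed

lemma dil_fun_measurable:
  assumes f: "\<And>p. p \<in> fst K \<Longrightarrow> f p \<in> borel_measurable (snd K p)" and q: "q \<in> fst (dil_fam \<alpha> c K)"
  shows "dil_fun \<alpha> c f q \<in> borel_measurable (snd (dil_fam \<alpha> c K) q)"
proof -
  obtain i zs \<zeta> where q: "q = (i, \<zeta> # zs)" "(i, zs) \<in> fst K" "\<zeta> \<in> dker \<alpha>"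
    using q by (auto simp: fst_dil_fam)
  have "(\<lambda>\<omega>. f (i, zs) (branch \<zeta> \<omega>)) \<in> borel_measurable (dil_measure \<alpha> c (snd K (i, zs)) \<zeta>)"
    by (rule measurable_compose[OF branch_measurable_dil[OF q(2,3)] f[OF q(2)]])
  then have "(\<lambda>\<omega>. f (i, zs) (branch \<zeta> \<omega>) / of_real (sqrt (real (ind \<alpha>))))
      \<in> borel_measurable (dil_measure \<alpha> c (snd K (i, zs)) \<zeta>)"
    by (intro borel_measurable_divide) auto
  moreover have "dil_fun \<alpha> c f (i, \<zeta> # zs) = (\<lambda>\<omega>. f (i, zs) (branch \<zeta> \<omega>) / of_real (sqrt (real (ind \<alpha>))))"
    by (rule ext) (rule dil_fun_branch)
  ultimately show ?thesis by (simp add: q(1) snd_dil_fam)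
qed

text \<open>On each piece the factor \<open>N\<close> in the dilated measure cancels the factor \<open>1/N\<close> of the squared
  function, and the pieces partition the domain.\<close>

lemma l2_sqnorm_dil:
  assumes ind: "ind \<alpha> > 0" and f: "\<And>p. p \<in> fst K \<Longrightarrow> f p \<in> borel_measurable (snd K p)"
  shows "l2_sqnorm (dil_fam \<alpha> c K) (dil_fun \<alpha> c f) = l2_sqnorm K f"
proof -
  have piece_norm: "(\<integral>\<^sup>+\<omega>. ennreal ((cmod (dil_fun \<alpha> c f (i, \<zeta> # zs) \<omega>))\<^sup>2) \<partial>dil_measure \<alpha> c (snd K (i, zs)) \<zeta>) =
      (\<integral>\<^sup>+\<omega>. ennreal ((cmod (f (i, zs) \<omega>))\<^sup>2) * indicator (piece (i, zs) \<zeta>) \<omega> \<partial>snd K (i, zs))"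
    if p: "(i, zs) \<in> fst K" and \<zeta>: "\<zeta> \<in> dker \<alpha>" for i zs \<zeta>
  proof -
    have q: "(i, \<zeta> # zs) \<in> fst (dil_fam \<alpha> c K)" using that by (force simp: fst_dil_fam)
    have "(\<lambda>\<omega>. ennreal ((cmod (dil_fun \<alpha> c f (i, \<zeta> # zs) \<omega>))\<^sup>2)) \<in> borel_measurable (dil_measure \<alpha> c (snd K (i, zs)) \<zeta>)"
      using dil_fun_measurable[OF f q] unfolding snd_dil_fam by measurable
    from nn_integral_dil_measure[OF p \<zeta> this]
    have "(\<integral>\<^sup>+\<omega>. ennreal ((cmod (dil_fun \<alpha> c f (i, \<zeta> # zs) \<omega>))\<^sup>2) \<partial>dil_measure \<alpha> c (snd K (i, zs)) \<zeta>) =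
      of_nat (ind \<alpha>) * (\<integral>\<^sup>+\<omega>. ennreal ((cmod (dil_fun \<alpha> c f (i, \<zeta> # zs) (dual_endo \<alpha> \<omega>)))\<^sup>2)
        * indicator (piece (i, zs) \<zeta>) \<omega> \<partial>snd K (i, zs))" .
    also have "\<dots> = of_nat (ind \<alpha>) * (\<integral>\<^sup>+\<omega>. ennreal (1 / real (ind \<alpha>)) * (ennreal ((cmod (f (i, zs) \<omega>))\<^sup>2)
        * indicator (piece (i, zs) \<zeta>) \<omega>) \<partial>snd K (i, zs))"
    proof (rule arg_cong2[where f = "(*)", OF refl], rule nn_integral_cong)
      fix \<omega> assume \<omega>: "\<omega> \<in> space (snd K (i, zs))"
      have "branch \<zeta> (dual_endo \<alpha> \<omega>) = \<omega>" if "tau \<alpha> c \<omega> = \<zeta>"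
        using branch_endo[OF family_space[OF K p \<omega>]] that by simp
      then show "ennreal ((cmod (dil_fun \<alpha> c f (i, \<zeta> # zs) (dual_endo \<alpha> \<omega>)))\<^sup>2) * indicator (piece (i, zs) \<zeta>) \<omega> =
          ennreal (1 / real (ind \<alpha>)) * (ennreal ((cmod (f (i, zs) \<omega>))\<^sup>2) * indicator (piece (i, zs) \<zeta>) \<omega>)"
        using ind by (auto simp: indicator_def piece_def dil_fun_branch norm_divide power_divide
            ennreal_mult[symmetric])
    qed
    also have "\<dots> = of_nat (ind \<alpha>) * (ennreal (1 / real (ind \<alpha>)) * (\<integral>\<^sup>+\<omega>. ennreal ((cmod (f (i, zs) \<omega>))\<^sup>2)
        * indicator (piece (i, zs) \<zeta>) \<omega> \<partial>snd K (i, zs)))"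
    proof -
      have "(\<lambda>\<omega>. ennreal ((cmod (f (i, zs) \<omega>))\<^sup>2) * indicator (piece (i, zs) \<zeta>) \<omega>) \<in> borel_measurable (snd K (i, zs))"
        using f[OF p] piece_sets(2)[OF p dker_dual[OF \<zeta>]] by measurable
      then show ?thesis by (simp only: nn_integral_cmult)
    qed
    also have "\<dots> = (ennreal (real (ind \<alpha>)) * ennreal (1 / real (ind \<alpha>))) * (\<integral>\<^sup>+\<omega>. ennreal ((cmod (f (i, zs) \<omega>))\<^sup>2)
        * indicator (piece (i, zs) \<zeta>) \<omega> \<partial>snd K (i, zs))"
      by (simp only: mult.assoc ennreal_of_nat_eq_real_of_nat)
    also have "ennreal (real (ind \<alpha>)) * ennreal (1 / real (ind \<alpha>)) = 1"
      using ind by (simp add: ennreal_mult[symmetric])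
    finally show ?thesis by simp
  qed
  have "l2_sqnorm (dil_fam \<alpha> c K) (dil_fun \<alpha> c f) =
      (\<integral>\<^sup>+q. (\<integral>\<^sup>+\<omega>. ennreal ((cmod (dil_fun \<alpha> c f q \<omega>))\<^sup>2) \<partial>snd (dil_fam \<alpha> c K) q)
        \<partial>count_space ((\<lambda>((i, zs), \<zeta>). (i, \<zeta> # zs)) ` (fst K \<times> dker \<alpha>)))"
    by (simp add: l2_sqnorm_def fst_dil_fam)
  also have "\<dots> = (\<integral>\<^sup>+((i, zs), \<zeta>). (\<integral>\<^sup>+\<omega>. ennreal ((cmod (dil_fun \<alpha> c f (i, \<zeta> # zs) \<omega>))\<^sup>2)
        \<partial>dil_measure \<alpha> c (snd K (i, zs)) \<zeta>) \<partial>count_space (fst K \<times> dker \<alpha>))"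
    by (subst nn_integral_bij_count_space[symmetric, where A = "fst K \<times> dker \<alpha>" and g = "\<lambda>((i, zs), \<zeta>). (i, \<zeta> # zs)"])
       (auto simp: bij_betw_def inj_on_def snd_dil_fam case_prod_unfold)
  also have "\<dots> = (\<integral>\<^sup>+(p, \<zeta>). (\<integral>\<^sup>+\<omega>. ennreal ((cmod (f p \<omega>))\<^sup>2) * indicator (piece p \<zeta>) \<omega> \<partial>snd K p)
        \<partial>count_space (fst K \<times> dker \<alpha>))"
    by (intro nn_integral_cong) (auto simp: piece_norm)
  also have "\<dots> = (\<integral>\<^sup>+p. (\<integral>\<^sup>+\<zeta>. (\<integral>\<^sup>+\<omega>. ennreal ((cmod (f p \<omega>))\<^sup>2) * indicator (piece p \<zeta>) \<omega> \<partial>snd K p)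
        \<partial>count_space (dker \<alpha>)) \<partial>count_space (fst K))"
    (is "_ = (\<integral>\<^sup>+p. (\<integral>\<^sup>+\<zeta>. ?J p \<zeta> \<partial>_) \<partial>_)")
  proof -
    have "(\<integral>\<^sup>+(p, \<zeta>). ?J p \<zeta> \<partial>count_space (fst K \<times> dker \<alpha>)) =
        (\<integral>\<^sup>+x. (\<lambda>(p, \<zeta>). ?J p \<zeta> * indicator (dker \<alpha>) \<zeta> * indicator (fst K) p) x \<partial>count_space UNIV)"
      by (subst nn_integral_count_space_indicator) (auto intro!: nn_integral_cong simp: indicator_def)
    also have "\<dots> = (\<integral>\<^sup>+p. (\<integral>\<^sup>+\<zeta>. ?J p \<zeta> * indicator (dker \<alpha>) \<zeta> * indicator (fst K) p \<partial>count_space UNIV) \<partial>count_space UNIV)"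
      by (simp add: nn_integral_fst_count_space[symmetric])
    also have "\<dots> = (\<integral>\<^sup>+p. (\<integral>\<^sup>+\<zeta>. ?J p \<zeta> * indicator (dker \<alpha>) \<zeta> \<partial>count_space UNIV) * indicator (fst K) p \<partial>count_space UNIV)"
      by (simp add: nn_integral_multc)
    also have "\<dots> = (\<integral>\<^sup>+p. (\<integral>\<^sup>+\<zeta>. ?J p \<zeta> \<partial>count_space (dker \<alpha>)) \<partial>count_space (fst K))"
      by (simp add: nn_integral_count_space_indicator)
    finally show ?thesis .
  qed
  also have "\<dots> = l2_sqnorm K f"
    unfolding l2_sqnorm_def
  proof (intro nn_integral_cong)
    fix p assume "p \<in> space (count_space (fst K))"
    then have p: "p \<in> fst K" by simp
    have "(\<integral>\<^sup>+\<zeta>. (\<integral>\<^sup>+\<omega>. ennreal ((cmod (f p \<omega>))\<^sup>2) * indicator (piece p \<zeta>) \<omega> \<partial>snd K p) \<partial>count_space (dker \<alpha>)) =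
        (\<integral>\<^sup>+\<omega>. (\<integral>\<^sup>+\<zeta>. ennreal ((cmod (f p \<omega>))\<^sup>2) * indicator (piece p \<zeta>) \<omega> \<partial>count_space (dker \<alpha>)) \<partial>snd K p)"
    proof (rule nn_integral_count_space_nn_integral[symmetric])
      show "countable (dker \<alpha>)" using finite_dker by (rule countable_finite)
      fix \<zeta> assume "\<zeta> \<in> dker \<alpha>"
      from piece_sets(2)[OF p dker_dual[OF this]] f[OF p]
      show "(\<lambda>\<omega>. ennreal ((cmod (f p \<omega>))\<^sup>2) * indicator (piece p \<zeta>) \<omega>) \<in> borel_measurable (snd K p)"
        by measurable
    qed
    also have "\<dots> = (\<integral>\<^sup>+\<omega>. ennreal ((cmod (f p \<omega>))\<^sup>2) \<partial>snd K p)"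
    proof (intro nn_integral_cong)
      fix \<omega> assume \<omega>: "\<omega> \<in> space (snd K p)"
      have "tau \<alpha> c \<omega> \<in> dker \<alpha>" by (rule tau_in_dker[OF family_space[OF K p \<omega>]])
      then show "(\<integral>\<^sup>+\<zeta>. ennreal ((cmod (f p \<omega>))\<^sup>2) * indicator (piece p \<zeta>) \<omega> \<partial>count_space (dker \<alpha>)) =
          ennreal ((cmod (f p \<omega>))\<^sup>2)"
        using \<omega> by (subst nn_integral_count_space'[of "{tau \<alpha> c \<omega>}"]) (auto simp: piece_def)
    qed
    finally show "(\<integral>\<^sup>+\<zeta>. (\<integral>\<^sup>+\<omega>. ennreal ((cmod (f p \<omega>))\<^sup>2) * indicator (piece p \<zeta>) \<omega> \<partial>snd K p) \<partial>count_space (dker \<alpha>)) =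
        (\<integral>\<^sup>+\<omega>. ennreal ((cmod (f p \<omega>))\<^sup>2) \<partial>snd K p)" .
  qed
  finally show ?thesis .
qed

lemma l2_operator_dil:
  assumes ind: "ind \<alpha> > 0"
  shows "l2_operator K (dil_fam \<alpha> c K) 1 (dil_fun \<alpha> c)"
  unfolding l2_operator_def
proof (intro conjI ballI allI)
  fix f assume f: "f \<in> l2_fun K"
  show norm: "l2_sqnorm (dil_fam \<alpha> c K) (dil_fun \<alpha> c f) = ennreal 1 * l2_sqnorm K f"
    using l2_sqnorm_dil[OF ind l2_fun_measurable[OF f]] by simp
  show "dil_fun \<alpha> c f \<in> l2_fun (dil_fam \<alpha> c K)"
    unfolding l2_fun_iff norm using f dil_fun_measurable[OF l2_fun_measurable[OF f]]
    by (auto simp: l2_fun_iff)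
qed (auto simp: dil_fun_def add_divide_distrib split: prod.splits)

text \<open>A preimage is glued from the functions \<open>g (i, \<zeta> # zs)\<close>, pulled back along \<open>\<alpha>\<^sup>*\<close> to the pieces.\<close>

lemma dil_fun_surj:
  assumes ind: "ind \<alpha> > 0" and g: "g \<in> l2_fun (dil_fam \<alpha> c K)"
  shows "\<exists>f\<in>l2_fun K. \<forall>q\<in>fst (dil_fam \<alpha> c K). AE \<omega> in snd (dil_fam \<alpha> c K) q. dil_fun \<alpha> c f q \<omega> = g q \<omega>"
proof -
  define f where "f = (\<lambda>(i, zs) \<omega>. of_real (sqrt (real (ind \<alpha>))) * g (i, tau \<alpha> c \<omega> # zs) (dual_endo \<alpha> \<omega>))"
  have eq: "dil_fun \<alpha> c f q \<omega> = g q \<omega>"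
    if q: "q \<in> fst (dil_fam \<alpha> c K)" and \<omega>: "\<omega> \<in> space (snd (dil_fam \<alpha> c K) q)" for q \<omega>
  proof -
    obtain i zs \<zeta> where q': "q = (i, \<zeta> # zs)" "\<zeta> \<in> dker \<alpha>" using q by (auto simp: fst_dil_fam)
    have "\<omega> \<in> dual_group" by (rule family_space[OF borel_dual_dil q \<omega>])
    then show ?thesis
      using ind by (simp add: q' dil_fun_branch f_def tau_branch endo_branch)
  qed
  have f_meas: "f p \<in> borel_measurable (snd K p)" if p: "p \<in> fst K" for p
  proof (rule measurable_piecewise_restrict[where C = "piece p ` dker \<alpha>"])
    show "countable (piece p ` dker \<alpha>)" using finite_dker by (intro countable_finite finite_imageI)
    show "space (snd K p) \<subseteq> \<Union> (piece p ` dker \<alpha>)"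
      using tau_in_dker[OF family_space[OF K p]] by (auto simp: piece_def)
    fix \<Omega> assume "\<Omega> \<in> piece p ` dker \<alpha>"
    then obtain \<zeta> where \<zeta>: "\<zeta> \<in> dker \<alpha>" "\<Omega> = piece p \<zeta>" by blast
    show "\<Omega> \<inter> space (snd K p) \<in> sets (snd K p)"
      using piece_sets(2)[OF p dker_dual[OF \<zeta>(1)]] \<zeta>(2) by simp
    obtain i zs where i: "p = (i, zs)" by force
    have "(i, \<zeta> # zs) \<in> fst (dil_fam \<alpha> c K)" using p \<zeta> i by (force simp: fst_dil_fam)
    from l2_fun_measurable[OF g this]
    have "g (i, \<zeta> # zs) \<in> borel_measurable (dil_measure \<alpha> c (snd K p) \<zeta>)" by (simp add: snd_dil_fam i)
    from measurable_compose[OF endo_measurable_dil[OF p \<zeta>(1)] this]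
    have "(\<lambda>\<omega>. of_real (sqrt (real (ind \<alpha>))) * g (i, \<zeta> # zs) (dual_endo \<alpha> \<omega>))
        \<in> borel_measurable (restrict_space (snd K p) \<Omega>)"
      unfolding \<zeta>(2) by (intro borel_measurable_times) auto
    then show "f p \<in> borel_measurable (restrict_space (snd K p) \<Omega>)"
      by (rule measurable_cong[THEN iffD1, rotated])
         (simp add: f_def i \<zeta>(2) space_restrict_space piece_def)
  qed
  have "l2_sqnorm K f = l2_sqnorm (dil_fam \<alpha> c K) (dil_fun \<alpha> c f)"
    by (rule l2_sqnorm_dil[OF ind f_meas, symmetric])
  also have "\<dots> = l2_sqnorm (dil_fam \<alpha> c K) g"
    by (rule l2_sqnorm_cong_AE) (auto intro: AE_I2 eq)
  finally have "f \<in> l2_fun K" using f_meas g by (simp add: l2_fun_iff)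
  then show ?thesis using eq by (auto intro!: bexI[of _ f] AE_I2)
qed

end

end

context dual_dynamics
begin

definition rep :: "('g idx, 'g dual) l2fam \<Rightarrow> 'g \<Rightarrow> 'g l2elt \<Rightarrow> 'g l2elt" where
  "rep K \<gamma> = l2_lift K (character_mult \<gamma>)"

lemma rep_closed: "borel_dual_family K \<Longrightarrow> F \<in> carr (l2_space K) \<Longrightarrow> rep K \<gamma> F \<in> carr (l2_space K)"
  using l2_lift_similitude[OF l2_operator_character_mult] by (auto simp: rep_def similitude_def)

context
  fixes K :: "('g idx, 'g dual) l2fam"
  assumes K: "borel_dual_family K" and ind: "ind \<alpha> > 0"
begin

lemma dil_isometry: "similitude 1 (l2_space K) (l2_space (dil_fam \<alpha> c K)) (dil \<alpha> c K)"
  and dil_inj: "inj_on (dil \<alpha> c K) (carr (l2_space K))"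
  and dil_surj: "dil \<alpha> c K ` carr (l2_space K) = carr (l2_space (dil_fam \<alpha> c K))"
  unfolding dil_def
  using l2_lift_similitude[OF l2_operator_dil[OF K ind]] l2_lift_inj[OF l2_operator_dil[OF K ind]]
    l2_lift_surj[OF l2_operator_dil[OF K ind] _ dil_fun_surj[OF K ind]]
  by simp_all

text \<open>Elements of the kernel of \<open>\<alpha>\<^sup>*\<close> are trivial on the image of \<open>\<alpha>\<close>; so each inverse branch of \<open>\<alpha>\<^sup>*\<close> takes
  \<open>\<omega>\<close> to a character whose value at \<open>\<alpha> \<gamma>\<close> is \<open>\<omega> \<gamma>\<close>.\<close>

lemma dil_rep:
  assumes "F \<in> carr (l2_space K)"
  shows "dil \<alpha> c K (rep K (\<alpha> \<gamma>) F) = rep (dil_fam \<alpha> c K) \<gamma> (dil \<alpha> c K F)"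
  unfolding dil_def rep_def
proof (rule l2_lift_commute[OF l2_operator_dil[OF K ind] _ l2_operator_character_mult[OF K]
      l2_operator_character_mult[OF borel_dual_dil[OF K]] _ assms])
  fix f q \<omega> assume q: "q \<in> fst (dil_fam \<alpha> c K)" and \<omega>: "\<omega> \<in> space (snd (dil_fam \<alpha> c K) q)"
  obtain i zs \<zeta> where q': "q = (i, \<zeta> # zs)" "\<zeta> \<in> dker \<alpha>" using q by (auto simp: fst_dil_fam[OF K])
  have "branch \<zeta> \<omega> (\<alpha> \<gamma>) = \<omega> \<gamma>"
    using fun_cong[OF endo_branch[OF q'(2) family_space[OF borel_dual_dil[OF K] q \<omega>]], of \<gamma>]
    by (simp add: dual_endo_def)
  then show "dil_fun \<alpha> c (character_mult (\<alpha> \<gamma>) f) q \<omega> = character_mult \<gamma> (dil_fun \<alpha> c f) q \<omega>"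
    by (simp add: q' dil_fun_branch[OF K] character_mult_def)
qed simp

end

end

section \<open>Equivalence of the canonical GMRAs\<close>

context ruelle_setting
begin

lemma ruelle_rep:
  assumes A: "relative_filter n A" and F: "F \<in> carr (l2_space (level_fam \<mu> n))"
  shows "l2_lift (level_fam \<mu> m) (ruelle \<alpha> n A) (rep (level_fam \<mu> n) \<gamma> F) =
    rep (level_fam \<mu> m) (\<alpha> \<gamma>) (l2_lift (level_fam \<mu> m) (ruelle \<alpha> n A) F)"
  unfolding rep_def
proof (rule l2_lift_commute[OF l2_operator_ruelle[OF A] scale_pos
      l2_operator_character_mult l2_operator_character_mult _ F])
  show "borel_dual_family (level_fam \<mu> n)" "borel_dual_family (level_fam \<mu> m)"
    using A m_measurable by (auto intro: borel_dual_level simp: relative_filter_def)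
  fix f p \<zeta> assume p: "p \<in> fst (level_fam \<mu> m)" and "\<zeta> \<in> space (snd (level_fam \<mu> m) p)"
  then have "\<zeta> \<in> dual_group" by (rule family_space[OF borel_dual_level[OF m_measurable]])
  note ruelle = ruelle_eq_sum[OF in_fibre_endo[OF this]]
  show "ruelle \<alpha> n A (character_mult \<gamma> f) p \<zeta> = character_mult (\<alpha> \<gamma>) (ruelle \<alpha> n A f) p \<zeta>"
    by (cases p) (simp add: ruelle character_mult_def sum_distrib_left dual_endo_def mult_ac)
qed

end

context complementary_pair
begin

abbreviation "V_space \<equiv> l2_space (level_fam \<mu> m)"
abbreviation "W_space \<equiv> l2_space (level_fam \<mu> m')"

lemma S_H_similitude: "similitude (real (ind \<alpha>) / real (card (dker \<alpha>))) V_space V_space (S_H \<alpha> \<mu> m H)"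
  unfolding S_H_def by (rule l2_lift_similitude[OF l2_operator_ruelle[OF H_relative] scale_pos])

lemma S_G_similitude: "similitude (real (ind \<alpha>) / real (card (dker \<alpha>))) W_space V_space (S_G \<alpha> \<mu> m G)"
  unfolding S_G_def by (rule l2_lift_similitude[OF l2_operator_ruelle[OF G_relative] scale_pos])

lemma S_G_inj: "inj_on (S_G \<alpha> \<mu> m G) (carr W_space)"
  unfolding S_G_def by (rule l2_lift_inj[OF l2_operator_ruelle[OF G_relative] scale_pos])

lemma S_sum_class:
  assumes v: "v \<in> l2_fun (level_fam \<mu> m)" and w: "w \<in> l2_fun (level_fam \<mu> m')"
  shows "hadd V_space (S_H \<alpha> \<mu> m H (l2_class (level_fam \<mu> m) v)) (S_G \<alpha> \<mu> m G (l2_class (level_fam \<mu> m') w)) =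
    l2_class (level_fam \<mu> m) (\<lambda>i x. ruelle \<alpha> m H v i x + ruelle \<alpha> m' G w i x)"
  and "(\<lambda>i x. ruelle \<alpha> m H v i x + ruelle \<alpha> m' G w i x) \<in> l2_fun (level_fam \<mu> m)"
proof -
  note RH = l2_operator_ruelle[OF H_relative] and RG = l2_operator_ruelle[OF G_relative]
  show "hadd V_space (S_H \<alpha> \<mu> m H (l2_class (level_fam \<mu> m) v)) (S_G \<alpha> \<mu> m G (l2_class (level_fam \<mu> m') w)) =
    l2_class (level_fam \<mu> m) (\<lambda>i x. ruelle \<alpha> m H v i x + ruelle \<alpha> m' G w i x)"
    unfolding S_H_def S_G_def l2_lift_class[OF RH scale_pos v] l2_lift_class[OF RG scale_pos w]
    by (intro hadd_l2_class l2_operator_closed[OF RH scale_pos v] l2_operator_closed[OF RG scale_pos w])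
  show "(\<lambda>i x. ruelle \<alpha> m H v i x + ruelle \<alpha> m' G w i x) \<in> l2_fun (level_fam \<mu> m)"
    by (intro l2_fun_add l2_operator_closed[OF RH scale_pos v] l2_operator_closed[OF RG scale_pos w])
qed

lemma S_sum_reconstruction:
  assumes F: "F \<in> l2_fun (level_fam \<mu> m)"
  shows "hadd V_space (S_H \<alpha> \<mu> m H (l2_class (level_fam \<mu> m) (coruelle \<alpha> m H F)))
    (S_G \<alpha> \<mu> m G (l2_class (level_fam \<mu> m') (coruelle \<alpha> m G F))) = l2_class (level_fam \<mu> m) F"
  unfolding S_sum_class(1)[OF coruelle_l2[OF F]]
  by (rule l2_class_cong) (rule ruelle_reconstruction)

text \<open>Surjectivity is the expansion of fibre vectors in the bases given by the rows of \<open>H\<close> and \<open>G\<close>,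
  injectivity the uniqueness of the coefficients.\<close>

lemma S_sum_bij:
  "bij_betw (\<lambda>(v, w). hadd V_space (S_H \<alpha> \<mu> m H v) (S_G \<alpha> \<mu> m G w)) (carr V_space \<times> carr W_space) (carr V_space)"
  unfolding bij_betw_def
proof (intro conjI)
  let ?V = "level_fam \<mu> m" and ?W = "level_fam \<mu> m'"
  show "(\<lambda>(v, w). hadd V_space (S_H \<alpha> \<mu> m H v) (S_G \<alpha> \<mu> m G w)) ` (carr V_space \<times> carr W_space) = carr V_space"
  proof
    show "(\<lambda>(v, w). hadd V_space (S_H \<alpha> \<mu> m H v) (S_G \<alpha> \<mu> m G w)) ` (carr V_space \<times> carr W_space) \<subseteq> carr V_space"
      using S_sum_class by (auto simp: carr_l2_space)
    show "carr V_space \<subseteq> (\<lambda>(v, w). hadd V_space (S_H \<alpha> \<mu> m H v) (S_G \<alpha> \<mu> m G w)) ` (carr V_space \<times> carr W_space)"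
    proof
      fix X assume "X \<in> carr V_space"
      then obtain F where F: "F \<in> l2_fun ?V" "X = l2_class ?V F" by (auto simp: carr_l2_space)
      show "X \<in> (\<lambda>(v, w). hadd V_space (S_H \<alpha> \<mu> m H v) (S_G \<alpha> \<mu> m G w)) ` (carr V_space \<times> carr W_space)"
        using S_sum_reconstruction[OF F(1)] F(2) coruelle_l2[OF F(1)]
        by (intro image_eqI[of _ _ "(l2_class ?V (coruelle \<alpha> m H F), l2_class ?W (coruelle \<alpha> m G F))"])
           (auto simp: carr_l2_space)
    qed
  qed
  show "inj_on (\<lambda>(v, w). hadd V_space (S_H \<alpha> \<mu> m H v) (S_G \<alpha> \<mu> m G w)) (carr V_space \<times> carr W_space)"
  proof (rule inj_onI, clarsimp simp: carr_l2_space)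
    fix v w v' w' assume mem: "v \<in> l2_fun ?V" "w \<in> l2_fun ?W" "v' \<in> l2_fun ?V" "w' \<in> l2_fun ?W"
      and eq: "hadd V_space (S_H \<alpha> \<mu> m H (l2_class ?V v)) (S_G \<alpha> \<mu> m G (l2_class ?W w)) =
        hadd V_space (S_H \<alpha> \<mu> m H (l2_class ?V v')) (S_G \<alpha> \<mu> m G (l2_class ?W w'))"
    define F where "F = (\<lambda>i x. ruelle \<alpha> m H v i x + ruelle \<alpha> m' G w i x)"
    have "l2_class ?V F = l2_class ?V (\<lambda>i x. ruelle \<alpha> m H v' i x + ruelle \<alpha> m' G w' i x)"
      using eq S_sum_class(1)[OF mem(1,2)] S_sum_class(1)[OF mem(3,4)] by (simp add: F_def)
    then have F': "AE x in snd ?V p. F p x = ruelle \<alpha> m H v' p x + ruelle \<alpha> m' G w' p x" if "p \<in> fst ?V" for p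
      using S_sum_class(2)[OF mem(1,2)] that by (simp add: l2_class_eq_iff F_def)
    have F: "AE x in snd ?V p. F p x = ruelle \<alpha> m H v p x + ruelle \<alpha> m' G w p x" if "p \<in> fst ?V" for p
      by (simp add: F_def)
    have "l2_class ?V v = l2_class ?V (coruelle \<alpha> m H F)" "l2_class ?V v' = l2_class ?V (coruelle \<alpha> m H F)"
      using coruelle_coefficients(1)[OF F] coruelle_coefficients(1)[OF F']
      by (auto intro!: l2_class_cong[symmetric])
    moreover have "l2_class ?W w = l2_class ?W (coruelle \<alpha> m G F)" "l2_class ?W w' = l2_class ?W (coruelle \<alpha> m G F)"
      using coruelle_coefficients(2)[OF F] coruelle_coefficients(2)[OF F']
      by (auto intro!: l2_class_cong[symmetric])
    ultimately show "l2_class ?V v = l2_class ?V v' \<and> l2_class ?W w = l2_class ?W w'" by simp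
  qed
qed

text \<open>An element of the range of the operator for \<open>G'\<close> has no coefficients along the rows of \<open>H\<close>, so only
  the \<open>G\<close>-part of its expansion in the basis given by \<open>H\<close> and \<open>G\<close> remains.\<close>

lemma S_G_range_contains:
  assumes "complementary_filter \<alpha> \<mu> m H G'"
  shows "S_G \<alpha> \<mu> m G' ` carr W_space \<subseteq> S_G \<alpha> \<mu> m G ` carr W_space"
proof
  interpret other: complementary_pair \<alpha> \<mu> c m H G'
    by unfold_locales (rule mult, rule H_filter, rule assms)
  let ?V = "level_fam \<mu> m" and ?W = "level_fam \<mu> m'"
  fix X assume "X \<in> S_G \<alpha> \<mu> m G' ` carr W_space"
  then obtain w where w: "w \<in> l2_fun ?W" "X = S_G \<alpha> \<mu> m G' (l2_class ?W w)" by (auto simp: carr_l2_space)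
  define F where "F = ruelle \<alpha> m' G' w"
  note RG' = l2_operator_ruelle[OF other.G_relative]
  have F: "F \<in> l2_fun ?V" and X: "X = l2_class ?V F"
    using l2_operator_closed[OF RG' scale_pos w(1)] l2_lift_class[OF RG' scale_pos w(1)]
    by (simp_all add: F_def w(2) S_G_def)
  have "AE x in snd ?V p. F p x = ruelle \<alpha> m H (\<lambda>i x. 0) p x + ruelle \<alpha> m' G' w p x" for p
    by (simp add: F_def ruelle_def case_prod_unfold)
  from other.coruelle_coefficients(1)[OF this]
  have "l2_class ?V (coruelle \<alpha> m H F) = hzero V_space"
    unfolding hzero_l2_space by (intro l2_class_cong) auto
  then have "X = S_G \<alpha> \<mu> m G (l2_class ?W (coruelle \<alpha> m G F))"
    using S_sum_reconstruction[OF F] S_G_similitude coruelle_l2(2)[OF F]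
    by (simp add: X similitude_zero[OF S_H_similitude] hadd_zero_left similitude_def carr_l2_space)
  then show "X \<in> S_G \<alpha> \<mu> m G ` carr W_space"
    using coruelle_l2(2)[OF F] by (auto simp: carr_l2_space)
qed

end

lemma inv_into_intertwine:
  assumes "bij_betw T C C" "bij_betw T' C C" "U ` C \<subseteq> C" "\<And>x. x \<in> C \<Longrightarrow> U (T x) = T' (U x)" "x \<in> C"
  shows "U (inv_into C T x) = inv_into C T' (U x)"
proof -
  define y where "y = inv_into C T x"
  have y: "y \<in> C" "T y = x"
    using assms(1,5) by (auto simp: y_def bij_betw_def intro: inv_into_into f_inv_into_f)
  then have "inv_into C T' (U x) = inv_into C T' (T' (U y))" using assms(4) by auto
  also have "\<dots> = U y"
    using assms(2,3) y by (intro inv_into_f_f) (auto simp: bij_betw_def)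
  finally show ?thesis by (simp add: y_def)
qed

lemma image_funpow_intertwine:
  assumes "f ` C \<subseteq> C" "\<And>x. x \<in> C \<Longrightarrow> U (f x) = f' (U x)" "A \<subseteq> C" "U ` A = A"
  shows "U ` (f ^^ n) ` A = (f' ^^ n) ` A"
proof -
  have "(f ^^ n) x \<in> C \<and> U ((f ^^ n) x) = (f' ^^ n) (U x)" if "x \<in> C" for x
    using that by (induction n) (use assms(1,2) in auto)
  then have "U ` (f ^^ n) ` A = (f' ^^ n) ` U ` A"
    unfolding image_image using assms(3) by (intro image_cong refl) blast
  then show ?thesis by (simp add: assms(4))
qed

context complementary_pair
begin

abbreviation "W n \<equiv> W_fam \<alpha> \<mu> c m n"
abbreviation "D n \<equiv> dil \<alpha> c (W n)"
abbreviation "can_carr \<equiv> carr (can_space \<alpha> \<mu> c m)"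

lemma W_0: "W 0 = level_fam \<mu> m'" and W_Suc: "W (Suc n) = dil_fam \<alpha> c (W n)"
  by (simp_all add: W_fam_def)

lemma borel_dual_W: "borel_dual_family (W n)"
  by (induction n) (simp_all add: W_0 W_Suc borel_dual_level[OF comp_mult_measurable] borel_dual_dil)

lemma D_similitude: "similitude 1 (l2_space (W n)) (l2_space (W (Suc n))) (D n)"
  and D_inj: "inj_on (D n) (carr (l2_space (W n)))"
  and D_surj: "D n ` carr (l2_space (W n)) = carr (l2_space (W (Suc n)))"
  and D_rep: "F \<in> carr (l2_space (W n)) \<Longrightarrow> D n (rep (W n) (\<alpha> \<gamma>) F) = rep (W (Suc n)) \<gamma> (D n F)"
  unfolding W_Suc using dil_isometry[OF borel_dual_W ind_pos] dil_inj[OF borel_dual_W ind_pos]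
    dil_surj[OF borel_dual_W ind_pos] dil_rep[OF borel_dual_W ind_pos] by auto

lemma D_inv:
  assumes "F \<in> carr (l2_space (W (Suc n)))"
  shows "inv_into (carr (l2_space (W n))) (D n) F \<in> carr (l2_space (W n))"
    "D n (inv_into (carr (l2_space (W n))) (D n) F) = F"
  using assms D_surj[of n] by (metis inv_into_into, metis f_inv_into_f)

lemma can_carr_iff:
  "(v, w) \<in> can_carr \<longleftrightarrow> v \<in> carr V_space \<and> (\<forall>n. w n \<in> carr (l2_space (W n))) \<and>
     summable (\<lambda>n. Re (hip (l2_space (W n)) (w n) (w n)))"
  by (simp add: can_space_def hsum_def hsum_seq_def)

text \<open>\<open>T\<close> is the bijection \<open>(v, w\<^sub>0) \<mapsto> S\<^sub>H v + S\<^sub>G w\<^sub>0\<close> together with a shift of the remaining components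
  by the unitary operators \<open>\<D>\<^sup>-\<^sup>1\<close>.\<close>

lemma can_T_bij: "bij_betw (can_T \<alpha> \<mu> c m H G) can_carr can_carr"
  unfolding bij_betw_def
proof (intro conjI equalityI subsetI)
  have hip_D: "hip (l2_space (W (Suc n))) (D n F) (D n F) = hip (l2_space (W n)) F F"
    if "F \<in> carr (l2_space (W n))" for n F
    using D_similitude[of n] that by (simp add: similitude_def)
  show "inj_on (can_T \<alpha> \<mu> c m H G) can_carr"
  proof (rule inj_onI, clarify)
    fix v w v' w' assume mem: "(v, w) \<in> can_carr" "(v', w') \<in> can_carr"
      and eq: "can_T \<alpha> \<mu> c m H G (v, w) = can_T \<alpha> \<mu> c m H G (v', w')"
    have "(v, w 0) = (v', w' 0)"
      using eq mem by (intro inj_onD[OF bij_betw_imp_inj_on[OF S_sum_bij]])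
        (auto simp: can_T_def can_carr_iff W_0[symmetric])
    moreover have "w (Suc n) = w' (Suc n)" for n
    proof -
      have "inv_into (carr (l2_space (W n))) (D n) (w (Suc n)) =
          inv_into (carr (l2_space (W n))) (D n) (w' (Suc n))"
        using eq by (simp add: can_T_def fun_eq_iff)
      moreover have "w (Suc n) \<in> carr (l2_space (W (Suc n)))" "w' (Suc n) \<in> carr (l2_space (W (Suc n)))"
        using mem by (auto simp: can_carr_iff)
      ultimately show ?thesis using D_inv(2) by metis
    qed
    ultimately show "v = v' \<and> w = w'" by (metis Pair_inject ext not0_implies_Suc)
  qed
  show "X \<in> can_carr" if image: "X \<in> can_T \<alpha> \<mu> c m H G ` can_carr" for X
  proof -
    obtain Y where "Y \<in> can_carr" "X = can_T \<alpha> \<mu> c m H G Y" using image by blast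
    then obtain v w where mem: "(v, w) \<in> can_carr" and X: "X = can_T \<alpha> \<mu> c m H G (v, w)"
      by (cases Y) blast
    have w: "w n \<in> carr (l2_space (W n))" for n using mem by (simp add: can_carr_iff)
    have "hip (l2_space (W n)) (inv_into (carr (l2_space (W n))) (D n) (w (Suc n)))
        (inv_into (carr (l2_space (W n))) (D n) (w (Suc n))) = hip (l2_space (W (Suc n))) (w (Suc n)) (w (Suc n))" for n
      using hip_D[OF D_inv(1)[OF w]] D_inv(2)[OF w] by simp
    moreover have "summable (\<lambda>n. Re (hip (l2_space (W (Suc n))) (w (Suc n)) (w (Suc n))))"
      using mem by (subst summable_Suc_iff) (simp add: can_carr_iff)
    moreover have "hadd V_space (S_H \<alpha> \<mu> m H v) (S_G \<alpha> \<mu> m G (w 0)) \<in> carr V_space"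
      using bij_betw_imp_surj_on[OF S_sum_bij] mem by (force simp: can_carr_iff W_0[symmetric])
    ultimately show ?thesis
      unfolding X can_T_def prod.case can_carr_iff using D_inv(1)[OF w] by simp
  qed
  show "X \<in> can_T \<alpha> \<mu> c m H G ` can_carr" if "X \<in> can_carr" for X
  proof -
    obtain x y where X: "X = (x, y)" by force
    have y: "y n \<in> carr (l2_space (W n))" for n using that by (simp add: X can_carr_iff)
    have "x \<in> (\<lambda>(v, w). hadd V_space (S_H \<alpha> \<mu> m H v) (S_G \<alpha> \<mu> m G w)) ` (carr V_space \<times> carr W_space)"
      using that by (simp add: X can_carr_iff bij_betw_imp_surj_on[OF S_sum_bij])
    then obtain v w0 where vw: "v \<in> carr V_space" "w0 \<in> carr W_space"
      "x = hadd V_space (S_H \<alpha> \<mu> m H v) (S_G \<alpha> \<mu> m G w0)"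
      by blast
    define w where "w = (\<lambda>n. case n of 0 \<Rightarrow> w0 | Suc k \<Rightarrow> D k (y k))"
    have "w n \<in> carr (l2_space (W n))" for n
      using vw(2) y D_surj by (cases n) (auto simp: w_def W_0)
    moreover have "summable (\<lambda>n. Re (hip (l2_space (W n)) (w n) (w n)))"
      using that by (subst summable_Suc_iff[symmetric]) (simp add: w_def hip_D[OF y] X can_carr_iff)
    ultimately have "(v, w) \<in> can_carr" using vw(1) by (simp add: can_carr_iff)
    moreover have "X = can_T \<alpha> \<mu> c m H G (v, w)"
      by (simp add: X can_T_def vw(3) w_def inv_into_f_f[OF D_inj y])
    ultimately show ?thesis by blast
  qed
qed

end

lemma complementary_canonical_gmras_equivalent:
  assumes "complementary_pair \<alpha> \<mu> c m H G" "complementary_pair \<alpha> \<mu> c m H G'"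
  shows "gmra_equivalent (canonical_gmra \<alpha> \<mu> c m H G) (canonical_gmra \<alpha> \<mu> c m H G')"
proof -
  interpret complementary_pair \<alpha> \<mu> c m H G by fact
  interpret other: complementary_pair \<alpha> \<mu> c m H G' by fact
  define SG where "SG = S_G \<alpha> \<mu> m G"
  define SG' where "SG' = S_G \<alpha> \<mu> m G'"
  define u0 where "u0 = (\<lambda>F. inv_into (carr W_space) SG' (SG F))"
  define u where "u = rec_nat u0 (\<lambda>n un F. D n (un (inv_into (carr (l2_space (W n))) (D n) F)))"
  have u_0: "u 0 = u0" and u_Suc: "u (Suc n) F = D n (u n (inv_into (carr (l2_space (W n))) (D n) F))" for n F
    by (simp_all add: u_def)
  have range: "SG ` carr W_space = SG' ` carr W_space"
    unfolding SG_def SG'_def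
    using S_G_range_contains[OF other.G_complementary] other.S_G_range_contains[OF G_complementary] by blast
  have u0: "unitary_on W_space W_space u0"
    unfolding u0_def
    by (rule unitary_on_transition[OF S_G_similitude[folded SG_def] other.S_G_similitude[folded SG'_def]])
       (use ind_pos card_dker_pos other.S_G_inj range in \<open>auto simp: SG'_def hilb_closed_l2_space\<close>)
  have D_inv_unitary: "unitary_on (l2_space (W (Suc n))) (l2_space (W n))
      (\<lambda>F. inv_into (carr (l2_space (W n))) (D n) F)" for n
    by (rule unitary_on_transition[OF _ D_similitude])
       (simp_all add: similitude_def D_inj D_surj hilb_closed_l2_space)
  have D_unitary: "unitary_on (l2_space (W n)) (l2_space (W (Suc n))) (D n)" for n
    by (simp add: unitary_on_def isometry_on_iff_similitude D_similitude D_surj)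
  have u: "unitary_on (l2_space (W n)) (l2_space (W n)) (u n)" for n
  proof (induction n)
    case 0
    show ?case using u0 by (simp add: u_0 W_0)
  next
    case (Suc n)
    have "u (Suc n) = (\<lambda>F. D n (u n (inv_into (carr (l2_space (W n))) (D n) F)))"
      by (rule ext) (rule u_Suc)
    then show ?case
      using unitary_on_compose[OF unitary_on_compose[OF D_inv_unitary Suc] D_unitary] by simp
  qed
  have u_carr: "u n F \<in> carr (l2_space (W n))" if "F \<in> carr (l2_space (W n))" for n F
    using u[of n] that by (auto simp: unitary_on_def)
  have u_ip: "hip (l2_space (W n)) (u n F) (u n F') = hip (l2_space (W n)) F F'"
    if "F \<in> carr (l2_space (W n))" "F' \<in> carr (l2_space (W n))" for n F F'
    using u[of n] that by (auto simp: unitary_on_def isometry_on_def)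
  have u0_eq: "SG' (u 0 F) = SG F" if "F \<in> carr W_space" for F
    using that range by (auto simp: u_0 u0_def intro!: f_inv_into_f)
  have u_rep: "u n (rep (W n) \<gamma> F) = rep (W n) \<gamma> (u n F)" if "F \<in> carr (l2_space (W n))" for n \<gamma> F
    using that
  proof (induction n arbitrary: F \<gamma>)
    case 0
    then have F: "F \<in> carr W_space" by (simp add: W_0)
    have uF: "u 0 F \<in> carr W_space" using u_carr[of F 0] F by (simp add: W_0)
    have rep0: "rep (W 0) \<gamma> X \<in> carr W_space" if "X \<in> carr W_space" for X
      using rep_closed[OF borel_dual_W[of 0]] that by (simp add: W_0)
    \<comment> \<open>the operator for \<open>G'\<close> is injective, so it suffices to compare images under it\<close>
    have "SG' (u 0 (rep (W 0) \<gamma> F)) = SG (rep (W 0) \<gamma> F)" by (rule u0_eq[OF rep0[OF F]])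
    also have "\<dots> = rep (level_fam \<mu> m) (\<alpha> \<gamma>) (SG F)"
      unfolding SG_def S_G_def W_0 by (rule ruelle_rep[OF G_relative F])
    also have "\<dots> = rep (level_fam \<mu> m) (\<alpha> \<gamma>) (SG' (u 0 F))" by (simp add: u0_eq[OF F])
    also have "\<dots> = SG' (rep (W 0) \<gamma> (u 0 F))"
      unfolding SG'_def S_G_def W_0 by (rule ruelle_rep[OF other.G_relative uF, symmetric])
    finally have "SG' (u 0 (rep (W 0) \<gamma> F)) = SG' (rep (W 0) \<gamma> (u 0 F))" .
    moreover have "u 0 (rep (W 0) \<gamma> F) \<in> carr W_space"
      using u_carr[of "rep (W 0) \<gamma> F" 0] rep0[OF F] unfolding W_0 by blast
    ultimately show ?case
      using inj_onD[OF other.S_G_inj[folded SG'_def]] rep0[OF uF] by blast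
  next
    case (Suc n)
    define E where "E = inv_into (carr (l2_space (W n))) (D n) F"
    have E: "E \<in> carr (l2_space (W n))" "F = D n E" using D_inv[OF Suc.prems] by (simp_all add: E_def)
    have inv_D: "inv_into (carr (l2_space (W n))) (D n) (D n X) = X" if "X \<in> carr (l2_space (W n))" for X
      using that by (rule inv_into_f_f[OF D_inj])
    have "u (Suc n) (rep (W (Suc n)) \<gamma> F) = u (Suc n) (D n (rep (W n) (\<alpha> \<gamma>) E))"
      by (simp add: E D_rep)
    also have "\<dots> = D n (u n (rep (W n) (\<alpha> \<gamma>) E))"
      by (simp add: u_Suc inv_D rep_closed[OF borel_dual_W] E)
    also have "\<dots> = D n (rep (W n) (\<alpha> \<gamma>) (u n E))" by (simp add: Suc.IH[OF E(1)])
    also have "\<dots> = rep (W (Suc n)) \<gamma> (D n (u n E))" by (rule D_rep[OF u_carr[OF E(1)]])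
    also have "D n (u n E) = u (Suc n) F" by (simp add: u_Suc E_def)
    finally show ?case .
  qed

  define C where "C = can_carr"
  define T where "T = can_T \<alpha> \<mu> c m H G"
  define T' where "T' = can_T \<alpha> \<mu> c m H G'"
  define U where "U = (\<lambda>(v :: 'a l2elt, w). (v, \<lambda>n. u n (w n)))"
  have T: "bij_betw T C C" and T': "bij_betw T' C C"
    unfolding T_def T'_def C_def by (rule can_T_bij, rule other.can_T_bij)
  have U_C: "U ` C = C"
  proof (intro equalityI subsetI)
    fix X assume "X \<in> U ` C"
    then show "X \<in> C" by (auto simp: U_def C_def can_carr_iff u_carr u_ip)
  next
    fix X assume "X \<in> C"
    then obtain v w where X: "X = (v, w)" "(v, w) \<in> can_carr" by (cases X) (auto simp: C_def)
    have "\<exists>F. F \<in> carr (l2_space (W n)) \<and> u n F = w n" for n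
    proof -
      have "w n \<in> u n ` carr (l2_space (W n))"
        using X(2) u[of n] by (auto simp: can_carr_iff unitary_on_def)
      then show ?thesis by auto
    qed
    then obtain w' where w': "\<And>n. w' n \<in> carr (l2_space (W n))" "\<And>n. u n (w' n) = w n" by metis
    have "(v, w') \<in> can_carr"
      using X(2) by (auto simp: can_carr_iff w'(1) u_ip[OF w'(1) w'(1), symmetric] w'(2))
    then show "X \<in> U ` C" by (intro image_eqI[of _ _ "(v, w')"]) (auto simp: C_def U_def X(1) w'(2))
  qed
  \<comment> \<open>the components of \<open>U\<close> preserve inner products termwise, so no convergence question arises\<close>
  have "isometry_on (can_space \<alpha> \<mu> c m) (can_space \<alpha> \<mu> c m) U"
    using u unfolding isometry_on_def
    by (auto simp: can_space_def hsum_def hsum_seq_def U_def unitary_on_def isometry_on_def fun_eq_iff)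
  then have U_unitary: "unitary_on (can_space \<alpha> \<mu> c m) (can_space \<alpha> \<mu> c m) U"
    using U_C by (simp add: unitary_on_def C_def)
  have U_T: "U (T X) = T' (U X)" if "X \<in> C" for X
  proof -
    from that obtain v w where X: "X = (v, w)" "(v, w) \<in> can_carr" by (cases X) (auto simp: C_def)
    have w: "w n \<in> carr (l2_space (W n))" for n using X(2) by (simp add: can_carr_iff)
    have "SG' (u 0 (w 0)) = SG (w 0)" using w[of 0] by (intro u0_eq) (simp add: W_0)
    moreover have "inv_into (carr (l2_space (W n))) (D n) (u (Suc n) (w (Suc n))) =
        u n (inv_into (carr (l2_space (W n))) (D n) (w (Suc n)))" for n
      unfolding u_Suc by (rule inv_into_f_f[OF D_inj u_carr[OF D_inv(1)[OF w]]])
    ultimately show ?thesis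
      by (simp add: X U_def T_def T'_def can_T_def SG_def SG'_def)
  qed
  have \<delta>: "inv_into C T ` C \<subseteq> C"
    using bij_betw_imp_surj_on[OF bij_betw_inv_into[OF T]] by simp
  have U_\<delta>: "U (inv_into C T X) = inv_into C T' (U X)" if "X \<in> C" for X
    by (rule inv_into_intertwine[where U = U, OF T T' _ U_T that]) (simp_all add: U_C)
  have V0: "can_V0 \<alpha> \<mu> c m \<subseteq> C" "U ` can_V0 \<alpha> \<mu> c m = can_V0 \<alpha> \<mu> c m"
  proof -
    show "can_V0 \<alpha> \<mu> c m \<subseteq> C"
      by (auto simp: can_V0_def C_def can_carr_iff hzero_in_carr hip_hzero)
    have "u n (hzero (l2_space (W n))) = hzero (l2_space (W n))" for n
      using u[of n] by (intro similitude_zero[of 1]) (simp add: unitary_on_def isometry_on_iff_similitude)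
    then show "U ` can_V0 \<alpha> \<mu> c m = can_V0 \<alpha> \<mu> c m"
      by (auto simp: can_V0_def U_def image_def)
  qed
  have T_C: "T ` C \<subseteq> C" using T by (simp add: bij_betw_def)
  have U_rep: "U (can_rep \<alpha> \<mu> c m \<gamma> X) = can_rep \<alpha> \<mu> c m \<gamma> (U X)" if "X \<in> C" for \<gamma> X
    using that u_rep[unfolded rep_def character_mult_def[abs_def]]
    by (cases X) (auto simp: can_rep_def U_def C_def can_carr_iff)
  show ?thesis
    unfolding gmra_equivalent_def
  proof (intro exI[of _ U] conjI allI ballI)
    show "unitary_on (gspace (canonical_gmra \<alpha> \<mu> c m H G)) (gspace (canonical_gmra \<alpha> \<mu> c m H G')) U"
      using U_unitary by (simp add: canonical_gmra_def)
    show "U ` glevel (canonical_gmra \<alpha> \<mu> c m H G) j = glevel (canonical_gmra \<alpha> \<mu> c m H G') j" for j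
      using image_funpow_intertwine[where U = U, OF \<delta> U_\<delta> V0] image_funpow_intertwine[where U = U, OF T_C U_T V0]
      by (simp add: canonical_gmra_def can_delta_def T_def T'_def C_def)
    fix X assume "X \<in> carr (gspace (canonical_gmra \<alpha> \<mu> c m H G))"
    then have X: "X \<in> C" by (simp add: canonical_gmra_def C_def)
    show "U (grep (canonical_gmra \<alpha> \<mu> c m H G) \<gamma> X) = grep (canonical_gmra \<alpha> \<mu> c m H G') \<gamma> (U X)" for \<gamma>
      using U_rep[OF X] by (simp add: canonical_gmra_def)
    show "U (gdil (canonical_gmra \<alpha> \<mu> c m H G) X) = gdil (canonical_gmra \<alpha> \<mu> c m H G') (U X)"
      using U_\<delta>[OF X] by (simp add: canonical_gmra_def can_delta_def T_def T'_def C_def)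
  qed
qed

theorem corollary14:
  fixes \<alpha> :: "'g::{ab_group_add, countable} \<Rightarrow> 'g"
    and \<mu> :: "'g dual measure"
    and c :: "'g dual \<Rightarrow> 'g dual"
    and m :: "'g dual \<Rightarrow> nat"
    and H G G' :: "'g fmatrix"
  assumes "Modules.additive \<alpha>" and "inj \<alpha>"
    and "finite (cosets \<alpha>)" and "ind \<alpha> > 1"
    and "(\<Inter>n. range (\<alpha> ^^ n)) = {0}"
    and "haar \<mu>"
    and "cross_section \<alpha> c"
    and "multiplicity_function \<alpha> \<mu> m"
    and "filter_rel \<alpha> \<mu> m H"
    and "pure_isometry (l2_space (level_fam \<mu> m)) (S_H \<alpha> \<mu> m H)"
    and "complementary_filter \<alpha> \<mu> m H G"
    and "complementary_filter \<alpha> \<mu> m H G'"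
  shows "gmra_equivalent (canonical_gmra \<alpha> \<mu> c m H G) (canonical_gmra \<alpha> \<mu> c m H G')"
proof -
  have setting: "ruelle_setting \<alpha> \<mu> c m"
    using assms
    by (intro ruelle_setting.intro dual_dynamics.intro ruelle_setting_axioms.intro)
       (simp_all add: multiplicity_function_def)
  have "complementary_pair \<alpha> \<mu> c m H G" "complementary_pair \<alpha> \<mu> c m H G'"
    using assms setting by (auto intro!: complementary_pair.intro complementary_pair_axioms.intro)
  then show ?thesis by (rule complementary_canonical_gmras_equivalent)
qed

end
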